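(* The following statements hold. (i) For each integer $k\ge1$, the set $\hat{\mathcal E}_k:=\{(\beta,\mathfrak e)\in(0,1)\times[0,1):\rho_e=k\text{ and }\zeta_e\text{ is hyperbolic}\}$ is empty. (ii) For each integer $k\ge2$, the set $\mathcal D_{k+1/2}:=\{(\beta,\mathfrak e)\in(0,1)\times[0,1):\rho_e=k+1/2\text{ and }\zeta_e\text{ is hyperbolic}\}$ contains a non-empty open subset of $[0,1]\times[0,1)$. Moreover, both $\mathcal D_{5/2}$ and $\mathcal D_{7/2}$ contain non-empty open subsets of $\mathcal D$. (iii) The subset $\mathcal D_{\mathcal R}:=\{(\beta,\mathfrak e)\in\mathcal D:\rho_e\in\mathbb Q\}$ is dense in $\mathcal D$ and contains a non-empty open set. Moreover, the subset $\mathcal D_{\rm odd/even}\subset\mathcal D$ of parameters $(\beta,\mathfrak e)$ for which $\rho_e=p/q\in\mathbb Q$, with $p>0$ odd and $q$ even, is dense in $\mathcal D$ and contains a non-empty open set.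
   Context: For $\varpi,\alpha>0$ consider $H(p_r,p_z,r,z)=\frac{p_r^2+p_z^2}{2}+V(r,z)$ on $\mathbb R^2\times\mathbb R^+\times\mathbb R$, with $V(r,z)=\frac{\varpi^2}{2r^2}-\frac1r-\frac{4\alpha^{-1}}{(r^2+(1+2\alpha)z^2)^{1/2}}$, $\omega_0=dp_r\wedge dr+dp_z\wedge dz$, $X_H$ given by $\omega_0(X_H,\cdot)=-dH$, and $\mathfrak M=H^{-1}(-1)$. The parameters $(\alpha,\varpi)$ are replaced by $\beta=(1+4\alpha^{-1})^{-1}$ and $\mathfrak e=(1-2\varpi^2\beta^2)^{1/2}$. Let $\mathcal D=\{(\beta,\mathfrak e):0<\beta^2+\mathfrak e^2<1,\ \beta,\mathfrak e>0\}$; $(\beta,\mathfrak e)\in\mathcal D$ is equivalent to $\frac12<\varpi^2<\frac{(1+4\alpha^{-1})^2}{2}$. The Euler orbit $\zeta_e=\mathfrak M\cap\{z=p_z=0\}$ is a periodic orbit for every $(\beta,\mathfrak e)\in(0,1)\times(0,1)$. Its rotation number $\rho_e$ is defined as follows: let $X_1=\partial_zV\,\partial_{p_r}-\partial_rV\,\partial_{p_z}+p_z\partial_r-p_r\partial_z$, $X_2=-p_z\partial_{p_r}+p_r\partial_{p_z}+\partial_zV\,\partial_r-\partial_rV\,\partial_z$; the linearized flow along $\zeta_e$ on $T\mathfrak M/\mathbb RX_H$ in the frame $\{X_1,X_2\}$ ($a_1X_1+a_2X_2\leftrightarrow a_1+\sqrt{-1}a_2$) is a path $\Psi(t)$ with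 $\Psi(0)=I$, and $\rho_e=T_e\lim_{t\to\infty}\frac{\eta(t)}{2\pi t}$, where $T_e$ is the least period and $\eta$ is a continuous argument of $\Psi(t)v$, $v\ne0$. The orbit is hyperbolic if the eigenvalues of the transverse linearized first return map do not lie on the unit circle. Equivalently, after reparametrizing $\zeta_e$ by an angle $\theta\in\mathbb R/2\pi\mathbb Z$ and a periodic symplectic change of frame of Maslov index $0$, the linearized flow in the $(p_z,z)$-plane becomes $\xi'=J_0\,\mathrm{diag}\bigl(1,\,1+7\beta(1+\mathfrak e\cos\theta)^{-1}\bigr)\xi$, $J_0=\begin{pmatrix}0&-1\\1&0\end{pmatrix}$, and $\rho_e=1+\hat\rho$, where $\hat\rho=\lim_{\theta\to\infty}\arg\xi(\theta)/\theta$ for any nonzero solution $\xi=(a,b)^T\leftrightarrow a+\sqrt{-1}b$; $\zeta_e$ is hyperbolic iff the time-$2\pi$ map of this system has no eigenvalue on the unit circle. For $\mathfrak e=0$ (where $\zeta_e$ collapses to an equilibrium) $\rho_e$ and hyperbolicity are understood through this linear system. *)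

theory Defs
  imports "HOL-Analysis.Analysis"
begin

section \<open>The Hamiltonian\<close>

text \<open>A point of phase space is the tuple (p_r, p_z, r, z); the half-space condition r > 0 is
  imposed in \<open>energy_surface\<close>.\<close>

type_synonym phase = "real \<times> real \<times> real \<times> real"

definition potential :: "real \<Rightarrow> real \<Rightarrow> real \<Rightarrow> real \<Rightarrow> real" where
  "potential \<alpha> w r z =
     w\<^sup>2 / (2 * r\<^sup>2) - 1 / r - (4 / \<alpha>) / sqrt (r\<^sup>2 + (1 + 2 * \<alpha>) * z\<^sup>2)"

definition hamiltonian :: "real \<Rightarrow> real \<Rightarrow> phase \<Rightarrow> real" where
  "hamiltonian \<alpha> w = (\<lambda>(pr, pz, r, z). (pr\<^sup>2 + pz\<^sup>2) / 2 + potential \<alpha> w r z)"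

text \<open>The form dp_r \<open>\<and>\<close> dr + dp_z \<open>\<and>\<close> dz.\<close>

definition omega0 :: "phase \<Rightarrow> phase \<Rightarrow> real" where
  "omega0 = (\<lambda>(a, b, c, d) (a', b', c', d'). (a * c' - c * a') + (b * d' - d * b'))"

definition ham_field :: "(phase \<Rightarrow> real) \<Rightarrow> phase \<Rightarrow> phase" where
  "ham_field H x = (THE X. \<forall>Y. omega0 X Y = - frechet_derivative H (at x) Y)"

abbreviation X_H :: "real \<Rightarrow> real \<Rightarrow> phase \<Rightarrow> phase" where
  "X_H \<alpha> w \<equiv> ham_field (hamiltonian \<alpha> w)"

definition energy_surface :: "real \<Rightarrow> real \<Rightarrow> phase set" where
  "energy_surface \<alpha> w = {(pr, pz, r, z). r > 0 \<and> hamiltonian \<alpha> w (pr, pz, r, z) = -1}"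

definition euler_orbit :: "real \<Rightarrow> real \<Rightarrow> phase set" where
  "euler_orbit \<alpha> w = energy_surface \<alpha> w \<inter> {(pr, pz, r, z). z = 0 \<and> pz = 0}"

definition dV_dr :: "real \<Rightarrow> real \<Rightarrow> real \<Rightarrow> real \<Rightarrow> real" where
  "dV_dr \<alpha> w r z = deriv (\<lambda>s. potential \<alpha> w s z) r"

definition dV_dz :: "real \<Rightarrow> real \<Rightarrow> real \<Rightarrow> real \<Rightarrow> real" where
  "dV_dz \<alpha> w r z = deriv (\<lambda>s. potential \<alpha> w r s) z"

definition X1 :: "real \<Rightarrow> real \<Rightarrow> phase \<Rightarrow> phase" where
  "X1 \<alpha> w = (\<lambda>(pr, pz, r, z). (dV_dz \<alpha> w r z, - dV_dr \<alpha> w r z, pz, - pr))"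

definition X2 :: "real \<Rightarrow> real \<Rightarrow> phase \<Rightarrow> phase" where
  "X2 \<alpha> w = (\<lambda>(pr, pz, r, z). (- pz, pr, dV_dz \<alpha> w r z, - dV_dr \<alpha> w r z))"


section \<open>Paths of two-by-two matrices\<close>

text \<open>\<open>has_rotation_rate \<Psi> c\<close>: for every nonzero \<open>v\<close>, a continuous argument \<open>\<eta>\<close> of \<open>\<Psi>(t) v\<close> satisfies
  \<open>\<eta>(t)/t \<longrightarrow> c\<close> (two such arguments differ by a constant).\<close>

definition vec_complex :: "real ^ 2 \<Rightarrow> complex" where
  "vec_complex a = Complex (a $ 1) (a $ 2)"

definition continuous_argument :: "(real \<Rightarrow> complex) \<Rightarrow> (real \<Rightarrow> real) \<Rightarrow> bool" where
  "continuous_argument f \<eta> \<longleftrightarrow> continuous_on {0..} \<eta> \<and>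
     (\<forall>t\<ge>0. f t \<noteq> 0 \<and> f t = of_real (cmod (f t)) * cis (\<eta> t))"

definition has_rotation_rate :: "(real \<Rightarrow> real ^ 2 ^ 2) \<Rightarrow> real \<Rightarrow> bool" where
  "has_rotation_rate \<Psi> c \<longleftrightarrow> (\<forall>v. v \<noteq> 0 \<longrightarrow>
     (\<exists>\<eta>. continuous_argument (\<lambda>t. vec_complex (\<Psi> t *v v)) \<eta> \<and>
          ((\<lambda>t. \<eta> t / t) \<longlongrightarrow> c) at_top))"

definition complex_eigenvalue :: "real ^ 2 ^ 2 \<Rightarrow> complex \<Rightarrow> bool" where
  "complex_eigenvalue A \<mu> \<longleftrightarrow>
     (\<exists>u :: complex ^ 2. u \<noteq> 0 \<and> map_matrix complex_of_real A *v u = \<mu> *s u)"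

definition hyperbolic_matrix :: "real ^ 2 ^ 2 \<Rightarrow> bool" where
  "hyperbolic_matrix A \<longleftrightarrow> (\<forall>\<mu>. complex_eigenvalue A \<mu> \<longrightarrow> cmod \<mu> \<noteq> 1)"


section \<open>The linearized flow along the Euler orbit\<close>

definition euler_solution :: "real \<Rightarrow> real \<Rightarrow> (real \<Rightarrow> phase) \<Rightarrow> bool" where
  "euler_solution \<alpha> w \<gamma> \<longleftrightarrow>
     (\<forall>t. \<gamma> t \<in> euler_orbit \<alpha> w \<and> (\<gamma> has_vector_derivative X_H \<alpha> w (\<gamma> t)) (at t))"

definition least_period :: "(real \<Rightarrow> phase) \<Rightarrow> real \<Rightarrow> bool" where
  "least_period \<gamma> T \<longleftrightarrow> T > 0 \<and> (\<forall>t. \<gamma> (t + T) = \<gamma> t) \<and>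
     (\<forall>S. 0 < S \<and> S < T \<longrightarrow> (\<exists>t. \<gamma> (t + S) \<noteq> \<gamma> t))"

definition variational_solution ::
    "real \<Rightarrow> real \<Rightarrow> (real \<Rightarrow> phase) \<Rightarrow> (real \<Rightarrow> phase) \<Rightarrow> bool" where
  "variational_solution \<alpha> w \<gamma> Y \<longleftrightarrow>
     (\<forall>t. (Y has_vector_derivative frechet_derivative (X_H \<alpha> w) (at (\<gamma> t)) (Y t)) (at t))"

text \<open>\<open>\<Psi>\<close> is the matrix of the linearized flow on the quotient of the tangent bundle of the energy
  surface by the line field of \<open>X_H\<close>, in the frame induced by \<open>X1\<close>, \<open>X2\<close>. As this frame is
  \<open>T\<close>-periodic along the orbit, \<open>\<Psi> T\<close> represents the transverse linearized first return map.\<close>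

definition transverse_flow ::
    "real \<Rightarrow> real \<Rightarrow> (real \<Rightarrow> phase) \<Rightarrow> (real \<Rightarrow> real ^ 2 ^ 2) \<Rightarrow> bool" where
  "transverse_flow \<alpha> w \<gamma> \<Psi> \<longleftrightarrow> \<Psi> 0 = mat 1 \<and>
     (\<forall>v. \<exists>Y. variational_solution \<alpha> w \<gamma> Y \<and>
        (\<forall>t. Y t - ((\<Psi> t *v v) $ 1 *\<^sub>R X1 \<alpha> w (\<gamma> t) + (\<Psi> t *v v) $ 2 *\<^sub>R X2 \<alpha> w (\<gamma> t))
               \<in> span {X_H \<alpha> w (\<gamma> t)}))"

text \<open>Neither notion depends on the choice of the parametrization \<open>\<gamma>\<close> (unique up to a time
  shift).\<close>

definition orbit_rotation_number :: "real \<Rightarrow> real \<Rightarrow> real" where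
  "orbit_rotation_number \<alpha> w = (THE \<rho>. \<exists>\<gamma> T \<Psi> c. euler_solution \<alpha> w \<gamma> \<and> least_period \<gamma> T \<and>
     transverse_flow \<alpha> w \<gamma> \<Psi> \<and> has_rotation_rate \<Psi> c \<and> \<rho> = T * (c / (2 * pi)))"

definition orbit_hyperbolic :: "real \<Rightarrow> real \<Rightarrow> bool" where
  "orbit_hyperbolic \<alpha> w \<longleftrightarrow> (\<exists>\<gamma> T \<Psi>. euler_solution \<alpha> w \<gamma> \<and> least_period \<gamma> T \<and>
     transverse_flow \<alpha> w \<gamma> \<Psi> \<and> hyperbolic_matrix (\<Psi> T))"


section \<open>The linear system in the angle variable\<close>

definition J0 :: "real ^ 2 ^ 2" where
  "J0 = vector [vector [0, -1], vector [1, 0]]"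

definition lin_coeff :: "real \<Rightarrow> real \<Rightarrow> real \<Rightarrow> real ^ 2 ^ 2" where
  "lin_coeff \<beta> e \<theta> =
     J0 ** vector [vector [1, 0], vector [0, 1 + 7 * \<beta> / (1 + e * cos \<theta>)]]"

definition lin_fundamental :: "real \<Rightarrow> real \<Rightarrow> (real \<Rightarrow> real ^ 2 ^ 2) \<Rightarrow> bool" where
  "lin_fundamental \<beta> e \<Phi> \<longleftrightarrow> \<Phi> 0 = mat 1 \<and>
     (\<forall>\<theta>. (\<Phi> has_vector_derivative lin_coeff \<beta> e \<theta> ** \<Phi> \<theta>) (at \<theta>))"

definition lin_rotation_number :: "real \<Rightarrow> real \<Rightarrow> real" where
  "lin_rotation_number \<beta> e = (THE c. \<exists>\<Phi>. lin_fundamental \<beta> e \<Phi> \<and> has_rotation_rate \<Phi> c)"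

definition lin_hyperbolic :: "real \<Rightarrow> real \<Rightarrow> bool" where
  "lin_hyperbolic \<beta> e \<longleftrightarrow> (\<exists>\<Phi>. lin_fundamental \<beta> e \<Phi> \<and> hyperbolic_matrix (\<Phi> (2 * pi)))"


section \<open>The parameters\<close>

definition beta_of :: "real \<Rightarrow> real" where
  "beta_of \<alpha> = inverse (1 + 4 / \<alpha>)"

definition ecc_of :: "real \<Rightarrow> real \<Rightarrow> real" where
  "ecc_of \<alpha> w = sqrt (1 - 2 * w\<^sup>2 * (beta_of \<alpha>)\<^sup>2)"

text \<open>The inverse of \<open>(\<alpha>, w) \<mapsto> (beta_of \<alpha>, ecc_of \<alpha> w)\<close>; see \<open>parameters_iff\<close>.\<close>

definition alpha_of :: "real \<Rightarrow> real" where
  "alpha_of \<beta> = 4 * \<beta> / (1 - \<beta>)"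

definition varpi_of :: "real \<Rightarrow> real \<Rightarrow> real" where
  "varpi_of \<beta> e = sqrt ((1 - e\<^sup>2) / 2) / \<beta>"

lemma parameters_iff:
  assumes "0 < \<beta>" "\<beta> < 1" "0 \<le> e" "e < 1"
  shows "(0 < \<alpha> \<and> 0 < w \<and> 2 * w\<^sup>2 * (beta_of \<alpha>)\<^sup>2 \<le> 1 \<and> beta_of \<alpha> = \<beta> \<and> ecc_of \<alpha> w = e) \<longleftrightarrow>
         (\<alpha> = alpha_of \<beta> \<and> w = varpi_of \<beta> e)"
proof -
  have e2: "e\<^sup>2 < 1" using assms by (simp add: power_less_one_iff abs_square_less_1)
  have a: "(0 < \<alpha> \<and> beta_of \<alpha> = \<beta>) \<longleftrightarrow> \<alpha> = alpha_of \<beta>"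
  proof
    assume h: "0 < \<alpha> \<and> beta_of \<alpha> = \<beta>"
    then have "1 + 4 / \<alpha> = (\<alpha> + 4) / \<alpha>" by (simp add: add_divide_distrib)
    then have "\<beta> = \<alpha> / (\<alpha> + 4)" using h by (simp add: beta_of_def)
    then have "\<beta> * (\<alpha> + 4) = \<alpha>" using h by simp
    then have "\<alpha> * (1 - \<beta>) = 4 * \<beta>" by (simp add: algebra_simps)
    then show "\<alpha> = alpha_of \<beta>"
      using assms by (simp add: alpha_of_def eq_divide_eq)
  next
    assume h: "\<alpha> = alpha_of \<beta>"
    have "1 + 4 / \<alpha> = 1 / \<beta>" using assms by (simp add: h alpha_of_def field_simps)
    then show "0 < \<alpha> \<and> beta_of \<alpha> = \<beta>"
      using assms by (simp add: h alpha_of_def beta_of_def)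
  qed
  have b: "(0 < w \<and> 2 * w\<^sup>2 * \<beta>\<^sup>2 \<le> 1 \<and> sqrt (1 - 2 * w\<^sup>2 * \<beta>\<^sup>2) = e) \<longleftrightarrow> w = varpi_of \<beta> e"
  proof
    assume h: "0 < w \<and> 2 * w\<^sup>2 * \<beta>\<^sup>2 \<le> 1 \<and> sqrt (1 - 2 * w\<^sup>2 * \<beta>\<^sup>2) = e"
    then have "e\<^sup>2 = 1 - 2 * w\<^sup>2 * \<beta>\<^sup>2" by auto
    then have "(1 - e\<^sup>2) / 2 = (w * \<beta>)\<^sup>2" by (simp add: power_mult_distrib)
    then show "w = varpi_of \<beta> e" using h assms by (simp add: varpi_of_def)
  next
    assume h: "w = varpi_of \<beta> e"
    then have "(w * \<beta>)\<^sup>2 = (1 - e\<^sup>2) / 2" using assms e2 by (simp add: varpi_of_def)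
    then have q: "2 * w\<^sup>2 * \<beta>\<^sup>2 = 1 - e\<^sup>2" by (simp add: power_mult_distrib)
    show "0 < w \<and> 2 * w\<^sup>2 * \<beta>\<^sup>2 \<le> 1 \<and> sqrt (1 - 2 * w\<^sup>2 * \<beta>\<^sup>2) = e"
      unfolding q using h assms e2 by (simp add: varpi_of_def)
  qed
  show ?thesis using a b by (auto simp: ecc_of_def)
qed

text \<open>For \<open>e = 0\<close> the Euler orbit is an equilibrium, and rotation number and hyperbolicity are those
  of the linear system.\<close>

definition rho_e :: "real \<Rightarrow> real \<Rightarrow> real" where
  "rho_e \<beta> e = (if e = 0 then 1 + lin_rotation_number \<beta> e
                else orbit_rotation_number (alpha_of \<beta>) (varpi_of \<beta> e))"

definition euler_hyperbolic :: "real \<Rightarrow> real \<Rightarrow> bool" where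
  "euler_hyperbolic \<beta> e \<longleftrightarrow> (if e = 0 then lin_hyperbolic \<beta> e
                else orbit_hyperbolic (alpha_of \<beta>) (varpi_of \<beta> e))"

definition hyperbolic_locus :: "real \<Rightarrow> (real \<times> real) set" where
  "hyperbolic_locus c =
     {(\<beta>, e). \<beta> \<in> {0<..<1} \<and> e \<in> {0..<1} \<and> rho_e \<beta> e = c \<and> euler_hyperbolic \<beta> e}"

definition D_dom :: "(real \<times> real) set" where
  "D_dom = {(\<beta>, e). 0 < \<beta>\<^sup>2 + e\<^sup>2 \<and> \<beta>\<^sup>2 + e\<^sup>2 < 1 \<and> \<beta> > 0 \<and> e > 0}"

definition D_rational :: "(real \<times> real) set" where
  "D_rational = {(\<beta>, e). (\<beta>, e) \<in> D_dom \<and> rho_e \<beta> e \<in> \<rat>}"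

definition D_odd_even :: "(real \<times> real) set" where
  "D_odd_even = {(\<beta>, e). (\<beta>, e) \<in> D_dom \<and>
     (\<exists>p q :: int. p > 0 \<and> odd p \<and> q > 0 \<and> even q \<and> rho_e \<beta> e = of_int p / of_int q)}"

end

theory Submission
  imports Defs
begin

text \<open>Dividing \<open>z\<close> by \<open>r\<close> and using the true anomaly as time turns the normal variational equation
  into the Hill equation \<open>b'' + q b = 0\<close>, \<open>q = 1 + 7 \<beta> / (1 + e cos \<theta>)\<close>; the frame \<open>X1, X2\<close> turns once
  backwards per period, so \<open>\<rho>\<^sub>e = 1 + rot\<close>. As \<open>q\<close> is even, the trace of the monodromy matrix is
  \<open>2 + 4 y1'(\<pi>) y2(\<pi>) = -2 + 4 y1(\<pi>) y2'(\<pi>)\<close> for the even and odd solutions \<open>y1, y2\<close>.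

  (i) The equation is of Ince type: in Fourier coefficients the coupling through the modes \<open>\<plusminus>1\<close>
  vanishes, so sine and cosine series satisfy the same recurrence and periodic solutions always
  coexist. A first crossing argument in \<open>\<beta>\<close> then gives \<open>y1'(\<pi>) y2(\<pi>) \<le> 0\<close>, hence trace at most 2,
  and hyperbolicity forces a half-integer rotation number. (ii) For antiperiodic solutions the
  Casoratian of the two recurrences excludes coexistence when \<open>e > 0\<close>, so the trace drops below
  \<open>-2\<close> next to every parameter with rotation number \<open>m + 1/2\<close>; these exist for all \<open>m\<close> because the
  number of oscillations near \<open>\<theta> = \<pi>\<close> tends to infinity as \<open>e \<rightarrow> 1\<close>. (iii) Where the trace lies in
  \<open>(-2, 2)\<close> it is not locally constant in \<open>\<beta>\<close>, hence some power of the monodromy matrix equals \<open>-1\<close>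
  at nearby parameters.\<close>

section \<open>Hill's equation\<close>

text \<open>Multiplied by \<open>1 + e cos \<theta>\<close> and with \<open>k = 7 \<beta>\<close>,
  the Hill equation reads \<open>y'' + (1 + k) y + e cos \<theta> (y'' + y) = 0\<close>. Only the
  operator \<open>y'' + y\<close> couples neighbouring Fourier modes, and it kills the modes 1 and
  -1. Half-integer modes never meet these two, so for antiperiodic solutions the chain stays
  connected and the opposite conclusion holds. Derivatives with respect to \<open>k\<close> are
  avoided: Lagrange's identity compares two parameters directly, and the sign of its integral is
  known once they are close. Continuity of the rotation number is avoided as well; inside a gap it
  is a half-integer, and the angle that one fixed solution reaches at \<open>2 pi\<close>, which is
  continuous in the parameters, tells which one. Since \<open>\<beta> < 1\<close> means
  \<open>k < 7\<close>, zeros are sought up to \<open>k = 63/10\<close> and gaps found below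
  \<open>64/10\<close>; then \<open>\<beta> < 64/70\<close>, and with \<open>e = 1/10\<close> the
  point lies in \<open>D_dom\<close>.\<close>

text \<open>A solution \<open>y\<close> of \<open>y'' + q y = 0\<close> is represented by the complex number \<open>y' + \<i> y\<close>.\<close>

definition hill_field :: "real \<Rightarrow> complex \<Rightarrow> complex" where
  "hill_field k x = Complex (- k * Im x) (Re x)"

lemma continuous_on_hill_field [continuous_intros]:
  "continuous_on A f \<Longrightarrow> continuous_on A g \<Longrightarrow> continuous_on A (\<lambda>x. hill_field (f x) (g x))"
  unfolding hill_field_def Complex_eq by (intro continuous_intros)

lemma hill_field_sum: "hill_field k (\<Sum>i\<in>A. f i) = (\<Sum>i\<in>A. hill_field k (f i))"
  by (induction A rule: infinite_finite_induct) (auto simp: hill_field_def complex_eq_iff algebra_simps)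

lemma norm_hill_field_le: "norm (hill_field k x) \<le> (1 + \<bar>k\<bar>) * norm x"
proof -
  have "norm (hill_field k x) \<le> \<bar>- k * Im x\<bar> + \<bar>Re x\<bar>"
    unfolding hill_field_def using cmod_le[of "Complex (- k * Im x) (Re x)"] by simp
  also have "\<dots> \<le> \<bar>k\<bar> * norm x + norm x"
    by (intro add_mono) (auto simp: abs_mult abs_Re_le_cmod abs_Im_le_cmod intro: mult_left_mono)
  finally show ?thesis by (simp add: algebra_simps)
qed

text \<open>The Picard integrals are rescaled to \<open>[0, 1]\<close>: this covers negative times as well and makes the
  iterates jointly continuous in time and parameters.\<close>

primrec picard :: "(real \<Rightarrow> real) \<Rightarrow> complex \<Rightarrow> nat \<Rightarrow> real \<Rightarrow> complex" where
  "picard q z 0 = (\<lambda>t. z)"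
| "picard q z (Suc n) = (\<lambda>t. t *\<^sub>R integral {0..1} (\<lambda>s. hill_field (q (t * s)) (picard q z n (t * s))))"

text \<open>The terms of \<open>picard\<close> are the successive increments of the Picard
  iteration, available one by one because the equation is linear. The flow is therefore a series, to
  which the Weierstrass test applies.\<close>

definition hill_flow :: "(real \<Rightarrow> real) \<Rightarrow> complex \<Rightarrow> real \<Rightarrow> complex" where
  "hill_flow q z t = (\<Sum>n. picard q z n t)"

text \<open>After the substitution \<open>x = t s\<close> this is the integral from 0 to
  \<open>t\<close>, for either sign of \<open>t\<close>. The same device serves for the logarithm of
  a solution and for the time along the orbit.\<close>

lemma has_vector_derivative_scaled_integral:
  fixes f :: "real \<Rightarrow> 'a::banach"
  assumes f: "continuous_on UNIV f"
  shows "((\<lambda>t. t *\<^sub>R integral {0..1} (\<lambda>s. f (t * s))) has_vector_derivative f t) (at t)"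
proof -
  define N where "N = \<bar>t\<bar> + 1"
  obtain g where g: "\<And>x. x \<in> {-N..N} \<Longrightarrow> (g has_vector_derivative f x) (at x within {-N..N})"
    using antiderivative_continuous[OF continuous_on_subset[OF f subset_UNIV]] by blast
  have eq: "u *\<^sub>R integral {0..1} (\<lambda>s. f (u * s)) = g u - g 0" if u: "u \<in> {-N..N}" for u
  proof -
    have sub: "(\<lambda>s. u * s) ` {0..1} \<subseteq> {-N..N}"
    proof safe
      fix s :: real assume s: "s \<in> {0..1}"
      have "\<bar>u * s\<bar> \<le> N * 1" unfolding abs_mult using u s by (intro mult_mono) auto
      then show "u * s \<in> {-N..N}" by auto
    qed
    have "((\<lambda>s. u *\<^sub>R f (u * s)) has_integral g (u * 1) - g (u * 0)) {0..1}"
    proof (rule fundamental_theorem_of_calculus)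
      fix s :: real assume s: "s \<in> {0..1}"
      have "((\<lambda>s. u * s) has_vector_derivative u) (at s within {0..1})"
        by (auto intro!: derivative_eq_intros)
      moreover have "(g has_vector_derivative f (u * s)) (at (u * s) within (\<lambda>s. u * s) ` {0..1})"
        using g[of "u * s"] sub s by (meson has_vector_derivative_within_subset imageI subsetD)
      ultimately show "((\<lambda>s. g (u * s)) has_vector_derivative u *\<^sub>R f (u * s)) (at s within {0..1})"
        using vector_diff_chain_within[of "\<lambda>s. u * s" u s "{0..1}" g] by (simp add: o_def)
    qed simp
    then show ?thesis by (simp add: integral_unique flip: integral_cmul)
  qed
  have t: "t \<in> {-N<..<N}" by (auto simp: N_def)
  have "(g has_vector_derivative f t) (at t)"
    using g[of t] t at_within_interior[of t "{-N..N}"] by (auto simp: interior_atLeastAtMost_real)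
  then have "((\<lambda>u. g u - g 0) has_vector_derivative f t) (at t)"
    by (auto intro!: derivative_eq_intros)
  then show ?thesis
    by (rule has_vector_derivative_transform_within_open[OF _ open_greaterThanLessThan t])
       (use eq in auto)
qed

text \<open>The domain of integration does not depend on \<open>t\<close>, so continuity of
  parameter integrals over a compact interval gives joint continuity in one stroke.\<close>

lemma continuous_on_picard:
  fixes q :: "'p::t2_space \<Rightarrow> real \<Rightarrow> real"
  assumes q: "continuous_on (P \<times> UNIV) (\<lambda>(p, t). q p t)"
  shows "continuous_on (P \<times> UNIV) (\<lambda>(p, t). picard (q p) z n t)"
proof (induction n)
  case (Suc n)
  have c: "continuous_on ((P \<times> UNIV) \<times> cbox 0 1) (\<lambda>x. (\<lambda>(p, t). f p t) (fst (fst x), snd (fst x) * snd x))"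
    if "continuous_on (P \<times> UNIV) (\<lambda>(p, t). f p t)" for f :: "'p \<Rightarrow> real \<Rightarrow> 'b::topological_space"
    by (rule continuous_on_compose2[OF that]) (auto intro!: continuous_intros)
  have "continuous_on ((P \<times> UNIV) \<times> cbox 0 1)
     (\<lambda>x. hill_field (q (fst (fst x)) (snd (fst x) * snd x)) (picard (q (fst (fst x))) z n (snd (fst x) * snd x)))"
    using c[OF q] c[OF Suc] by (intro continuous_intros) auto
  then have "continuous_on ((P \<times> UNIV) \<times> cbox 0 1)
     (\<lambda>(x, s). hill_field (q (fst x) (snd x * s)) (picard (q (fst x)) z n (snd x * s)))"
    by (simp add: case_prod_unfold)
  from integral_continuous_on_param[OF this]
  have "continuous_on (P \<times> UNIV) (\<lambda>x. snd x *\<^sub>R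
      integral {0..1} (\<lambda>s. hill_field (q (fst x) (snd x * s)) (picard (q (fst x)) z n (snd x * s))))"
    by (intro continuous_intros) simp
  then show ?case by (simp add: case_prod_unfold)
qed (simp add: case_prod_unfold)

lemma continuous_on_picard1:
  assumes q: "continuous_on UNIV q" shows "continuous_on A (picard q z n)"
proof -
  have q': "continuous_on (UNIV \<times> UNIV) (\<lambda>(p::real, t). q t)"
    by (auto simp: case_prod_unfold intro!: continuous_on_compose2[OF q] continuous_intros)
  have "continuous_on A (\<lambda>t. (\<lambda>(p::real, t). picard q z n t) (0, t))"
    by (rule continuous_on_compose2[OF continuous_on_picard[OF q']]) (auto intro!: continuous_intros)
  then show ?thesis by simp
qed

lemma norm_picard_le:
  assumes q: "continuous_on UNIV q" and C: "\<And>t. 1 + \<bar>q t\<bar> \<le> C"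
  shows "norm (picard q z n t) \<le> norm z * (C * \<bar>t\<bar>) ^ n / fact n"
proof (induction n arbitrary: t)
  case (Suc n)
  have C0: "C \<ge> 1" using C[of 0] by linarith
  let ?f = "\<lambda>s. hill_field (q (t * s)) (picard q z n (t * s))"
  let ?g = "\<lambda>s::real. C * (norm z * (C * \<bar>t\<bar>) ^ n / fact n) * s ^ n"
  have cont: "continuous_on {0..1} ?f"
    by (intro continuous_intros continuous_on_compose2[OF q] continuous_on_compose2[OF continuous_on_picard1[OF q, of UNIV]]) auto
  have g: "(?g has_integral C * (norm z * (C * \<bar>t\<bar>) ^ n / fact n) * (1 / real (Suc n))) {0..1}"
  proof (rule has_integral_mult_right)
    have "((\<lambda>s. s ^ n) has_integral 1 ^ (Suc n) / real (Suc n) - 0 ^ (Suc n) / real (Suc n)) {0..1::real}"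
    proof (rule fundamental_theorem_of_calculus)
      fix s :: real
      have "((\<lambda>s. s ^ Suc n / real (Suc n)) has_real_derivative s ^ n) (at s within {0..1})"
        using DERIV_cdivide[OF DERIV_pow[of "Suc n" s], of "real (Suc n)"] by (simp del: of_nat_Suc)
      then show "((\<lambda>s. s ^ Suc n / real (Suc n)) has_vector_derivative s ^ n) (at s within {0..1})"
        by (simp add: has_real_derivative_iff_has_vector_derivative)
    qed simp
    then show "((\<lambda>s. s ^ n) has_integral 1 / real (Suc n)) {0..1::real}" by simp
  qed
  have "norm (integral {0..1} ?f) \<le> integral {0..1} ?g"
  proof (rule integral_norm_bound_integral)
    show "?f integrable_on {0..1}" using cont integrable_continuous_real by blast
    show "?g integrable_on {0..1}" using g by blast
    fix s :: real assume s: "s \<in> {0..1}"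
    have "norm (?f s) \<le> (1 + \<bar>q (t * s)\<bar>) * norm (picard q z n (t * s))" by (rule norm_hill_field_le)
    also have "\<dots> \<le> C * (norm z * (C * \<bar>t * s\<bar>) ^ n / fact n)"
      using C Suc.IH C0 by (intro mult_mono) auto
    also have "\<dots> = ?g s" using s by (simp add: abs_mult power_mult_distrib)
    finally show "norm (?f s) \<le> ?g s" .
  qed
  also have "\<dots> = C * (norm z * (C * \<bar>t\<bar>) ^ n / fact n) * (1 / real (Suc n))"
    using g by (rule integral_unique)
  finally have "\<bar>t\<bar> * norm (integral {0..1} ?f) \<le> \<bar>t\<bar> * (C * (norm z * (C * \<bar>t\<bar>) ^ n / fact n) * (1 / real (Suc n)))"
    by (rule mult_left_mono) simp
  then show ?case by (simp add: field_simps)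
qed simp

text \<open>Domination by the exponential series, uniform in the parameters because one
  \<open>C\<close> bounds all coefficients; only the time is kept in a bounded interval.\<close>

lemma uniform_limit_picard:
  fixes q :: "'p \<Rightarrow> real \<Rightarrow> real"
  assumes q: "\<And>p. p \<in> P \<Longrightarrow> continuous_on UNIV (q p)"
    and C: "\<And>p t. p \<in> P \<Longrightarrow> 1 + \<bar>q p t\<bar> \<le> C"
  shows "uniform_limit (P \<times> {-R..R}) (\<lambda>n (p, t). \<Sum>i<n. picard (q p) z i t)
           (\<lambda>(p, t). hill_flow (q p) z t) sequentially"
proof -
  have "uniform_limit (P \<times> {-R..R}) (\<lambda>n x. \<Sum>i<n. picard (q (fst x)) z i (snd x))
           (\<lambda>x. \<Sum>i. picard (q (fst x)) z i (snd x)) sequentially"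
  proof (rule Weierstrass_m_test)
    fix n x assume x: "x \<in> P \<times> {-R..R}"
    have C0: "C \<ge> 1" using C[of "fst x" 0] x by auto
    have "norm (picard (q (fst x)) z n (snd x)) \<le> norm z * (C * \<bar>snd x\<bar>) ^ n / fact n"
      by (rule norm_picard_le) (use x q C in auto)
    also have "\<dots> \<le> norm z * ((C * R) ^ n / fact n)"
      unfolding times_divide_eq_right
      using C0 x by (intro divide_right_mono mult_left_mono power_mono mult_mono) auto
    finally show "norm (picard (q (fst x)) z n (snd x)) \<le> norm z * ((C * R) ^ n / fact n)" .
  next
    show "summable (\<lambda>n. norm z * ((C * R) ^ n / fact n))"
      using summable_exp[of "C * R"] by (intro summable_mult) (simp add: divide_inverse mult.commute)
  qed
  then show ?thesis by (simp add: case_prod_unfold hill_flow_def)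
qed

lemma continuous_on_hill_flow_param:
  fixes q :: "'p::t2_space \<Rightarrow> real \<Rightarrow> real"
  assumes q: "continuous_on (P \<times> UNIV) (\<lambda>(p, t). q p t)"
    and C: "\<And>p t. p \<in> P \<Longrightarrow> 1 + \<bar>q p t\<bar> \<le> C"
  shows "continuous_on (P \<times> UNIV) (\<lambda>(p, t). hill_flow (q p) z t)"
proof -
  have q1: "continuous_on UNIV (q p)" if "p \<in> P" for p
    using continuous_on_compose2[OF q, of UNIV "\<lambda>t. (p, t)"] that by (force intro!: continuous_intros)
  have *: "continuous_on (P \<times> {-R..R}) (\<lambda>(p, t). hill_flow (q p) z t)" for R
  proof (rule uniform_limit_theorem[OF _ uniform_limit_picard[OF q1 C]])
    have "continuous_on (P \<times> {-R..R}) (\<lambda>x. \<Sum>i<n. (\<lambda>(p, t). picard (q p) z i t) x)" for n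
      by (intro continuous_intros continuous_on_subset[OF continuous_on_picard[OF q]]) auto
    then show "\<forall>\<^sub>F n in sequentially. continuous_on (P \<times> {-R..R}) (\<lambda>(p, t). \<Sum>i<n. picard (q p) z i t)"
      by (simp add: case_prod_unfold)
  qed auto
  show ?thesis
  proof (unfold continuous_on_eq_continuous_within, safe)
    fix p and t :: real assume p: "p \<in> P"
    define R where "R = \<bar>t\<bar> + 1"
    have t: "t \<in> {-R<..<R}" by (auto simp: R_def)
    have "continuous (at (p, t) within P \<times> {-R..R}) (\<lambda>(p, t). hill_flow (q p) z t)"
      using *[of R] p t by (auto simp: continuous_on_eq_continuous_within)
    moreover have "at (p, t) within P \<times> {-R..R} = at (p, t) within P \<times> UNIV"
      by (rule at_within_nhd[of _ "UNIV \<times> {-R<..<R}"]) (use t in \<open>auto intro!: open_Times\<close>)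
    ultimately show "continuous (at (p, t) within P \<times> UNIV) (\<lambda>(p, t). hill_flow (q p) z t)" by simp
  qed
qed

lemma hill_flow:
  assumes q: "continuous_on UNIV q" and C: "\<And>t. 1 + \<bar>q t\<bar> \<le> C"
  shows hill_flow_0: "hill_flow q z 0 = z"
    and has_vector_derivative_hill_flow:
      "(hill_flow q z has_vector_derivative hill_field (q t) (hill_flow q z t)) (at t)"
proof -
  have ul: "uniform_limit {-R..R} (\<lambda>n t. \<Sum>i<n. picard q z i t) (hill_flow q z) sequentially" for R
    using uniform_limit_picard[of "UNIV::real set" "\<lambda>_. q" C z R] q C
    by (auto simp: uniform_limit_iff)
  have lim: "(\<lambda>n. \<Sum>i<n. picard q z i t) \<longlonglongrightarrow> hill_flow q z t" for t
    by (rule tendsto_uniform_limitI[OF ul[of "\<bar>t\<bar>"]]) auto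
  have cont: "continuous_on UNIV (hill_flow q z)"
  proof -
    have "continuous_on (UNIV \<times> UNIV) (\<lambda>(p::real, t). hill_flow q z t)"
      using C by (intro continuous_on_hill_flow_param[where q="\<lambda>_. q" and C=C])
        (auto simp: case_prod_unfold intro!: continuous_on_compose2[OF q] continuous_intros)
    from continuous_on_compose2[OF this, of UNIV "\<lambda>t. (0, t)"] show ?thesis
      by (force intro!: continuous_intros)
  qed
  let ?F = "\<lambda>t. t *\<^sub>R integral {0..1} (\<lambda>s. hill_field (q (t * s)) (hill_flow q z (t * s)))"
  \<comment> \<open>The partial sums satisfy the integral equation with a shift by one index;
    uniform convergence lets the limit pass under the integral, and differentiating the result
    yields the equation.\<close>
  have eq: "hill_flow q z t = z + ?F t" for t
  proof -
    let ?f = "\<lambda>n s. \<Sum>i<n. hill_field (q (t * s)) (picard q z i (t * s))"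
    have c: "continuous_on {0..1} (\<lambda>s. hill_field (q (t * s)) (picard q z i (t * s)))" for i
      by (intro continuous_intros continuous_on_compose2[OF q] continuous_on_compose2[OF continuous_on_picard1[OF q, of UNIV]]) auto
    have u: "uniform_limit {0..1} ?f (\<lambda>s. hill_field (q (t * s)) (hill_flow q z (t * s))) sequentially"
    proof (rule uniform_limitI)
      fix e :: real assume e: "e > 0"
      have C0: "C \<ge> 1" using C[of 0] by linarith
      have "\<forall>\<^sub>F n in sequentially. \<forall>x\<in>{-\<bar>t\<bar>..\<bar>t\<bar>}. dist (\<Sum>i<n. picard q z i x) (hill_flow q z x) < e / C"
        by (rule uniform_limitD[OF ul]) (use e C0 in auto)
      then show "\<forall>\<^sub>F n in sequentially. \<forall>s\<in>{0..1}. dist (?f n s) (hill_field (q (t * s)) (hill_flow q z (t * s))) < e"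
      proof eventually_elim
        case (elim n)
        show ?case
        proof
          fix s :: real assume s: "s \<in> {0..1}"
          let ?x = "(\<Sum>i<n. picard q z i (t * s)) - hill_flow q z (t * s)"
          have "\<bar>t * s\<bar> \<le> \<bar>t\<bar> * 1" unfolding abs_mult using s by (intro mult_left_mono) auto
          then have "t * s \<in> {-\<bar>t\<bar>..\<bar>t\<bar>}" by (simp add: abs_le_iff)
          then have "norm ?x < e / C" using elim by (simp add: dist_norm)
          then have "C * norm ?x < e" using C0 by (simp add: field_simps)
          moreover have "norm (hill_field (q (t * s)) ?x) \<le> C * norm ?x"
            using norm_hill_field_le[of "q (t * s)" ?x] mult_right_mono[OF C, of "norm ?x" "t * s"] by simp
          moreover have "?f n s - hill_field (q (t * s)) (hill_flow q z (t * s)) = hill_field (q (t * s)) ?x"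
            by (simp add: hill_field_sum[symmetric]) (simp add: hill_field_def complex_eq_iff algebra_simps)
          ultimately show "dist (?f n s) (hill_field (q (t * s)) (hill_flow q z (t * s))) < e"
            by (simp add: dist_norm)
        qed
      qed
    qed
    obtain I J where I: "\<And>n. (?f n has_integral I n) {0..1}"
      and J: "((\<lambda>s. hill_field (q (t * s)) (hill_flow q z (t * s))) has_integral J) {0..1}"
      and IJ: "I \<longlonglongrightarrow> J"
      by (rule uniform_limit_integral[OF u]) (use c in \<open>auto intro!: continuous_on_sum\<close>)
    have "(\<Sum>i<Suc n. picard q z i t) = z + t *\<^sub>R I n" for n
    proof -
      have "I n = integral {0..1} (?f n)" using integral_unique[OF I[of n]] by simp
      also have "\<dots> = (\<Sum>i<n. integral {0..1} (\<lambda>s. hill_field (q (t * s)) (picard q z i (t * s))))"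
        by (rule integral_sum) (use c integrable_continuous_real in auto)
      finally show ?thesis by (simp add: sum.lessThan_Suc_shift scaleR_sum_right del: sum.lessThan_Suc)
    qed
    then have "(\<lambda>n. z + t *\<^sub>R I n) \<longlonglongrightarrow> hill_flow q z t"
      using LIMSEQ_Suc[OF lim[of t]] by simp
    moreover have "(\<lambda>n. z + t *\<^sub>R I n) \<longlonglongrightarrow> z + t *\<^sub>R J" by (intro tendsto_intros IJ)
    ultimately have "hill_flow q z t = z + t *\<^sub>R J" by (rule LIMSEQ_unique)
    then show ?thesis using J by (simp add: integral_unique)
  qed
  show "hill_flow q z 0 = z" by (subst eq) simp
  have "continuous_on UNIV (\<lambda>t. hill_field (q t) (hill_flow q z t))"
    by (intro continuous_intros q cont)
  from has_vector_derivative_add[OF has_vector_derivative_const has_vector_derivative_scaled_integral[OF this], of z]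
  show "(hill_flow q z has_vector_derivative hill_field (q t) (hill_flow q z t)) (at t)"
    unfolding eq[symmetric] by simp
qed

section \<open>Fundamental solutions, symmetries and the monodromy\<close>

definition hill_sol :: "(real \<Rightarrow> real) \<Rightarrow> (real \<Rightarrow> real) \<Rightarrow> (real \<Rightarrow> real) \<Rightarrow> bool" where
  "hill_sol q y v \<longleftrightarrow> (\<forall>t. (y has_real_derivative v t) (at t) \<and> (v has_real_derivative - q t * y t) (at t))"

lemma hill_solD:
  assumes "hill_sol q y v"
  shows "(y has_real_derivative v t) (at t within S)" "(v has_real_derivative - q t * y t) (at t within S)"
  using assms by (auto simp: hill_sol_def intro: has_field_derivative_at_within)

lemma hill_sol_continuous:
  assumes "hill_sol q y v" shows "continuous_on A y" "continuous_on A v"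
  by (rule DERIV_continuous_on[OF hill_solD(1)[OF assms]], rule DERIV_continuous_on[OF hill_solD(2)[OF assms]])

lemma hill_sol_wronskian:
  assumes y: "hill_sol q y v" and x: "hill_sol q x u"
  shows "v t * x t - y t * u t = v 0 * x 0 - y 0 * u 0"
proof -
  have "((\<lambda>t. v t * x t - y t * u t) has_real_derivative 0) (at t)" for t
    by (rule derivative_eq_intros hill_solD[OF y] hill_solD[OF x] refl | simp)+
  then show ?thesis using DERIV_isconst_all by blast
qed

lemma real_const_if_deriv_eq:
  fixes f g :: "real \<Rightarrow> real"
  assumes "\<And>t. (f has_real_derivative h t) (at t)" "\<And>t. (g has_real_derivative h t) (at t)"
  shows "f t - f s = g t - g s"
proof -
  have "((\<lambda>t. f t - g t) has_real_derivative 0) (at t)" for t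
    using DERIV_diff[OF assms(1)[of t] assms(2)[of t]] by simp
  then have "f t - g t = f s - g s" using DERIV_isconst_all by blast
  then show ?thesis by simp
qed

text \<open>Cramer's rule. It recovers a solution from its Wronskians with two fundamental
  solutions, and the values at \<open>2 pi\<close> from those at \<open>pi\<close>.\<close>

lemma linear_system_det_1:
  fixes a b c d x y :: real
  assumes "a * d - b * c = 1" "x * a - y * c = e" "y * d - x * b = f"
  shows "x = d * e + c * f" "y = b * e + a * f"
proof -
  have h: "x * (a * d - b * c) = d * (x * a - y * c) + c * (y * d - x * b)"
    "y * (a * d - b * c) = b * (x * a - y * c) + a * (y * d - x * b)"
    by (simp_all add: algebra_simps)
  show "x = d * e + c * f" using h(1) unfolding assms by simp
  show "y = b * e + a * f" using h(2) unfolding assms by simp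
qed

text \<open>The global bound \<open>C\<close> makes the Picard series converge for all times and the
  angles Lipschitz. Evenness and periodicity together express the monodromy through half a
  period.\<close>

locale hill =
  fixes q :: "real \<Rightarrow> real" and C :: real
  assumes cont_q: "continuous_on UNIV q"
    and bound_q: "1 + \<bar>q t\<bar> \<le> C"
    and even_q: "q (- t) = q t"
    and periodic_q: "q (t + 2 * pi) = q t"
begin

abbreviation "flow \<equiv> hill_flow q"
definition "y1 t = Im (flow \<i> t)"
definition "v1 t = Re (flow \<i> t)"
definition "y2 t = Im (flow 1 t)"
definition "v2 t = Re (flow 1 t)"

lemma flow_0 [simp]: "flow z 0 = z" by (rule hill_flow_0[OF cont_q bound_q])

lemma flow_deriv: "(flow z has_vector_derivative hill_field (q t) (flow z t)) (at t within S)"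
  by (rule has_vector_derivative_at_within[OF has_vector_derivative_hill_flow[OF cont_q bound_q]])

lemma continuous_on_flow: "continuous_on A (flow z)"
  by (rule continuous_on_vector_derivative[OF flow_deriv])

lemma hill_sol_flow: "hill_sol q (\<lambda>t. Im (flow z t)) (\<lambda>t. Re (flow z t))"
  using bounded_linear.has_vector_derivative[OF bounded_linear_Re flow_deriv]
    bounded_linear.has_vector_derivative[OF bounded_linear_Im flow_deriv]
  by (simp add: hill_sol_def has_real_derivative_iff_has_vector_derivative hill_field_def)

lemma sol1: "hill_sol q y1 v1" and sol2: "hill_sol q y2 v2"
  using hill_sol_flow[of \<i>] hill_sol_flow[of 1] by (simp_all add: y1_def[abs_def] v1_def[abs_def] y2_def[abs_def] v2_def[abs_def])

lemma init [simp]: "y1 0 = 1" "v1 0 = 0" "y2 0 = 0" "v2 0 = 1"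
  by (simp_all add: y1_def v1_def y2_def v2_def)

lemma det_1: "y1 t * v2 t - v1 t * y2 t = 1"
  using hill_sol_wronskian[OF sol1 sol2, of t] by simp

text \<open>Uniqueness without a Gronwall estimate: the Wronskians with \<open>y1\<close> and
  \<open>y2\<close> are constant, and together they determine the solution.\<close>

lemma hill_sol_unique:
  assumes "hill_sol q y v"
  shows "y t = y 0 * y1 t + v 0 * y2 t" "v t = y 0 * v1 t + v 0 * v2 t"
proof -
  have "v t * y1 t - y t * v1 t = v 0" "y t * v2 t - v t * y2 t = y 0"
    using hill_sol_wronskian[OF assms sol1, of t] hill_sol_wronskian[OF assms sol2, of t] by simp_all
  from linear_system_det_1[OF _ this] show "y t = y 0 * y1 t + v 0 * y2 t" "v t = y 0 * v1 t + v 0 * v2 t"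
    using det_1[of t] by (simp_all add: mult.commute)
qed

lemma flow_eq: "flow z t = Complex (Im z * v1 t + Re z * v2 t) (Im z * y1 t + Re z * y2 t)"
  using hill_sol_unique[OF hill_sol_flow, of z t] by (simp add: complex_eq_iff)

lemma flow_scaleR: "flow (of_real r * z) t = of_real r * flow z t"
  by (simp add: flow_eq complex_eq_iff algebra_simps)

lemma flow_nonzero:
  assumes "z \<noteq> 0" shows "flow z t \<noteq> 0"
proof
  assume "flow z t = 0"
  then have "Im z * v1 t + Re z * v2 t = 0" "Im z * y1 t + Re z * y2 t = 0"
    by (simp_all add: flow_eq complex_eq_iff)
  with linear_system_det_1[of "y1 t" "v2 t" "v1 t" "y2 t" "Im z" "- Re z" 0 0] det_1[of t]
  have "Re z = 0" "Im z = 0" by simp_all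
  with assms show False by (simp add: complex_eq_iff)
qed

lemma hill_sol_reflect:
  assumes "hill_sol q y v" shows "hill_sol q (\<lambda>t. y (- t)) (\<lambda>t. - v (- t))"
proof -
  have "((\<lambda>t. y (- t)) has_real_derivative v (- t) * (- 1)) (at t)" for t
    by (rule DERIV_chain2[OF hill_solD(1)[OF assms]]) (auto intro!: derivative_eq_intros)
  moreover have "((\<lambda>t. v (- t)) has_real_derivative (- q (- t) * y (- t)) * (- 1)) (at t)" for t
    by (rule DERIV_chain2[OF hill_solD(2)[OF assms]]) (auto intro!: derivative_eq_intros)
  from DERIV_minus[OF this] have "((\<lambda>t. - v (- t)) has_real_derivative - q t * y (- t)) (at t)" for t
    by (simp add: even_q)
  ultimately show ?thesis by (simp add: hill_sol_def)
qed

lemma parity: "y1 (- t) = y1 t" "v1 (- t) = - v1 t" "y2 (- t) = - y2 t" "v2 (- t) = v2 t"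
  using hill_sol_unique[OF hill_sol_reflect[OF sol1], of t] hill_sol_unique[OF hill_sol_reflect[OF sol2], of t]
  by simp_all

lemma hill_sol_shift:
  assumes "hill_sol q y v" shows "hill_sol q (\<lambda>t. y (t + 2 * pi)) (\<lambda>t. v (t + 2 * pi))"
  unfolding hill_sol_def DERIV_shift[symmetric]
  using hill_solD[OF assms, of "t + 2 * pi" UNIV for t] by (simp add: periodic_q)

text \<open>The solution translated by a period, evaluated at \<open>- pi\<close>, takes the known
  values at \<open>pi\<close>; with parity this is a linear system of determinant 1 for the values
  at \<open>2 pi\<close>.\<close>

lemma monodromy:
  "y1 (2 * pi) = y1 pi * v2 pi + v1 pi * y2 pi" "v1 (2 * pi) = 2 * y1 pi * v1 pi"
  "v2 (2 * pi) = y1 pi * v2 pi + v1 pi * y2 pi" "y2 (2 * pi) = 2 * y2 pi * v2 pi"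
proof -
  have "y1 (2 * pi) * y1 pi - v1 (2 * pi) * y2 pi = y1 pi" "v1 (2 * pi) * v2 pi - y1 (2 * pi) * v1 pi = v1 pi"
    using hill_sol_unique[OF hill_sol_shift[OF sol1], of "- pi"] by (simp_all add: parity)
  from linear_system_det_1[OF _ this]
  show "y1 (2 * pi) = y1 pi * v2 pi + v1 pi * y2 pi" "v1 (2 * pi) = 2 * y1 pi * v1 pi"
    using det_1[of pi] by (simp_all add: mult.commute)
  have "y2 (2 * pi) * y1 pi - v2 (2 * pi) * y2 pi = y2 pi" "v2 (2 * pi) * v2 pi - y2 (2 * pi) * v1 pi = v2 pi"
    using hill_sol_unique[OF hill_sol_shift[OF sol2], of "- pi"] by (simp_all add: parity)
  from linear_system_det_1[OF _ this]
  show "v2 (2 * pi) = y1 pi * v2 pi + v1 pi * y2 pi" "y2 (2 * pi) = 2 * y2 pi * v2 pi"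
    using det_1[of pi] by (simp_all add: mult.commute)
qed

lemma flow_shift: "flow z (t + 2 * pi) = flow (flow z (2 * pi)) t"
  using hill_sol_unique[OF hill_sol_shift[OF hill_sol_flow[of z]], of t] by (simp add: flow_eq[of _ t] complex_eq_iff)

lemma flow_shift_n: "flow z (t + 2 * pi * real n) = flow (flow z (2 * pi * real n)) t"
proof (induction n arbitrary: t)
  case (Suc n)
  have "flow z (t + 2 * pi * real (Suc n)) = flow z ((t + 2 * pi) + 2 * pi * real n)"
    by (simp add: algebra_simps)
  also have "\<dots> = flow (flow z (2 * pi * real n)) (t + 2 * pi)" by (rule Suc)
  also have "\<dots> = flow (flow (flow z (2 * pi * real n)) (2 * pi)) t" by (rule flow_shift)
  also have "flow (flow z (2 * pi * real n)) (2 * pi) = flow z (2 * pi + 2 * pi * real n)" by (rule Suc[symmetric])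
  finally show ?case by (simp add: algebra_simps)
qed simp

section \<open>A continuous argument along solutions\<close>

definition "logdiff z t = hill_field (q t) (flow z t) / flow z t"

end

text \<open>Primitive of the logarithmic derivative of the solution, hence a global logarithm of it
  up to a constant; its imaginary part is a continuous argument obtained without any lifting. The
  rescaled integral keeps it continuous in the parameters.\<close>

definition hill_log :: "(real \<Rightarrow> real) \<Rightarrow> complex \<Rightarrow> real \<Rightarrow> complex" where
  "hill_log q z t = t *\<^sub>R integral {0..1} (\<lambda>s. hill_field (q (t * s)) (hill_flow q z (t * s)) / hill_flow q z (t * s))"

definition hill_angle :: "(real \<Rightarrow> real) \<Rightarrow> complex \<Rightarrow> real \<Rightarrow> real" where
  "hill_angle q z t = Im (hill_log q z t)"

context hill
begin

abbreviation "angle \<equiv> hill_angle q"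

lemma continuous_on_logdiff: "z \<noteq> 0 \<Longrightarrow> continuous_on UNIV (logdiff z)"
  unfolding logdiff_def using flow_nonzero
  by (intro continuous_intros cont_q continuous_on_flow) auto

lemma hill_log_deriv: "z \<noteq> 0 \<Longrightarrow> (hill_log q z has_vector_derivative logdiff z t) (at t)"
  using has_vector_derivative_scaled_integral[OF continuous_on_logdiff[of z], of t]
  by (simp add: hill_log_def[abs_def] logdiff_def)

lemma hill_log_0 [simp]: "hill_log q z 0 = 0" by (simp add: hill_log_def)
lemma angle_0 [simp]: "angle z 0 = 0" by (simp add: hill_angle_def)

lemma angle_deriv: "z \<noteq> 0 \<Longrightarrow> (angle z has_real_derivative Im (logdiff z t)) (at t within S)"
  unfolding hill_angle_def[abs_def] has_real_derivative_iff_has_vector_derivative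
  by (rule has_vector_derivative_at_within[OF bounded_linear.has_vector_derivative[OF bounded_linear_Im hill_log_deriv]])

lemma continuous_on_angle: "z \<noteq> 0 \<Longrightarrow> continuous_on A (angle z)"
  by (rule DERIV_continuous_on[OF angle_deriv])

lemma logdiff_flow: "z \<noteq> 0 \<Longrightarrow> logdiff z t * flow z t = hill_field (q t) (flow z t)"
  using flow_nonzero[of z t] by (simp add: logdiff_def)

lemma flow_exp:
  assumes z: "z \<noteq> 0"
  shows "flow z t = z * exp (hill_log q z t)"
proof -
  have "((\<lambda>t. flow z t * exp (- hill_log q z t)) has_vector_derivative 0) (at t within UNIV)" for t
  proof -
    have m: "((\<lambda>t. - hill_log q z t) has_vector_derivative - logdiff z t) (at t)"
      by (rule has_vector_derivative_minus[OF hill_log_deriv[OF z]])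
    have e: "((\<lambda>t. exp (- hill_log q z t)) has_vector_derivative (- logdiff z t) * exp (- hill_log q z t)) (at t)"
      using field_vector_diff_chain_at[OF m DERIV_exp] by (simp only: o_def)
    have "flow z t * (- logdiff z t * exp (- hill_log q z t)) + hill_field (q t) (flow z t) * exp (- hill_log q z t) = 0"
      unfolding logdiff_flow[OF z, symmetric] by (simp only: mult_minus_left mult_minus_right mult.assoc mult.left_commute[of "flow z t"]) simp
    then show ?thesis
      using has_vector_derivative_mult[OF flow_deriv e, of z] by (simp only:)
  qed
  then obtain c where c: "\<And>t. flow z t * exp (- hill_log q z t) = c"
    using has_vector_derivative_zero_constant[OF convex_UNIV, of "\<lambda>t. flow z t * exp (- hill_log q z t)"] UNIV_I by metis
  have "flow z t * exp (- hill_log q z t) = z" using c[of t] c[of 0] by simp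
  then have "flow z t * (exp (- hill_log q z t) * exp (hill_log q z t)) = z * exp (hill_log q z t)"
    by (simp only: mult.assoc[symmetric])
  then show ?thesis by (simp add: exp_add[symmetric])
qed

lemma flow_polar:
  assumes z: "z \<noteq> 0"
  shows "flow z t = of_real (cmod (flow z t)) * cis (Arg z + angle z t)"
proof -
  let ?r = "exp (Re (hill_log q z t))"
  have "flow z t = rcis (cmod z) (Arg z) * rcis ?r (angle z t)"
    unfolding flow_exp[OF z] hill_angle_def rcis_cmod_Arg by (simp add: exp_eq_polar rcis_def)
  then have "flow z t = of_real (cmod z * ?r) * cis (Arg z + angle z t)"
    by (simp add: rcis_mult) (simp add: rcis_def)
  moreover have "cmod (flow z t) = cmod z * ?r"
    unfolding flow_exp[OF z] norm_mult by simp
  ultimately show ?thesis by simp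
qed

lemma angle_lipschitz:
  assumes z: "z \<noteq> 0" shows "\<bar>angle z t - angle z s\<bar> \<le> C * \<bar>t - s\<bar>"
proof -
  have "norm (Im (logdiff z t)) \<le> C" for t
  proof -
    have "\<bar>Im (logdiff z t)\<bar> \<le> cmod (logdiff z t)" by (rule abs_Im_le_cmod)
    also have "\<dots> \<le> 1 + \<bar>q t\<bar>"
      using norm_hill_field_le[of "q t" "flow z t"] flow_nonzero[OF z, of t]
      unfolding logdiff_def norm_divide by (subst pos_divide_le_eq) auto
    also have "\<dots> \<le> C" by (rule bound_q)
    finally show ?thesis by simp
  qed
  then have "norm (angle z t - angle z s) \<le> C * norm (t - s)"
    by (intro field_differentiable_bound[of UNIV "angle z" "\<lambda>t. Im (logdiff z t)"]) (simp_all add: angle_deriv[OF z])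
  then show ?thesis by simp
qed

lemma angle_scale:
  assumes "r \<noteq> 0" shows "angle (of_real r * z) t = angle z t"
proof -
  have "hill_field k (of_real r * x) / (of_real r * x) = hill_field k x / x" for k x
  proof -
    have "hill_field k (of_real r * x) = of_real r * hill_field k x"
      by (simp add: hill_field_def complex_eq_iff)
    then show ?thesis using assms by simp
  qed
  then show ?thesis by (simp add: hill_angle_def hill_log_def flow_scaleR)
qed

text \<open>By the Wronskian, linearly independent solutions are never parallel.\<close>

lemma angle_interlace:
  assumes z: "z \<noteq> 0" and w: "w \<noteq> 0"
  shows "\<bar>angle z t - angle w t\<bar> < pi"
proof (cases "Im (cnj z * w) = 0")
  case True
  define r where "r = Re (cnj z * w) / (cmod z)\<^sup>2"
  have "w * (of_real ((cmod z)\<^sup>2)) = z * (cnj z * w)" by (simp only: complex_norm_square ac_simps)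
  also have "cnj z * w = of_real (Re (cnj z * w))" using True by (simp add: complex_eq_iff)
  finally have "w = of_real r * z" using z by (simp add: r_def field_simps)
  moreover from this w have "r \<noteq> 0" by auto
  ultimately show ?thesis using angle_scale by simp
next
  case False
  define a where "a = Arg (cnj z * w)"
  define \<delta> where "\<delta> t = angle w t - angle z t" for t
  have ne: "cnj z * w \<noteq> 0" using z w by simp
  have sin: "sin (a + \<delta> t) \<noteq> 0" for t
  proof -
    have "Im (cnj (flow z t) * flow w t) = Im (cnj z * w)"
      using hill_sol_wronskian[OF hill_sol_flow[of z] hill_sol_flow[of w], of t] by simp
    moreover have "cnj (flow z t) * flow w t = (cnj z * w) * exp (cnj (hill_log q z t) + hill_log q w t)"
      by (simp add: flow_exp z w exp_add exp_cnj)
    moreover have "\<dots> = rcis (cmod (cnj z * w)) a * rcis (exp (Re (cnj (hill_log q z t) + hill_log q w t))) (\<delta> t)"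
      using rcis_cmod_Arg[of "cnj z * w"] by (simp add: exp_eq_polar a_def \<delta>_def hill_angle_def rcis_def)
    ultimately show ?thesis using False by (auto simp: rcis_mult)
  qed
  have cont: "continuous_on A (\<lambda>t. a + \<delta> t)" for A
    unfolding \<delta>_def by (intro continuous_intros continuous_on_angle z w)
  have "a \<noteq> 0" using sin[of 0] by (auto simp: \<delta>_def)
  have "a \<noteq> pi" using sin[of 0] by (auto simp: \<delta>_def)
  have a: "- pi < a" "a \<le> pi" using Arg_bounded[of "cnj z * w"] by (auto simp: a_def)
  have conn: "connected (range (\<lambda>t. a + \<delta> t))"
    by (rule connected_continuous_image[OF cont]) auto
  have noint: "k \<notin> range (\<lambda>t. a + \<delta> t)" if "sin k = 0" for k
    using sin that by fastforce
  have mem: "a \<in> range (\<lambda>t. a + \<delta> t)" "a + \<delta> t \<in> range (\<lambda>t. a + \<delta> t)"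
    by (auto simp: \<delta>_def intro!: image_eqI[of _ _ 0])
  \<comment> \<open>The angle from one solution to the other starts at \<open>a\<close>, strictly
    between two consecutive multiples of \<open>pi\<close>, and never meets a multiple of
    \<open>pi\<close>; connectedness confines it to that interval of length
    \<open>pi\<close>.\<close>
  have avoid: "(a < k \<longleftrightarrow> a + \<delta> t < k)" if "sin k = 0" for k
    using connectedD_interval[OF conn mem, of k] connectedD_interval[OF conn mem(2,1), of k] noint[OF that] mem
    by (metis linorder_less_linear less_imp_le)
  show ?thesis
    using avoid[of 0] avoid[of pi] avoid[of "-pi"] a \<open>a \<noteq> 0\<close> \<open>a \<noteq> pi\<close> by (auto simp: \<delta>_def abs_less_iff)
qed

lemma angle_add:
  assumes z: "z \<noteq> 0"
  shows "angle z (t + 2 * pi * real n) = angle z (2 * pi * real n) + angle (flow z (2 * pi * real n)) t"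
proof -
  let ?T = "2 * pi * real n"
  have w: "flow z ?T \<noteq> 0" by (rule flow_nonzero[OF z])
  have qn: "q (t + 2 * pi * real n) = q t" for t
  proof (induction n)
    case (Suc n)
    have "q (t + 2 * pi * real (Suc n)) = q ((t + 2 * pi * real n) + 2 * pi)" by (simp add: algebra_simps)
    then show ?case using Suc periodic_q by metis
  qed simp
  have "logdiff z (t + ?T) = logdiff (flow z ?T) t" for t
    by (simp add: logdiff_def flow_shift_n qn)
  then have "((\<lambda>t. angle z (t + ?T)) has_real_derivative Im (logdiff (flow z ?T) t)) (at t)" for t
    using angle_deriv[OF z, of "t + ?T" UNIV] by (simp add: DERIV_shift)
  from real_const_if_deriv_eq[OF this angle_deriv[OF w], of t 0] show ?thesis by simp
qed

end

section \<open>Existence of the rotation number and its value at eigenvectors\<close>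

lemma quasi_additive_limit:
  fixes a :: "nat \<Rightarrow> real"
  assumes a: "\<And>m n. \<bar>a (m + n) - a m - a n\<bar> \<le> K"
  shows "\<exists>L. (\<lambda>n. a n / n) \<longlonglongrightarrow> L"
proof -
  have K: "K \<ge> 0" using a[of 0 0] by linarith
  \<comment> \<open>Homogenisation of a quasimorphism: iterating the defect bound and comparing
    \<open>a (m * n)\<close> with both \<open>m * a n\<close> and \<open>n * a m\<close> makes the
    averages a Cauchy sequence.\<close>
  have mult: "\<bar>a (m * n) - m * a n\<bar> \<le> (m + 1) * K" for m n
  proof (induction m)
    case 0 then show ?case using a[of 0 0] by simp
  next
    case (Suc m)
    have "\<bar>a (n + m * n) - a n - a (m * n)\<bar> \<le> K" by (rule a)
    with Suc show ?case by (simp add: algebra_simps) 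
  qed
  have close: "\<bar>a m / m - a n / n\<bar> \<le> 2 * K / m + 2 * K / n" if "m > 0" "n > 0" for m n :: nat
  proof -
    have "\<bar>m * a n - n * a m\<bar> \<le> (m + 1) * K + (n + 1) * K"
      using mult[of m n] mult[of n m, unfolded mult.commute[of n m]] by (simp only: of_nat_add of_nat_1)
    also have "\<dots> \<le> 2 * m * K + 2 * n * K"
      using that K by (intro add_mono mult_right_mono) auto
    finally have *: "\<bar>m * a n - n * a m\<bar> \<le> 2 * m * K + 2 * n * K" .
    have "a m / m - a n / n = (n * a m - m * a n) / (real m * n)"
      using that by (simp add: field_simps)
    then have "\<bar>a m / m - a n / n\<bar> = \<bar>m * a n - n * a m\<bar> / (real m * n)"
      by (simp only: abs_divide abs_mult abs_of_nat abs_minus_commute)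
    also have "\<dots> \<le> (2 * m * K + 2 * n * K) / (real m * n)"
      using * by (rule divide_right_mono) simp
    also have "\<dots> = 2 * K / m + 2 * K / n" using that by (simp add: field_simps)
    finally show ?thesis .
  qed
  have "Cauchy (\<lambda>n. a n / n)"
  proof (rule CauchyI)
    fix e :: real assume e: "e > 0"
    obtain N :: nat where N: "N > 4 * K / e" "N > 0"
      by (metis gr0I less_trans of_nat_0_less_iff reals_Archimedean2 zero_less_one max_less_iff_conj)
    have half: "2 * K / m < e / 2" if "m \<ge> N" for m :: nat
    proof -
      have "4 * K / e < m" using N that by linarith
      then show ?thesis using e N that by (simp add: field_simps)
    qed
    show "\<exists>M. \<forall>m\<ge>M. \<forall>n\<ge>M. norm (a m / m - a n / n) < e"
    proof (intro exI allI impI)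
      fix m n assume "m \<ge> N" "n \<ge> N"
      then show "norm (a m / m - a n / n) < e"
        using close[of m n] half[of m] half[of n] N by simp
    qed
  qed
  then show ?thesis using Cauchy_convergent_iff convergent_def by blast
qed

context hill
begin

text \<open>At multiples of \<open>2 pi\<close> the angle is additive up to a change of initial
  vector, and interlacing bounds that error by \<open>pi\<close>. Passing to other times costs at
  most a period times the Lipschitz constant, passing to other solutions at most
  \<open>pi\<close>.\<close>

lemma rotation_exists: "\<exists>L. \<forall>z. z \<noteq> 0 \<longrightarrow> ((\<lambda>t. angle z t / t) \<longlongrightarrow> L) at_top"
proof -
  define a where "a n = angle 1 (2 * pi * real n)" for n
  have "\<bar>a (m + n) - a m - a n\<bar> \<le> pi" for m n
    using angle_add[of 1 "2 * pi * real n" m] angle_interlace[of "flow 1 (2 * pi * real m)" 1 "2 * pi * real n"]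
      flow_nonzero[of 1]
    by (simp add: a_def algebra_simps)
  then obtain L where L: "(\<lambda>n. a n / n) \<longlonglongrightarrow> L" using quasi_additive_limit by blast
  have C1: "C \<ge> 1" using bound_q[of 0] by linarith
  have "((\<lambda>t. angle z t / t) \<longlongrightarrow> L / (2 * pi)) at_top" if z: "z \<noteq> 0" for z
  proof -
    define N where "N t = nat \<lfloor>t / (2 * pi)\<rfloor>" for t :: real
    have N: "2 * pi * real (N t) \<le> t" "t - 2 * pi * real (N t) \<le> 2 * pi" if "t \<ge> 0" for t
    proof -
      have *: "real (N t) = of_int \<lfloor>t / (2 * pi)\<rfloor>" using that by (simp add: N_def)
      have "of_int \<lfloor>t / (2 * pi)\<rfloor> \<le> t / (2 * pi)" "t / (2 * pi) \<le> of_int \<lfloor>t / (2 * pi)\<rfloor> + 1"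
        by linarith+
      from mult_right_mono[OF this(1), of "2 * pi"] mult_right_mono[OF this(2), of "2 * pi"]
      have "of_int \<lfloor>t / (2 * pi)\<rfloor> * (2 * pi) \<le> t" "t \<le> (of_int \<lfloor>t / (2 * pi)\<rfloor> + 1) * (2 * pi)"
        by simp_all
      then show "2 * pi * real (N t) \<le> t" "t - 2 * pi * real (N t) \<le> 2 * pi"
        unfolding * by (simp_all add: algebra_simps)
    qed
    have Nlim: "filterlim N at_top at_top"
      unfolding N_def
      by (intro filterlim_compose[OF filterlim_nat_sequentially] filterlim_compose[OF filterlim_floor_sequentially]
        filterlim_tendsto_pos_mult_at_top[of "\<lambda>_. 1 / (2 * pi)" "1 / (2*pi)" _ "\<lambda>t. t", simplified])
         (auto simp: filterlim_ident)
    have A: "((\<lambda>t. a (N t) / real (N t)) \<longlongrightarrow> L) at_top"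
      by (rule filterlim_compose[OF L Nlim])
    have inv: "((\<lambda>t::real. K / t) \<longlongrightarrow> 0) at_top" for K :: real
      by (rule tendsto_divide_0[OF tendsto_const filterlim_at_top_imp_at_infinity[OF filterlim_ident]])
    have B: "((\<lambda>t. real (N t) / t) \<longlongrightarrow> 1 / (2 * pi)) at_top"
    proof (rule tendsto_sandwich)
      show "\<forall>\<^sub>F t in at_top. real (N t) / t \<le> 1 / (2 * pi)"
        using eventually_gt_at_top[of 0] by eventually_elim (use N(1) in \<open>simp add: field_simps\<close>)
      show "\<forall>\<^sub>F t in at_top. 1 / (2 * pi) - 1 / t \<le> real (N t) / t"
        using eventually_gt_at_top[of 0] 
      proof eventually_elim
        case (elim t)
        then have "t - 2 * pi \<le> 2 * pi * real (N t)" using N(2)[of t] by simp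
        then have "(t - 2 * pi) / (2 * pi) \<le> real (N t)" by (simp add: divide_le_eq mult.commute)
        then have "(t - 2 * pi) / (2 * pi) / t \<le> real (N t) / t" using elim by (intro divide_right_mono) simp_all
        then show ?case using elim by (simp add: diff_divide_distrib)
      qed
      show "((\<lambda>t::real. 1 / (2 * pi) - 1 / t) \<longlongrightarrow> 1 / (2 * pi)) at_top"
        using tendsto_diff[OF tendsto_const inv[of 1]] by simp
    qed simp
    have AB: "((\<lambda>t. a (N t) / real (N t) * (real (N t) / t)) \<longlongrightarrow> L * (1 / (2 * pi))) at_top"
      by (rule tendsto_mult[OF A B])
    have D: "((\<lambda>t. angle z t / t - a (N t) / real (N t) * (real (N t) / t)) \<longlongrightarrow> 0) at_top"
    proof (rule Lim_null_comparison[OF _ inv[of "pi + C * (2 * pi)"]])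
      show "\<forall>\<^sub>F t in at_top. norm (angle z t / t - a (N t) / real (N t) * (real (N t) / t)) \<le> (pi + C * (2 * pi)) / t"
        using eventually_gt_at_top[of 0]
      proof eventually_elim
        case (elim t)
        have "\<bar>angle z t - angle z (2 * pi * real (N t))\<bar> \<le> C * (2 * pi)"
        proof -
          have "\<bar>angle z t - angle z (2 * pi * real (N t))\<bar> \<le> C * \<bar>t - 2 * pi * real (N t)\<bar>"
            by (rule angle_lipschitz[OF z])
          also have "\<dots> \<le> C * (2 * pi)" using N[of t] elim C1 by (intro mult_left_mono) auto
          finally show ?thesis .
        qed
        moreover have "\<bar>angle z (2 * pi * real (N t)) - a (N t)\<bar> < pi"
          unfolding a_def by (rule angle_interlace) (use z in auto)
        ultimately have "\<bar>angle z t - a (N t)\<bar> \<le> pi + C * (2 * pi)" by linarith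
        moreover have "a (N t) / real (N t) * (real (N t) / t) = a (N t) / t"
          by (auto simp: a_def)
        ultimately show ?case using elim by (simp add: divide_right_mono flip: diff_divide_distrib)
      qed
    qed
    show ?thesis using tendsto_add[OF D AB] by simp
  qed
  then show ?thesis by blast
qed

definition "rot = (THE L. \<forall>z. z \<noteq> 0 \<longrightarrow> ((\<lambda>t. angle z t / t) \<longlongrightarrow> L) at_top)"

lemma rot_tendsto:
  assumes "z \<noteq> 0" shows "((\<lambda>t. angle z t / t) \<longlongrightarrow> rot) at_top"
proof -
  obtain L where L: "\<forall>z. z \<noteq> 0 \<longrightarrow> ((\<lambda>t. angle z t / t) \<longlongrightarrow> L) at_top"
    using rotation_exists by blast
  have "rot = L" unfolding rot_def
  proof (rule the_equality)
    show "\<forall>z. z \<noteq> 0 \<longrightarrow> ((\<lambda>t. angle z t / t) \<longlongrightarrow> L) at_top" by (rule L)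
  next
    fix L' assume "\<forall>z. z \<noteq> 0 \<longrightarrow> ((\<lambda>t. angle z t / t) \<longlongrightarrow> L') at_top"
    with L have "((\<lambda>t. angle 1 t / t) \<longlongrightarrow> L') at_top" "((\<lambda>t. angle 1 t / t) \<longlongrightarrow> L) at_top" by auto
    then show "L' = L" using tendsto_unique trivial_limit_at_top_linorder by blast
  qed
  with L assms show ?thesis by blast
qed

text \<open>Along a real eigenvector of the \<open>n\<close>-th power of the monodromy the angle is
  exactly additive, so the limit equals the average over \<open>n\<close> periods. The sign of the
  eigenvalue fixes the parity of the multiple of \<open>pi\<close>.\<close>

lemma rot_eigenvector:
  assumes z: "z \<noteq> 0" and n: "n > 0" and r: "flow z (2 * pi * real n) = of_real r * z"
  shows "rot = angle z (2 * pi * real n) / (2 * pi * real n)"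
    and "r > 0 \<Longrightarrow> \<exists>j::int. angle z (2 * pi * real n) = 2 * pi * of_int j"
    and "r < 0 \<Longrightarrow> \<exists>j::int. angle z (2 * pi * real n) = pi * of_int (2 * j + 1)"
proof -
  let ?T = "2 * pi * real n" let ?A = "angle z ?T"
  have r0: "r \<noteq> 0" using flow_nonzero[OF z, of ?T] r by auto
  have "angle z (2 * pi * real (n * k)) = real k * ?A" for k
  proof (induction k)
    case (Suc k)
    have "angle z (2 * pi * real (n * Suc k)) = angle z (2 * pi * real (n * k) + ?T)"
      by (simp add: algebra_simps)
    also have "\<dots> = ?A + angle (of_real r * z) (2 * pi * real (n * k))"
      unfolding r[symmetric] by (rule angle_add[OF z])
    also have "\<dots> = ?A + real k * ?A" by (simp only: angle_scale[OF r0] Suc)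
    finally show ?case by (simp add: algebra_simps)
  qed simp
  then have "angle z (?T * real k) / (?T * real k) = ?A / ?T" if "k > 0" for k :: nat
    using that n by (simp add: mult.assoc)
  then have "\<forall>\<^sub>F k::nat in sequentially. angle z (?T * real k) / (?T * real k) = ?A / ?T"
    using eventually_gt_at_top[of "0::nat"] by (rule eventually_mono[rotated])
  then have "(\<lambda>k. angle z (?T * real k) / (?T * real k)) \<longlonglongrightarrow> ?A / ?T"
    by (rule tendsto_eventually)
  moreover have "(\<lambda>k. angle z (?T * real k) / (?T * real k)) \<longlonglongrightarrow> rot"
    by (rule filterlim_compose[OF rot_tendsto[OF z]])
       (use n in \<open>auto intro!: filterlim_tendsto_pos_mult_at_top[OF tendsto_const] filterlim_real_sequentially\<close>)
  ultimately show "rot = ?A / ?T" using LIMSEQ_unique by blast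
  have "exp (hill_log q z ?T) = of_real r" using r z by (simp add: flow_exp)
  then have e: "exp (Re (hill_log q z ?T)) * cos ?A = r" "sin ?A = 0"
    by (simp_all add: complex_eq_iff Re_exp Im_exp hill_angle_def)
  from e(2) obtain i :: int where i: "?A = of_int i * pi" by (auto simp: sin_zero_iff_int2)
  show "\<exists>j::int. ?A = 2 * pi * of_int j" if "r > 0"
  proof -
    have "cos ?A > 0" using e(1) that by (metis exp_gt_zero zero_less_mult_pos)
    then have "even i" using i by (simp add: cos_npi_int mult.commute split: if_splits)
    then show ?thesis using i by (auto elim!: evenE)
  qed
  show "\<exists>j::int. ?A = pi * of_int (2 * j + 1)" if "r < 0"
  proof -
    have "cos ?A < 0" using e(1) that by (metis exp_gt_zero linorder_neqE_linordered_idom mult_eq_0_iff mult_pos_pos less_irrefl less_asym)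
    then have "odd i" using i by (simp add: cos_npi_int mult.commute split: if_splits)
    then show ?thesis using i by (auto elim!: oddE simp: algebra_simps)
  qed
qed

end

section \<open>Fourier coefficients of periodic solutions\<close>

text \<open>Here \<open>k\<close> stands for \<open>7 * \<beta>\<close>; it is kept free so that
  deformations can start at the solvable case \<open>k = 0\<close>.\<close>

definition ecc_q :: "real \<Rightarrow> real \<Rightarrow> real \<Rightarrow> real" where
  "ecc_q k e t = 1 + k / (1 + e * cos t)"

lemma one_plus_ecc_cos_ge: "1 - \<bar>e\<bar> \<le> 1 + e * cos t" for e :: real
proof -
  have "\<bar>e * cos t\<bar> \<le> \<bar>e\<bar> * 1" unfolding abs_mult by (intro mult_left_mono) auto
  then show ?thesis by linarith
qed

lemma one_plus_ecc_cos_pos: "\<bar>e\<bar> < 1 \<Longrightarrow> 0 < 1 + e * cos t" for e :: real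
  using one_plus_ecc_cos_ge[of e t] by linarith

lemma hill_ecc_q:
  assumes "\<bar>e\<bar> < 1" shows "hill (ecc_q k e) (2 + \<bar>k\<bar> / (1 - \<bar>e\<bar>))"
proof
  show "continuous_on UNIV (ecc_q k e)"
    unfolding ecc_q_def using one_plus_ecc_cos_pos[OF assms] by (intro continuous_intros) (metis less_irrefl)
  fix t
  have "\<bar>k / (1 + e * cos t)\<bar> \<le> \<bar>k\<bar> / (1 - \<bar>e\<bar>)"
    unfolding abs_divide using one_plus_ecc_cos_ge[of e t] assms by (intro frac_le) auto
  then show "1 + \<bar>ecc_q k e t\<bar> \<le> 2 + \<bar>k\<bar> / (1 - \<bar>e\<bar>)" unfolding ecc_q_def by linarith
  show "ecc_q k e (- t) = ecc_q k e t" "ecc_q k e (t + 2 * pi) = ecc_q k e t"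
    by (simp_all add: ecc_q_def)
qed

text \<open>The phase \<open>\<tau>\<close> is 0 for sine and \<open>\<pi>/2\<close> for cosine coefficients.\<close>

definition fourier :: "(real \<Rightarrow> real) \<Rightarrow> real \<Rightarrow> real \<Rightarrow> real" where
  "fourier y \<tau> \<nu> = integral {0..pi} (\<lambda>t. y t * sin (\<nu> * t + \<tau>))"

text \<open>The condition under which the boundary terms of Green's formula on \<open>[0, \<pi>]\<close> vanish.\<close>

definition compatible :: "(real \<Rightarrow> real) \<Rightarrow> (real \<Rightarrow> real) \<Rightarrow> real \<Rightarrow> real \<Rightarrow> bool" where
  "compatible y v \<tau> \<nu> \<longleftrightarrow> sin \<tau> * v 0 = \<nu> * cos \<tau> * y 0 \<and>
     sin (\<nu> * pi + \<tau>) * v pi = \<nu> * cos (\<nu> * pi + \<tau>) * y pi"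

lemma cos_mult_sin_shift:
  "cos t * sin (\<nu> * t + \<tau>) = (sin ((\<nu> + 1) * t + \<tau>) + sin ((\<nu> - 1) * t + \<tau>)) / 2" for t :: real
proof -
  have "(\<nu> + 1) * t + \<tau> = (\<nu> * t + \<tau>) + t" "(\<nu> - 1) * t + \<tau> = (\<nu> * t + \<tau>) - t"
    by (simp_all add: algebra_simps)
  then show ?thesis by (simp only: sin_add sin_diff) simp
qed

lemma norm_fourier_le:
  assumes f: "continuous_on {0..pi} f"
  shows "\<exists>K. \<forall>\<tau> \<nu>. \<bar>fourier f \<tau> \<nu>\<bar> \<le> K"
proof (intro exI allI)
  fix \<tau> \<nu>
  have "norm (fourier f \<tau> \<nu>) \<le> integral {0..pi} (\<lambda>t. \<bar>f t\<bar>)"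
    unfolding fourier_def
  proof (rule integral_norm_bound_integral)
    show "norm (f t * sin (\<nu> * t + \<tau>)) \<le> \<bar>f t\<bar>" for t
      using mult_left_mono[OF abs_sin_le_one, of "\<bar>f t\<bar>" "\<nu> * t + \<tau>"] by (simp add: abs_mult)
  qed (auto intro!: integrable_continuous_real continuous_intros f)
  then show "\<bar>fourier f \<tau> \<nu>\<bar> \<le> integral {0..pi} (\<lambda>t. \<bar>f t\<bar>)" by simp
qed

text \<open>Two integrations by parts done at once: \<open>?W\<close> is the Wronskian of
  \<open>y\<close> with the trigonometric function, its derivative is the difference of the
  integrands, and \<open>compatible\<close> makes it vanish at both ends.\<close>

lemma fourier_green:
  assumes q: "continuous_on UNIV q" and y: "hill_sol q y v" and c: "compatible y v \<tau> \<nu>"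
  shows "fourier (\<lambda>t. q t * y t) \<tau> \<nu> = \<nu>\<^sup>2 * fourier y \<tau> \<nu>"
proof -
  let ?W = "\<lambda>t. v t * sin (\<nu> * t + \<tau>) - y t * (\<nu> * cos (\<nu> * t + \<tau>))"
  have cq: "continuous_on A q" for A using q continuous_on_subset by blast
  have i1: "(\<lambda>t. q t * y t * sin (\<nu> * t + \<tau>)) integrable_on {0..pi}"
    and i2: "(\<lambda>t. \<nu>\<^sup>2 * (y t * sin (\<nu> * t + \<tau>))) integrable_on {0..pi}"
    by (intro integrable_continuous_real continuous_intros cq hill_sol_continuous[OF y])+
  have "((\<lambda>t. \<nu>\<^sup>2 * (y t * sin (\<nu> * t + \<tau>)) - q t * y t * sin (\<nu> * t + \<tau>)) has_integral ?W pi - ?W 0) {0..pi}"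
  proof (rule fundamental_theorem_of_calculus)
    fix t
    have "(?W has_real_derivative \<nu>\<^sup>2 * (y t * sin (\<nu> * t + \<tau>)) - q t * y t * sin (\<nu> * t + \<tau>)) (at t within {0..pi})"
      by (rule derivative_eq_intros hill_solD[OF y] refl | simp add: algebra_simps power2_eq_square)+
    then show "(?W has_vector_derivative \<nu>\<^sup>2 * (y t * sin (\<nu> * t + \<tau>)) - q t * y t * sin (\<nu> * t + \<tau>)) (at t within {0..pi})"
      by (simp add: has_real_derivative_iff_has_vector_derivative)
  qed simp
  moreover have "?W pi = 0" "?W 0 = 0" using c by (auto simp: compatible_def algebra_simps)
  ultimately have "integral {0..pi} (\<lambda>t. \<nu>\<^sup>2 * (y t * sin (\<nu> * t + \<tau>)) - q t * y t * sin (\<nu> * t + \<tau>)) = 0"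
    by (simp add: integral_unique)
  then show ?thesis using integral_diff[OF i2 i1] by (simp add: fourier_def)
qed

lemma fourier_cos:
  assumes f: "continuous_on {0..pi} f"
  shows "fourier (\<lambda>t. cos t * f t) \<tau> \<nu> = (fourier f \<tau> (\<nu> + 1) + fourier f \<tau> (\<nu> - 1)) / 2"
proof -
  have i: "(\<lambda>t. f t * sin (\<mu> * t + \<tau>)) integrable_on {0..pi}" for \<mu>
    by (intro integrable_continuous_real continuous_intros f)
  have eq: "(cos t * f t) * sin (\<nu> * t + \<tau>) = (f t * sin ((\<nu> + 1) * t + \<tau>) + f t * sin ((\<nu> - 1) * t + \<tau>)) / 2" for t
    unfolding mult.commute[of "cos t"] mult.assoc cos_mult_sin_shift by (simp add: distrib_left)
  show ?thesis unfolding fourier_def eq integral_divide integral_add[OF i i] ..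
qed

lemma fourier_add:
  assumes f: "continuous_on {0..pi} f" and g: "continuous_on {0..pi} g"
  shows "fourier (\<lambda>t. a * f t + b * g t) \<tau> \<nu> = a * fourier f \<tau> \<nu> + b * fourier g \<tau> \<nu>"
proof -
  have "(\<lambda>t. a * (f t * sin (\<nu> * t + \<tau>))) integrable_on {0..pi}" "(\<lambda>t. b * (g t * sin (\<nu> * t + \<tau>))) integrable_on {0..pi}"
    by (intro integrable_continuous_real continuous_intros f g)+
  from integral_add[OF this] show ?thesis by (simp add: fourier_def algebra_simps)
qed

text \<open>Coefficients of the identity \<open>(1 + e cos t) q y = (1 + k + e cos t) y\<close>.
  Multiplication by \<open>cos\<close> averages the neighbouring coefficients, and Green's formula
  turns those of \<open>q y\<close> into those of \<open>y\<close>, whence the factors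
  \<open>1 - \<nu>^2\<close>.\<close>

lemma fourier_recurrence:
  assumes e: "\<bar>e\<bar> < 1" and y: "hill_sol (ecc_q k e) y v"
    and c: "compatible y v \<tau> (\<nu> - 1)" "compatible y v \<tau> \<nu>" "compatible y v \<tau> (\<nu> + 1)"
  shows "(1 + k - \<nu>\<^sup>2) * fourier y \<tau> \<nu> +
    e / 2 * ((1 - (\<nu> + 1)\<^sup>2) * fourier y \<tau> (\<nu> + 1) + (1 - (\<nu> - 1)\<^sup>2) * fourier y \<tau> (\<nu> - 1)) = 0"
proof -
  interpret hill "ecc_q k e" "2 + \<bar>k\<bar> / (1 - \<bar>e\<bar>)" by (rule hill_ecc_q[OF e])
  let ?q = "ecc_q k e" let ?g = "\<lambda>t. ?q t * y t"
  have cy: "continuous_on {0..pi} y" by (rule hill_sol_continuous[OF y])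
  have cg: "continuous_on {0..pi} ?g" by (intro continuous_intros cy continuous_on_subset[OF cont_q]) auto
  have cc: "continuous_on {0..pi} (\<lambda>t. cos t * f t)" if "continuous_on {0..pi} f" for f :: "real \<Rightarrow> real"
    by (intro continuous_intros that)
  have eq: "1 * ?g t + e * (cos t * ?g t) = (1 + k) * y t + e * (cos t * y t)" for t
  proof -
    have "1 + e * cos t \<noteq> 0" using one_plus_ecc_cos_pos[OF e, of t] by simp
    then have "(1 + e * cos t) * ?q t = 1 + k + e * cos t" by (simp add: ecc_q_def field_simps)
    then have "((1 + e * cos t) * ?q t) * y t = (1 + k + e * cos t) * y t" by simp
    then show ?thesis by (simp add: algebra_simps)
  qed
  have "1 * fourier ?g \<tau> \<nu> + e * ((fourier ?g \<tau> (\<nu> + 1) + fourier ?g \<tau> (\<nu> - 1)) / 2)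
     = (1 + k) * fourier y \<tau> \<nu> + e * ((fourier y \<tau> (\<nu> + 1) + fourier y \<tau> (\<nu> - 1)) / 2)"
    unfolding fourier_cos[OF cy, symmetric] fourier_cos[OF cg, symmetric]
      fourier_add[OF cy cc[OF cy], symmetric] fourier_add[OF cg cc[OF cg], symmetric] eq ..
  then show ?thesis
    unfolding fourier_green[OF cont_q y c(1)] fourier_green[OF cont_q y c(2)] fourier_green[OF cont_q y c(3)]
    by (simp add: algebra_simps add_divide_distrib diff_divide_distrib)
qed

section \<open>Decay and completeness of Fourier coefficients\<close>

lemma geometric_decay:
  fixes G :: "nat \<Rightarrow> real"
  assumes step: "\<And>n. n \<ge> N \<Longrightarrow> \<bar>G (Suc n)\<bar> \<le> r / 2 * (\<bar>G (Suc (Suc n))\<bar> + \<bar>G n\<bar>)"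
    and K: "\<And>n. \<bar>G n\<bar> \<le> K" and r: "0 \<le> r"
  shows "\<bar>G (N + j + i)\<bar> \<le> K * r ^ j"
\<comment> \<open>The bound holds for all later indices at once, so both neighbours of an index one
  step further in obey the old bound, and their mean gains a factor \<open>r\<close>.\<close>
proof (induction j arbitrary: i)
  case (Suc j)
  have "\<bar>G (Suc (N + j + i))\<bar> \<le> r / 2 * (\<bar>G (N + j + Suc (Suc i))\<bar> + \<bar>G (N + j + i)\<bar>)"
    using step[of "N + j + i"] by simp
  also have "\<dots> \<le> r / 2 * (K * r ^ j + K * r ^ j)"
    using Suc[of "Suc (Suc i)"] Suc[of i] r by (intro mult_left_mono add_mono) auto
  finally show ?case by (simp add: algebra_simps)
qed (use K in simp)

text \<open>The shift \<open>s\<close> is 0 for integer and 1/2 for half-integer frequencies. For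
  large \<open>n\<close> the constant \<open>k\<close> is negligible against the square of the
  frequency, so \<open>G\<close> is at most about \<open>e\<close> times the mean of its neighbours,
  and \<open>e < 1\<close> gives geometric decay.\<close>

lemma ince_decay:
  fixes G C :: "nat \<Rightarrow> real"
  assumes e: "0 \<le> e" "e < 1" and s: "0 \<le> s"
    and G: "\<And>n. G n = (1 - (real n + s)\<^sup>2) * C n"
    and rec: "\<And>n. (1 + k - (real (Suc n) + s)\<^sup>2) * C (Suc n) + e / 2 * (G (Suc (Suc n)) + G n) = 0"
    and K: "\<And>n. \<bar>G n\<bar> \<le> K"
  shows "summable (\<lambda>n. \<bar>G n\<bar>)"
proof -
  \<comment> \<open>\<open>r\<close> lies strictly between \<open>e\<close> and 1;
    \<open>\<delta>\<close> is the relative size tolerated for \<open>k\<close>, chosen so that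
    \<open>1 - \<delta> = e / r\<close>.\<close>
  define r where "r = (1 + e) / 2"
  have r: "0 < r" "r < 1" using e by (auto simp: r_def)
  define \<delta> where "\<delta> = (1 - e) / (1 + e)"
  have \<delta>: "0 < \<delta>" using e by (simp add: \<delta>_def)
  obtain N :: nat where N: "real N > \<bar>k\<bar> / \<delta>" using reals_Archimedean2 by blast
  have step: "\<bar>G (Suc n)\<bar> \<le> r / 2 * (\<bar>G (Suc (Suc n))\<bar> + \<bar>G n\<bar>)" if n: "n \<ge> Suc N" for n
  proof -
    define m where "m = (real (Suc n) + s)\<^sup>2 - 1"
    have "m = (real n + s) * (real n + s + 2)" by (simp add: m_def power2_eq_square algebra_simps)
    moreover have "real n * 1 \<le> (real n + s) * (real n + s + 2)" using s by (intro mult_mono) auto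
    ultimately have m: "m \<ge> real n" by simp
    have m0: "m > 0" using m n by simp
    have "\<bar>k\<bar> / \<delta> < m" using m N n by linarith
    then have km: "\<bar>k\<bar> < \<delta> * m" using \<delta> by (simp add: field_simps)
    have Gm: "G (Suc n) = - m * C (Suc n)" by (simp add: G m_def)
    have "m * \<bar>C (Suc n)\<bar> - \<delta> * m * \<bar>C (Suc n)\<bar> \<le> \<bar>k - m\<bar> * \<bar>C (Suc n)\<bar>"
    proof -
      have "m - \<delta> * m \<le> \<bar>k - m\<bar>" using km by linarith
      from mult_right_mono[OF this, of "\<bar>C (Suc n)\<bar>"] show ?thesis by (simp add: algebra_simps)
    qed
    also have "\<dots> = \<bar>e / 2 * (G (Suc (Suc n)) + G n)\<bar>"
    proof -
      have "(k - m) * C (Suc n) = - (e / 2 * (G (Suc (Suc n)) + G n))"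
        using rec[of n] by (simp add: m_def algebra_simps)
      then show ?thesis by (metis abs_minus_cancel abs_mult)
    qed
    also have "\<dots> \<le> e / 2 * (\<bar>G (Suc (Suc n))\<bar> + \<bar>G n\<bar>)"
      unfolding abs_mult using e by (intro mult_mono) auto
    finally have "(1 - \<delta>) * \<bar>G (Suc n)\<bar> \<le> e / 2 * (\<bar>G (Suc (Suc n))\<bar> + \<bar>G n\<bar>)"
      using m0 by (simp add: Gm abs_mult algebra_simps)
    moreover have "1 - \<delta> = e / r" using e by (simp add: \<delta>_def r_def field_simps)
    ultimately have *: "e * \<bar>G (Suc n)\<bar> \<le> e * (r / 2 * (\<bar>G (Suc (Suc n))\<bar> + \<bar>G n\<bar>))"
      using r by (simp add: field_simps)
    \<comment> \<open>The factor \<open>e\<close> can be cancelled only when nonzero; for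
      \<open>e = 0\<close> the recurrence is diagonal and its coefficient does not vanish at this
      index.\<close>
    show ?thesis
    proof (cases "e = 0")
      case True
      then have "(k - m) * C (Suc n) = 0" using rec[of n] by (simp add: m_def algebra_simps)
      moreover have "k \<noteq> m" using km m0 True by (auto simp: \<delta>_def) 
      ultimately show ?thesis using r by (auto simp: Gm)
    next
      case False
      then show ?thesis using * e by (simp only: mult_le_cancel_left_pos)
    qed
  qed
  have "\<bar>G (j + Suc N)\<bar> \<le> K * r ^ j" for j
    using geometric_decay[of "Suc N" G r K j 0, OF step K] r by (simp add: add.commute)
  then have "summable (\<lambda>j. \<bar>G (j + Suc N)\<bar>)"
    using r by (intro summable_comparison_test'[OF summable_mult[OF summable_geometric[of r], of K]]) auto
  then show ?thesis by (rule summable_iff_shift[THEN iffD1])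
qed

text \<open>As a function of \<open>cos t\<close>, \<open>y\<close> itself is a uniform limit of
  polynomials; vanishing of all weighted moments therefore makes the weighted integral of its square
  vanish.\<close>

lemma weighted_moments_zero:
  fixes y w :: "real \<Rightarrow> real"
  assumes y: "continuous_on {0..pi} y" and w: "continuous_on {0..pi} w"
    and w0: "\<And>t. 0 < t \<Longrightarrow> t < pi \<Longrightarrow> w t > 0"
    and moments: "\<And>j. integral {0..pi} (\<lambda>t. y t * w t * cos t ^ j) = 0"
    and t: "t \<in> {0<..<pi}"
  shows "y t = 0"
proof -
  have poly: "integral {0..pi} (\<lambda>t. y t * w t * p (cos t)) = 0" if pp: "real_polynomial_function p" for p
  proof -
    obtain a n where p: "p = (\<lambda>x. \<Sum>i\<le>n. a i * x ^ i)"
      using pp by (auto simp: real_polynomial_function_iff_sum)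
    have "integral {0..pi} (\<lambda>t. \<Sum>i\<le>n. a i * (y t * w t * cos t ^ i)) = (\<Sum>i\<le>n. integral {0..pi} (\<lambda>t. a i * (y t * w t * cos t ^ i)))"
      by (rule integral_sum) (auto intro!: integrable_continuous_real continuous_intros y w)
    also have "\<dots> = 0" by (simp add: moments)
    finally show ?thesis by (simp add: p sum_distrib_left algebra_simps)
  qed
  have wnn: "w t \<ge> 0" if "t \<in> {0..pi}" for t
  proof (rule ccontr)
    assume neg: "\<not> w t \<ge> 0"
    have "\<forall>x\<in>closure {0<..<pi}. w x \<ge> 0"
    proof
      fix x assume x: "x \<in> closure {0<..<pi}"
      show "w x \<ge> 0"
        by (rule continuous_ge_on_closure[of "{0<..<pi}" w x 0]) (use x w w0 in \<open>auto intro: less_imp_le\<close>)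
    qed
    then show False using neg that by auto
  qed
  let ?f = "\<lambda>x. y (arccos x)"
  have cf: "continuous_on {-1..1} ?f"
    by (rule continuous_on_compose2[OF y]) (auto intro!: continuous_intros arccos_lbound arccos_ubound)
  let ?I = "integral {0..pi} (\<lambda>t. y t * w t * y t)" let ?J = "integral {0..pi} (\<lambda>t. \<bar>y t * w t\<bar>)"
  have I: "?I \<le> \<epsilon> * ?J" if \<epsilon>: "\<epsilon> > 0" for \<epsilon>
  proof -
    obtain p where p: "real_polynomial_function p" "\<And>x. x \<in> {-1..1} \<Longrightarrow> \<bar>?f x - p x\<bar> < \<epsilon>"
      using Stone_Weierstrass_real_polynomial_function[OF compact_Icc cf \<epsilon>] by blast
    have cp: "continuous_on A p" for A
      using p(1) by (intro continuous_on_polymonial_function) (simp add: real_polynomial_function_eq)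
    have cpc: "continuous_on {0..pi} (\<lambda>t. p (cos t))"
      by (rule continuous_on_compose2[OF cp[of UNIV]]) (auto intro!: continuous_intros)
    have "?I = integral {0..pi} (\<lambda>t. y t * w t * y t) - integral {0..pi} (\<lambda>t. y t * w t * p (cos t))"
      by (simp add: poly[OF p(1)])
    also have "\<dots> = integral {0..pi} (\<lambda>t. y t * w t * y t - y t * w t * p (cos t))"
      by (rule integral_diff[symmetric]) (intro integrable_continuous_real continuous_intros y w cpc)+
    also have "\<dots> \<le> integral {0..pi} (\<lambda>t. \<epsilon> * \<bar>y t * w t\<bar>)"
    proof (rule integral_le)
      fix t assume t: "t \<in> {0..pi}"
      have "\<bar>y t - p (cos t)\<bar> < \<epsilon>" using p(2)[of "cos t"] t by (simp add: arccos_cos)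
      then have "\<bar>y t * w t\<bar> * \<bar>y t - p (cos t)\<bar> \<le> \<bar>y t * w t\<bar> * \<epsilon>" by (intro mult_left_mono) auto
      then have "\<bar>y t * w t * (y t - p (cos t))\<bar> \<le> \<epsilon> * \<bar>y t * w t\<bar>" by (simp only: abs_mult mult.commute)
      then show "y t * w t * y t - y t * w t * p (cos t) \<le> \<epsilon> * \<bar>y t * w t\<bar>"
        unfolding right_diff_distrib by linarith
    qed (intro integrable_continuous_real continuous_intros y w cpc)+
    finally show ?thesis by simp
  qed
  have "?I \<le> 0"
  proof (rule ccontr)
    assume n: "\<not> ?I \<le> 0"
    have J: "?J \<ge> 0" by (rule integral_nonneg) (auto intro!: integrable_continuous_real continuous_intros y w)
    have "?I \<le> ?I / (2 * (?J + 1)) * ?J" using n J by (intro I) auto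
    also have "\<dots> = ?I * (?J / (2 * (?J + 1)))" by simp
    also have "\<dots> < ?I * 1" using n J by (intro mult_strict_left_mono) (auto simp: field_simps)
    finally show False by simp
  qed
  moreover have nn: "y t * w t * y t \<ge> 0" if "t \<in> {0..pi}" for t
    using wnn[OF that] by (metis mult.commute mult.left_commute mult_nonneg_nonneg zero_le_square)
  then have "?I \<ge> 0"
    by (intro integral_nonneg) (auto intro!: integrable_continuous_real continuous_intros y w)
  ultimately have I0: "integral (cbox 0 pi) (\<lambda>t. y t * w t * y t) = 0" by simp
  have cyw: "continuous_on (cbox 0 pi) (\<lambda>t. y t * w t * y t)"
    unfolding box_real by (intro continuous_intros y w)
  have "(\<lambda>t. y t * w t * y t) integrable_on cbox 0 pi"
    by (simp, intro integrable_continuous_real continuous_intros y w)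
  then have "((\<lambda>t. y t * w t * y t) has_integral 0) (cbox 0 pi)" using I0 by (simp add: has_integral_iff)
  then have "y t * w t * y t = 0"
    using has_integral_0_cbox_imp_0[of 0 pi "\<lambda>t. y t * w t * y t" t] t nn cyw by auto
  then show ?thesis using w0[of t] t by auto
qed

text \<open>The lowest mode is the positive weight. Multiplying by \<open>cos\<close> shifts modes
  by one in both directions, and \<open>edge\<close> expresses the mode just below the lowest one
  through the two lowest, so moments of every degree are combinations of vanishing
  coefficients.\<close>

lemma fourier_complete:
  assumes y: "continuous_on {0..pi} y"
    and edge: "\<And>t. sin ((\<nu> - 1) * t + \<tau>) = a * sin (\<nu> * t + \<tau>) + b * sin ((\<nu> + 1) * t + \<tau>)"
    and pos: "\<And>t. 0 < t \<Longrightarrow> t < pi \<Longrightarrow> sin (\<nu> * t + \<tau>) > 0"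
    and z: "\<And>n::nat. fourier y \<tau> (\<nu> + real n) = 0"
    and t: "t \<in> {0<..<pi}"
  shows "y t = 0"
proof (rule weighted_moments_zero[OF y _ pos _ t])
  show "continuous_on {0..pi} (\<lambda>t. sin (\<nu> * t + \<tau>))" by (intro continuous_intros)
  have "fourier (\<lambda>t. y t * cos t ^ j) \<tau> (\<nu> + real n) = 0" for j n
  proof (induction j arbitrary: n)
    case 0 then show ?case using z by simp
  next
    case (Suc j)
    let ?f = "\<lambda>t. y t * cos t ^ j"
    have c: "continuous_on {0..pi} ?f" by (intro continuous_intros y)
    have "fourier (\<lambda>t. y t * cos t ^ Suc j) \<tau> (\<nu> + real n) = fourier (\<lambda>t. cos t * ?f t) \<tau> (\<nu> + real n)"
      by (simp add: ac_simps)
    also have "\<dots> = (fourier ?f \<tau> (\<nu> + real n + 1) + fourier ?f \<tau> (\<nu> + real n - 1)) / 2"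
      by (rule fourier_cos[OF c])
    also have "fourier ?f \<tau> (\<nu> + real n + 1) = 0" using Suc[of "Suc n"] by (simp add: ac_simps)
    also have "fourier ?f \<tau> (\<nu> + real n - 1) = 0"
    proof (cases n)
      case 0
      have i: "(\<lambda>t. r * (?f t * sin (\<mu> * t + \<tau>))) integrable_on {0..pi}" for r \<mu>
        by (intro integrable_continuous_real continuous_intros y)
      have "fourier ?f \<tau> (\<nu> - 1) = integral {0..pi} (\<lambda>t. a * (?f t * sin (\<nu> * t + \<tau>)) + b * (?f t * sin ((\<nu> + 1) * t + \<tau>)))"
        unfolding fourier_def edge by (simp add: algebra_simps)
      also have "\<dots> = a * fourier ?f \<tau> (\<nu> + real 0) + b * fourier ?f \<tau> (\<nu> + real 1)"
        unfolding integral_add[OF i i] by (simp add: fourier_def)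
      finally show ?thesis using 0 by (simp only: Suc) simp
    next
      case (Suc m) then show ?thesis using Suc.IH[of m] by (simp add: algebra_simps)
    qed
    finally show ?case by simp
  qed
  from this[of _ 0] show "integral {0..pi} (\<lambda>t. y t * sin (\<nu> * t + \<tau>) * cos t ^ j) = 0" for j
    by (simp add: fourier_def ac_simps)
qed

text \<open>The phase \<open>\<tau>\<close> is arbitrary because the recurrence breaks off at its
  lower end: \<open>G 0\<close> and \<open>G 1\<close> both vanish. Taking 0 and
  \<open>pi / 2\<close> turns one coefficient sequence into an odd and an even periodic
  solution.\<close>

lemma ince_series:
  fixes C G :: "nat \<Rightarrow> real"
  assumes e: "\<bar>e\<bar> < 1" and C0: "C 0 = 0" and G: "\<And>n. G n = (1 - (real n)\<^sup>2) * C n"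
    and rec: "\<And>n. (1 + k - (real (Suc n))\<^sup>2) * C (Suc n) + e / 2 * (G (Suc (Suc n)) + G n) = 0"
    and sumG: "summable (\<lambda>n. \<bar>G n\<bar>)"
  defines "x \<equiv> \<lambda>\<tau> t. \<Sum>n. C n * sin (real n * t + \<tau>)"
    and "u \<equiv> \<lambda>\<tau> t. \<Sum>n. real n * C n * cos (real n * t + \<tau>)"
  shows "hill_sol (ecc_q k e) (x \<tau>) (u \<tau>)"
    and "m > 0 \<Longrightarrow> (\<And>t. x \<tau> t = 0) \<Longrightarrow> C m = 0"
proof -
  \<comment> \<open>A summable majorant of \<open>n^j * C n\<close> for \<open>j\<close> up to 2.
    \<open>G\<close> controls it except at \<open>n = 1\<close>, where the factor
    \<open>1 - n^2\<close> hides \<open>C 1\<close>.\<close>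
  define M where "M n = 2 * \<bar>G n\<bar> + (if n = 1 then \<bar>C 1\<bar> else 0)" for n
  have M: "summable M"
    unfolding M_def by (intro summable_add summable_mult sumG summable_finite[of "{1}"]) auto
  have bound: "\<bar>real n ^ j * C n\<bar> \<le> M n" if "j \<le> 2" for n j
  proof -
    consider "n = 0" | "n = 1" | "n \<ge> 2" by linarith
    then show ?thesis
    proof cases
      case 3
      then have n: "real n \<ge> 2" by simp
      have "real n ^ j \<le> (real n)\<^sup>2" using that n by (intro power_increasing) auto
      also have "\<dots> \<le> 2 * ((real n)\<^sup>2 - 1)" using power_mono[OF n, of 2] by simp
      finally have "real n ^ j * \<bar>C n\<bar> \<le> 2 * ((real n)\<^sup>2 - 1) * \<bar>C n\<bar>" by (rule mult_right_mono) simp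
      also have "2 * ((real n)\<^sup>2 - 1) * \<bar>C n\<bar> = 2 * (((real n)\<^sup>2 - 1) * \<bar>C n\<bar>)" by (simp only: mult.assoc)
      also have "((real n)\<^sup>2 - 1) * \<bar>C n\<bar> = \<bar>G n\<bar>" using power_mono[OF n, of 2] by (simp add: G abs_mult)
      also have "2 * \<bar>G n\<bar> = M n" using 3 by (simp add: M_def)
      finally show ?thesis by (simp add: abs_mult)
    qed (auto simp: M_def C0)
  qed
  have bs: "\<bar>real n ^ j * C n * s\<bar> \<le> M n" if "j \<le> 2" "\<bar>s\<bar> \<le> 1" for n j s
    using mult_mono[OF bound[OF that(1)] that(2), of n] order_trans[OF abs_ge_zero bound[OF that(1)], of n]
    by (simp add: abs_mult)
  have summ: "summable (\<lambda>n. real n ^ j * C n * s n)" if "j \<le> 2" "\<And>n. \<bar>s n\<bar> \<le> 1" for j s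
    by (rule summable_comparison_test'[OF M, of 0]) (use bs[OF that] in auto)
  define a where "a t = (\<Sum>n. (real n)\<^sup>2 * C n * sin (real n * t + \<tau>))" for t
  have dx: "(x \<tau> has_real_derivative u \<tau> t) (at t)" for t
    unfolding x_def u_def
  proof (rule has_field_derivative_series'(2)[of UNIV])
    show "((\<lambda>t. C n * sin (real n * t + \<tau>)) has_real_derivative real n * C n * cos (real n * t + \<tau>)) (at t within UNIV)" for n t
      by (auto intro!: derivative_eq_intros)
    show "uniformly_convergent_on UNIV (\<lambda>n x. \<Sum>i<n. real i * C i * cos (real i * x + \<tau>))"
      by (rule Weierstrass_m_test'[OF _ M]) (use bs[of 1] in auto)
    show "summable (\<lambda>n. C n * sin (real n * 0 + \<tau>))" using summ[of 0 "\<lambda>_. sin \<tau>"] by simp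
  qed auto
  have "(u \<tau> has_real_derivative (\<Sum>n. - ((real n)\<^sup>2 * C n * sin (real n * t + \<tau>)))) (at t)" for t
    unfolding u_def
  proof (rule has_field_derivative_series'(2)[of UNIV])
    show "((\<lambda>t. real n * C n * cos (real n * t + \<tau>)) has_real_derivative - ((real n)\<^sup>2 * C n * sin (real n * t + \<tau>))) (at t within UNIV)" for n t
      by (auto intro!: derivative_eq_intros simp: power2_eq_square)
    show "uniformly_convergent_on UNIV (\<lambda>n x. \<Sum>i<n. - ((real i)\<^sup>2 * C i * sin (real i * x + \<tau>)))"
      by (rule Weierstrass_m_test'[OF _ M]) (use bs[of 2] in auto)
    show "summable (\<lambda>n. real n * C n * cos (real n * 0 + \<tau>))" using summ[of 1 "\<lambda>_. cos \<tau>"] by simp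
  qed auto
  moreover have sa: "summable (\<lambda>n. (real n)\<^sup>2 * C n * sin (real n * t + \<tau>))" for t
    using summ[of 2 "\<lambda>n. sin (real n * t + \<tau>)"] by simp
  ultimately have du: "(u \<tau> has_real_derivative - a t) (at t)" for t
    by (simp add: suminf_minus a_def)
  have ode: "a t = ecc_q k e t * x \<tau> t" for t
  proof -
    let ?s = "\<lambda>n. sin (real n * t + \<tau>)"
    have sx: "(\<lambda>n. C n * ?s n) sums x \<tau> t"
      unfolding x_def using summ[of 0 ?s] by (simp add: summable_sums)
    have sa': "(\<lambda>n. (real n)\<^sup>2 * C n * ?s n) sums a t"
      unfolding a_def by (rule summable_sums[OF sa])
    have sG: "(\<lambda>n. G n * ?s n) sums (x \<tau> t - a t)"
      using sums_diff[OF sx sa'] by (simp add: G algebra_simps)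
    have sS: "summable (\<lambda>n. G n * s n)" if "\<And>n. \<bar>s n\<bar> \<le> 1" for s
      by (rule summable_comparison_test'[OF sumG, of 0]) (use that mult_left_mono[of "\<bar>s n\<bar>" 1 "\<bar>G n\<bar>" for n] in \<open>auto simp: abs_mult\<close>)
    have prod: "2 * cos t * (G n * ?s n) = G n * sin ((real n + 1) * t + \<tau>) + G n * sin ((real n - 1) * t + \<tau>)" for n
      using cos_mult_sin_shift[of t "real n" \<tau>] by (simp add: distrib_left[symmetric])
    have up: "(\<lambda>n. G n * sin ((real n + 1) * t + \<tau>)) sums (\<Sum>n. G n * ?s (Suc n))" (is "_ sums ?U")
      using summable_sums[OF sS[of "\<lambda>n. ?s (Suc n)"]] by (simp add: add.commute)
    have sD: "summable (\<lambda>n. G (Suc n) * ?s n)"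
    proof -
      have "summable (\<lambda>n. \<bar>G (Suc n)\<bar>)" using sumG by (subst summable_Suc_iff)
      then show ?thesis
        by (rule summable_comparison_test'[of _ 0]) (use mult_left_mono[OF abs_sin_le_one, of "\<bar>G (Suc n)\<bar>" "real n * t + \<tau>" for n] in \<open>auto simp: abs_mult\<close>)
    qed
    have G0: "G 0 = 0" "G 1 = 0" by (auto simp: G C0)
    have "(\<lambda>n. G (Suc n) * sin ((real (Suc n) - 1) * t + \<tau>)) sums (\<Sum>n. G (Suc n) * ?s n)" (is "_ sums ?D")
      using summable_sums[OF sD] by simp
    then have down: "(\<lambda>n. G n * sin ((real n - 1) * t + \<tau>)) sums (?D + G 0 * sin ((real 0 - 1) * t + \<tau>))"
      by (rule sums_Suc)
    \<comment> \<open>The product splits into a series with raised and one with lowered frequencies;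
      nothing falls off the lower end because \<open>G 0\<close> and \<open>G 1\<close>
      vanish.\<close>
    have "2 * cos t * (x \<tau> t - a t) = ?U + ?D"
      using sums_unique2[OF sums_mult[OF sG, of "2 * cos t"] sums_add[OF up down, folded prod]] G0 by simp
    also have "?D = (\<Sum>n. G (Suc (Suc n)) * ?s (Suc n))"
      using suminf_split_head[OF sD] G0 by simp
    also have "?U + \<dots> = (\<Sum>n. (G (Suc (Suc n)) + G n) * ?s (Suc n))"
    proof -
      have "summable (\<lambda>n. G (Suc (Suc n)) * ?s (Suc n))" using sD by (subst summable_Suc_iff)
      moreover have "summable (\<lambda>n. G n * ?s (Suc n))" using sS[of "\<lambda>n. ?s (Suc n)"] by simp
      ultimately show ?thesis by (simp add: suminf_add algebra_simps)
    qed
    finally have cosx: "2 * cos t * (x \<tau> t - a t) = (\<Sum>n. (G (Suc (Suc n)) + G n) * ?s (Suc n))" .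
    have "(\<lambda>n. ((1 + k) * C n - (real n)\<^sup>2 * C n) * ?s n) sums ((1 + k) * x \<tau> t - a t)"
      using sums_diff[OF sums_mult[OF sx, of "1 + k"] sa'] by (simp add: algebra_simps)
    then have "(\<lambda>n. ((1 + k) * C (Suc n) - (real (Suc n))\<^sup>2 * C (Suc n)) * ?s (Suc n)) sums ((1 + k) * x \<tau> t - a t)"
      by (subst sums_Suc_iff) (simp add: C0)
    then have "(\<lambda>n. - (e / 2) * ((G (Suc (Suc n)) + G n) * ?s (Suc n))) sums ((1 + k) * x \<tau> t - a t)"
    proof (rule sums_cong[THEN iffD1, rotated])
      fix n
      have "(1 + k) * C (Suc n) - (real (Suc n))\<^sup>2 * C (Suc n) = - (e / 2) * (G (Suc (Suc n)) + G n)"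
        using rec[of n] by (simp add: algebra_simps)
      then show "((1 + k) * C (Suc n) - (real (Suc n))\<^sup>2 * C (Suc n)) * ?s (Suc n) = - (e / 2) * ((G (Suc (Suc n)) + G n) * ?s (Suc n))"
        by (simp only: mult.assoc)
    qed
    then have "(\<Sum>n. - (e / 2) * ((G (Suc (Suc n)) + G n) * ?s (Suc n))) = (1 + k) * x \<tau> t - a t"
      by (rule sums_unique[symmetric])
    moreover have "(\<Sum>n. - (e / 2) * ((G (Suc (Suc n)) + G n) * ?s (Suc n))) = - (e / 2) * (\<Sum>n. (G (Suc (Suc n)) + G n) * ?s (Suc n))"
    proof (rule suminf_mult)
      have "summable (\<lambda>n. G (Suc (Suc n)) * ?s (Suc n))" using sD by (subst summable_Suc_iff)
      moreover have "summable (\<lambda>n. G n * ?s (Suc n))" using sS[of "\<lambda>n. ?s (Suc n)"] by simp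
      ultimately show "summable (\<lambda>n. (G (Suc (Suc n)) + G n) * ?s (Suc n))"
        by (simp add: distrib_right summable_add)
    qed
    ultimately have "(1 + k) * x \<tau> t - a t = - (e / 2) * (2 * cos t * (x \<tau> t - a t))"
      using cosx by simp
    then have "(1 + e * cos t) * a t = (1 + k + e * cos t) * x \<tau> t"
      by (simp add: algebra_simps)
    then show ?thesis
      using one_plus_ecc_cos_pos[OF e, of t] by (simp add: ecc_q_def field_simps)
  qed
  show "hill_sol (ecc_q k e) (x \<tau>) (u \<tau>)"
    using dx du by (simp add: hill_sol_def ode)
  show "C m = 0" if m: "m > 0" and x0: "\<And>t. x \<tau> t = 0"
  proof -
    \<comment> \<open>Orthogonality is used over a full period, where it holds for every phase;
      uniform convergence allows integrating the zero function term by term.\<close>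
    let ?f = "\<lambda>N t. (\<Sum>n<N. C n * sin (real n * t + \<tau>)) * sin (real m * t + \<tau>)"
    have orth: "((\<lambda>t. sin (real n * t + \<tau>) * sin (real m * t + \<tau>)) has_integral (if n = m then pi else 0)) {0..2 * pi}" for n
    proof -
      have id: "sin (real n * t + \<tau>) * sin (real m * t + \<tau>) = (cos ((real n - real m) * t) - cos ((real n + real m) * t + 2 * \<tau>)) / 2" for t
      proof -
        have "(real n - real m) * t = (real n * t + \<tau>) - (real m * t + \<tau>)" "(real n + real m) * t + 2 * \<tau> = (real n * t + \<tau>) + (real m * t + \<tau>)"
          by (simp_all add: algebra_simps)
        then show ?thesis by (simp only: cos_add cos_diff) simp
      qed
      have c: "((\<lambda>t. cos (real_of_int i * t + s)) has_integral (if i = 0 then 2 * pi * cos s else 0)) {0..2 * pi}" for i s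
      proof (cases "i = 0")
        case True
        then show ?thesis using has_integral_const_real[of "cos s" 0 "2 * pi"] by simp
      next
        case False
        have "((\<lambda>t. cos (real_of_int i * t + s)) has_integral (sin (real_of_int i * (2 * pi) + s) / i - sin (real_of_int i * 0 + s) / i)) {0..2 * pi}"
        proof (rule fundamental_theorem_of_calculus)
          fix t
          show "((\<lambda>t. sin (real_of_int i * t + s) / i) has_vector_derivative cos (real_of_int i * t + s)) (at t within {0..2 * pi})"
            unfolding has_real_derivative_iff_has_vector_derivative[symmetric]
            using False by (auto intro!: derivative_eq_intros)
        qed simp
        moreover have "sin (real_of_int i * (2 * pi) + s) = sin s"
          by (simp add: sin_add mult.commute[of "real_of_int i"])
        ultimately show ?thesis using False by simp
      qed
      have "((if int n - int m = 0 then 2 * pi * cos 0 else 0) - (if int n + int m = 0 then 2 * pi * cos (2 * \<tau>) else 0)) / 2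
          = (if n = m then pi else 0)" using m by auto
      then show ?thesis
        using has_integral_divide[OF has_integral_diff[OF c[of "int n - int m" 0] c[of "int n + int m" "2 * \<tau>"]], of 2]
        by (simp only: id of_int_diff of_int_add of_int_of_nat_eq add_0_right)
    qed
    have ul: "uniform_limit {0..2 * pi} (\<lambda>N t. \<Sum>n<N. C n * sin (real n * t + \<tau>)) (x \<tau>) sequentially"
      unfolding x_def by (rule Weierstrass_m_test[OF _ M]) (use bs[of 0] in auto)
    have ul': "uniform_limit {0..2 * pi} ?f (\<lambda>t. 0) sequentially"
    proof (rule uniform_limitI)
      fix \<epsilon> :: real assume "\<epsilon> > 0"
      from uniform_limitD[OF ul this]
      show "\<forall>\<^sub>F N in sequentially. \<forall>t\<in>{0..2 * pi}. dist (?f N t) 0 < \<epsilon>"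
      proof eventually_elim
        case (elim N)
        show ?case
        proof
          fix t assume "t \<in> {0..2 * pi}"
          then have "\<bar>\<Sum>n<N. C n * sin (real n * t + \<tau>)\<bar> < \<epsilon>" using elim x0 by simp
          moreover have "\<bar>?f N t\<bar> \<le> \<bar>\<Sum>n<N. C n * sin (real n * t + \<tau>)\<bar> * 1"
            unfolding abs_mult by (intro mult_left_mono) auto
          ultimately show "dist (?f N t) 0 < \<epsilon>" by (simp add: dist_norm)
        qed
      qed
    qed
    obtain I J where I: "\<And>N. (?f N has_integral I N) {0..2 * pi}" and J: "((\<lambda>t. 0::real) has_integral J) {0..2 * pi}" and IJ: "I \<longlonglongrightarrow> J"
      by (rule uniform_limit_integral[OF ul']) (auto intro!: continuous_intros)
    have "J = 0" using J has_integral_0 has_integral_unique by blast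
    have "I N = C m * pi" if "N > m" for N
    proof (rule has_integral_unique[OF I])
      have "((\<lambda>t. \<Sum>n<N. C n * (sin (real n * t + \<tau>) * sin (real m * t + \<tau>))) has_integral (\<Sum>n<N. C n * (if n = m then pi else 0))) {0..2 * pi}"
        by (intro has_integral_sum has_integral_mult_right orth) auto
      moreover have "(\<Sum>n<N. C n * (if n = m then pi else 0)) = C m * pi"
        using that by (simp add: if_distrib sum.delta cong: if_cong)
      ultimately show "(?f N has_integral C m * pi) {0..2 * pi}" by (simp add: sum_distrib_right mult.assoc)
    qed
    then have "\<forall>\<^sub>F N in sequentially. I N = C m * pi" using eventually_gt_at_top[of m] by (rule eventually_mono[rotated])
    then have "I \<longlonglongrightarrow> C m * pi" by (rule tendsto_eventually)
    then have "C m * pi = J" using IJ LIMSEQ_unique by blast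
    then show ?thesis using \<open>J = 0\<close> by simp
  qed
qed

lemma hill_sol_zero_on_interval:
  assumes y: "hill_sol q y v" and z: "\<And>t. t \<in> {0<..<pi} \<Longrightarrow> y t = 0"
  shows "y 0 = 0" "v 0 = 0"
proof -
  from continuous_constant_on_closure[OF hill_sol_continuous(1)[OF y] z, where x=0, of "{0<..<pi}"]
  show "y 0 = 0" by simp
  have "v t = 0" if t: "t \<in> {0<..<pi}" for t
  proof -
    have "(y has_real_derivative 0) (at t)"
      by (rule has_field_derivative_transform_within_open[OF DERIV_const open_greaterThanLessThan t]) (simp add: z)
    then show ?thesis by (rule DERIV_unique[OF hill_solD(1)[OF y]])
  qed
  from continuous_constant_on_closure[OF hill_sol_continuous(2)[OF y] this, where x=0, of "{0<..<pi}"]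
  show "v 0 = 0" by simp
qed

lemma sin_nat_pi_add: "sin (real n * pi + s) = (-1) ^ n * sin s" "cos (real n * pi + s) = (-1) ^ n * cos s"
  by (simp_all add: sin_add cos_add)

text \<open>In the Fourier recurrence the factor \<open>1 - \<nu>\<^sup>2\<close> vanishes at \<open>\<nu> = 1\<close>, so the modes
  \<open>\<nu> \<ge> 1\<close> decouple and the sine and cosine coefficients satisfy the same equations.\<close>

lemma ince_coexistence:
  assumes e: "0 \<le> e" "e < 1" and k: "k > - 1"
  shows "hill.y2 (ecc_q k e) pi = 0 \<longleftrightarrow> hill.v1 (ecc_q k e) pi = 0"
proof -
  have e': "\<bar>e\<bar> < 1" using e by simp
  interpret hill "ecc_q k e" "2 + \<bar>k\<bar> / (1 - \<bar>e\<bar>)" by (rule hill_ecc_q[OF e'])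
  \<comment> \<open>The coefficients of one solution are resummed with both phases. The two results
    are nonzero; one vanishes at 0 and \<open>pi\<close>, the other has vanishing derivative there,
    so they are multiples of \<open>y2\<close> and of \<open>y1\<close>.\<close>
  have main: "y2 pi = 0 \<and> v1 pi = 0"
    if y: "hill_sol (ecc_q k e) y v" and comp: "\<And>n. compatible y v \<tau> (real n)"
      and F0: "fourier y \<tau> 0 = 0" and ne: "\<exists>n>0. fourier y \<tau> (real n) \<noteq> 0" for y v \<tau>
  proof -
    let ?C = "\<lambda>n. fourier y \<tau> (real n)" let ?G = "\<lambda>n. (1 - (real n)\<^sup>2) * ?C n"
    have cy: "continuous_on {0..pi} y" by (rule hill_sol_continuous[OF y])
    have cg: "continuous_on {0..pi} (\<lambda>t. ecc_q k e t * y t)"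
      by (intro continuous_intros cy continuous_on_subset[OF cont_q]) auto
    obtain K1 K2 where K: "\<And>\<nu>. \<bar>fourier y \<tau> \<nu>\<bar> \<le> K1" "\<And>\<nu>. \<bar>fourier (\<lambda>t. ecc_q k e t * y t) \<tau> \<nu>\<bar> \<le> K2"
      using norm_fourier_le[OF cy] norm_fourier_le[OF cg] by metis
    have rec: "(1 + k - (real (Suc n))\<^sup>2) * ?C (Suc n) + e / 2 * (?G (Suc (Suc n)) + ?G n) = 0" for n
      using fourier_recurrence[OF e' y, of \<tau> "real (Suc n)"] comp[of n] comp[of "Suc n"] comp[of "Suc (Suc n)"]
      by (simp add: add.commute)
    have sumG: "summable (\<lambda>n. \<bar>?G n\<bar>)"
    proof (rule ince_decay[OF e, of 0 ?G ?C k "K1 + K2"])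
      fix n
      have "?G n = ?C n - fourier (\<lambda>t. ecc_q k e t * y t) \<tau> (real n)"
        using fourier_green[OF cont_q y comp, of n] by (simp add: algebra_simps)
      then show "\<bar>?G n\<bar> \<le> K1 + K2" using K(1)[of "real n"] K(2)[of "real n"] by linarith
      show "(1 + k - (real (Suc n) + 0)\<^sup>2) * ?C (Suc n) + e / 2 * (?G (Suc (Suc n)) + ?G n) = 0"
        using rec[of n] by simp
    qed auto
    define x where "x \<sigma> t = (\<Sum>n. ?C n * sin (real n * t + \<sigma>))" for \<sigma> t
    define u where "u \<sigma> t = (\<Sum>n. real n * ?C n * cos (real n * t + \<sigma>))" for \<sigma> t
    have sol: "hill_sol (ecc_q k e) (x \<sigma>) (u \<sigma>)" for \<sigma>
      using ince_series(1)[OF e' _ refl rec sumG, of \<sigma>] F0 by (simp add: x_def[abs_def] u_def[abs_def])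
    have nz: "\<exists>t. x \<sigma> t \<noteq> 0" for \<sigma>
      using ince_series(2)[OF e' _ refl rec sumG, of _ \<sigma>] F0 ne by (auto simp: x_def)
    have "x 0 t = u 0 0 * y2 t" for t
      using hill_sol_unique(1)[OF sol[of 0], of t] by (simp add: x_def)
    moreover have "x 0 pi = 0" by (simp add: x_def)
    ultimately have "y2 pi = 0" using nz[of 0] by auto
    have "u (pi / 2) 0 = 0" by (simp add: u_def)
    then have "x (pi / 2) t = x (pi / 2) 0 * y1 t" "u (pi / 2) t = x (pi / 2) 0 * v1 t" for t
      using hill_sol_unique[OF sol[of "pi / 2"], of t] by simp_all
    moreover have "u (pi / 2) pi = 0" by (simp add: u_def sin_nat_pi_add)
    ultimately have "v1 pi = 0" using nz[of "pi / 2"] by (metis mult_eq_0_iff)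
    with \<open>y2 pi = 0\<close> show ?thesis by simp
  qed
  show ?thesis
  proof
    assume y2: "y2 pi = 0"
    have "\<exists>n>0. fourier y2 0 (real n) \<noteq> 0"
    proof (rule ccontr)
      assume "\<not> ?thesis"
      then have z: "fourier y2 0 (1 + real n) = 0" for n using of_nat_Suc[of n, where 'a=real] by (metis zero_less_Suc)
      have "y2 t = 0" if "t \<in> {0<..<pi}" for t
        by (rule fourier_complete[OF hill_sol_continuous(1)[OF sol2], of 1 0 0 0])
           (use z that in \<open>auto intro: sin_gt_zero\<close>)
      from hill_sol_zero_on_interval(2)[OF sol2 this] show False by simp
    qed
    then show "v1 pi = 0"
      using main[OF sol2, of 0] y2 by (simp add: compatible_def fourier_def)
  next
    assume v1: "v1 pi = 0"
    let ?t = "pi / 2"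
    have comp: "compatible y1 v1 ?t (real n)" for n
      using v1 by (simp add: compatible_def sin_nat_pi_add)
    have compm: "compatible y1 v1 ?t (- 1)"
      using v1 cos_minus[of "pi / 2"] by (simp add: compatible_def)
    \<comment> \<open>At frequency 0 both neighbours are the modes 1 and -1, whose weights vanish;
      what remains is \<open>1 + k\<close> times the mean, and \<open>k > -1\<close>.\<close>
    have F0: "fourier y1 ?t 0 = 0"
      using fourier_recurrence[OF e' sol1, of ?t 0] comp[of 0] comp[of 1] compm k by simp
    have "\<exists>n>0. fourier y1 ?t (real n) \<noteq> 0"
    proof (rule ccontr)
      assume *: "\<not> ?thesis"
      have z: "fourier y1 ?t (0 + real n) = 0" for n using * F0 by (cases n) (auto simp del: of_nat_Suc)
      have "y1 t = 0" if "t \<in> {0<..<pi}" for t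
      proof (rule fourier_complete[OF hill_sol_continuous(1)[OF sol1] _ _ z that, where a=0 and b=1])
        fix t :: real
        have "sin (- t + pi / 2) = sin (t + pi / 2)" by (simp only: sin_add) simp
        then show "sin ((0 - 1) * t + pi / 2) = 0 * sin (0 * t + pi / 2) + 1 * sin ((0 + 1) * t + pi / 2)" by simp
      qed simp
      from hill_sol_zero_on_interval(1)[OF sol1 this] show False by simp
    qed
    then show "y2 pi = 0" using main[OF sol1 comp F0] by blast
  qed
qed

text \<open>If both values vanish, the cosine coefficients \<open>A\<close> and sine coefficients
  \<open>B\<close> at half-integers obey one recurrence; their Casoratian is constant and tends to 0
  by decay, so it is 0. At the edge, the mode \<open>- 1 / 2\<close> is plus the mode
  \<open>1 / 2\<close> for \<open>A\<close> but minus it for \<open>B\<close>. This difference of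
  sign forces \<open>A 0 * B 0 = 0\<close>, and the recurrence then annihilates a whole sequence,
  against completeness.\<close>

lemma ince_no_antiperiodic_coexistence:
  assumes e: "0 < e" "e < 1"
  shows "\<not> (hill.y1 (ecc_q k e) pi = 0 \<and> hill.v2 (ecc_q k e) pi = 0)"
proof
  have e': "\<bar>e\<bar> < 1" "0 \<le> e" using e by simp_all
  interpret hill "ecc_q k e" "2 + \<bar>k\<bar> / (1 - \<bar>e\<bar>)" by (rule hill_ecc_q[OF e'(1)])
  assume z: "y1 pi = 0 \<and> v2 pi = 0"
  have half: "cos ((real n + 1 / 2) * pi) = 0" for n
    using sin_nat_pi_add(2)[of n "pi / 2"] by (simp add: algebra_simps)
  have halfm: "cos (- (1 / 2) * pi) = 0" by simp
  have cc: "compatible y1 v1 (pi / 2) \<nu>" "compatible y2 v2 0 \<nu>" if "cos (\<nu> * pi) = 0" for \<nu>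
    using z that by (simp_all add: compatible_def sin_add)
  define A where "A n = fourier y1 (pi / 2) (real n + 1 / 2)" for n
  define B where "B n = fourier y2 0 (real n + 1 / 2)" for n
  define w where "w n = 1 - (real n + 1 / 2)\<^sup>2" for n
  have Am: "fourier y1 (pi / 2) (- (1 / 2)) = A 0"
  proof -
    have "sin (- (1 / 2) * t + pi / 2) = sin (1 / 2 * t + pi / 2)" for t :: real by (simp only: sin_add) simp
    then show ?thesis unfolding A_def fourier_def by simp
  qed
  have Bm: "fourier y2 0 (- (1 / 2)) = - B 0" unfolding B_def fourier_def by simp
  have recur: "(1 + k - (real (Suc n) + 1 / 2)\<^sup>2) * F (Suc n) + e / 2 * (w (Suc (Suc n)) * F (Suc (Suc n)) + w n * F n) = 0
      \<and> (1 + k - 1 / 4) * F 0 + e / 2 * (w 1 * F 1 + w 0 * fourier y \<tau> (- (1 / 2))) = 0"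
    if y: "hill_sol (ecc_q k e) y v" and c: "\<And>\<nu>. cos (\<nu> * pi) = 0 \<Longrightarrow> compatible y v \<tau> \<nu>"
      and F: "\<And>n. F n = fourier y \<tau> (real n + 1 / 2)" for y v \<tau> F n
  proof
    have a: "real (Suc n) + 1 / 2 - 1 = real n + 1 / 2" "real (Suc n) + 1 / 2 + 1 = real (Suc (Suc n)) + 1 / 2" by simp_all
    show "(1 + k - (real (Suc n) + 1 / 2)\<^sup>2) * F (Suc n) + e / 2 * (w (Suc (Suc n)) * F (Suc (Suc n)) + w n * F n) = 0"
      using fourier_recurrence[OF e'(1) y, of \<tau> "real (Suc n) + 1 / 2", unfolded a, OF c c c, OF half half half]
      by (simp only: F w_def)
    have b: "1 / 2 - 1 = - (1 / 2 :: real)" "(- (1 / 2))\<^sup>2 = (1 / 2 :: real)\<^sup>2" "real 0 + 1 / 2 = 1 / 2" "1 / 2 + 1 = real 1 + 1 / 2" "1 / 4 = (1 / 2 :: real)\<^sup>2"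
      by (simp_all add: power2_eq_square)
    show "(1 + k - 1 / 4) * F 0 + e / 2 * (w 1 * F 1 + w 0 * fourier y \<tau> (- (1 / 2))) = 0"
      using fourier_recurrence[OF e'(1) y, of \<tau> "1 / 2", unfolded b(1,4), OF c c c, OF halfm half[of 0, unfolded b(3)] half]
      unfolding F w_def b(2,3,5) .
  qed
  note recA = recur[OF sol1 cc(1) A_def] and recB = recur[OF sol2 cc(2) B_def]
  \<comment> \<open>A weight vanishes only at frequency 1, which is not a half-integer; hence the
    recurrence can always be solved for the next coefficient.\<close>
  have wne: "w n \<noteq> 0" for n
  proof
    assume "w n = 0"
    then have "(2 * real n + 1)\<^sup>2 = 2\<^sup>2" by (simp add: w_def power2_eq_square field_simps)
    then have "2 * real n + 1 = 2" using power2_eq_iff_nonneg[of "2 * real n + 1" 2] by simp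
    then have "real (2 * n + 1) = real 2" by simp
    then have "2 * n + 1 = 2" by (simp only: of_nat_eq_iff)
    then show False by presburger
  qed
  have lim: "(\<lambda>n. w n * F n) \<longlonglongrightarrow> 0"
    if y: "hill_sol (ecc_q k e) y v" and c: "\<And>\<nu>. cos (\<nu> * pi) = 0 \<Longrightarrow> compatible y v \<tau> \<nu>"
      and F: "\<And>n. F n = fourier y \<tau> (real n + 1 / 2)" for y v \<tau> F
  proof -
    have cy: "continuous_on {0..pi} y" by (rule hill_sol_continuous[OF y])
    have cg: "continuous_on {0..pi} (\<lambda>t. ecc_q k e t * y t)"
      by (intro continuous_intros cy continuous_on_subset[OF cont_q]) auto
    obtain K1 K2 where K: "\<And>\<nu>. \<bar>fourier y \<tau> \<nu>\<bar> \<le> K1" "\<And>\<nu>. \<bar>fourier (\<lambda>t. ecc_q k e t * y t) \<tau> \<nu>\<bar> \<le> K2"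
      using norm_fourier_le[OF cy] norm_fourier_le[OF cg] by metis
    have "summable (\<lambda>n. \<bar>w n * F n\<bar>)"
    proof (rule ince_decay[OF e'(2) e(2), of "1 / 2" "\<lambda>n. w n * F n" F k "K1 + K2"])
      fix n
      have "w n * F n = F n - fourier (\<lambda>t. ecc_q k e t * y t) \<tau> (real n + 1 / 2)"
        using fourier_green[OF cont_q y c[OF half[of n]]] by (simp add: w_def F algebra_simps)
      then show "\<bar>w n * F n\<bar> \<le> K1 + K2" using K(1)[of "real n + 1 / 2"] K(2)[of "real n + 1 / 2"] F[of n] by linarith
      show "(1 + k - (real (Suc n) + 1 / 2)\<^sup>2) * F (Suc n) + e / 2 * (w (Suc (Suc n)) * F (Suc (Suc n)) + w n * F n) = 0"
        using recur[OF y c F] by blast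
    qed (auto simp: w_def)
    from summable_LIMSEQ_zero[OF this] show ?thesis by (simp only: tendsto_rabs_zero_iff)
  qed
  define W where "W n = w (Suc n) * A (Suc n) * (w n * B n) - w (Suc n) * B (Suc n) * (w n * A n)" for n
  have "W (Suc n) = W n" for n
  proof -
    define d where "d = 1 + k - (real (Suc n) + 1 / 2)\<^sup>2"
    have "d * A (Suc n) + e / 2 * (w (Suc (Suc n)) * A (Suc (Suc n)) + w n * A n) = 0"
      "d * B (Suc n) + e / 2 * (w (Suc (Suc n)) * B (Suc (Suc n)) + w n * B n) = 0"
      using recA[of n] recB[of n] by (simp_all only: d_def)
    then have "(d * A (Suc n) + e / 2 * (w (Suc (Suc n)) * A (Suc (Suc n)) + w n * A n)) * (w (Suc n) * B (Suc n))
       - (d * B (Suc n) + e / 2 * (w (Suc (Suc n)) * B (Suc (Suc n)) + w n * B n)) * (w (Suc n) * A (Suc n)) = 0" by simp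
    then have "e / 2 * (W (Suc n) - W n) = 0"
      unfolding W_def by (simp only: distrib_left distrib_right left_diff_distrib right_diff_distrib ac_simps)
    then show ?thesis using e by simp
  qed
  then have Wc: "W n = W 0" for n by (induction n) auto
  have "W \<longlonglongrightarrow> 0 * 0 - 0 * 0"
    unfolding W_def using lim[OF sol1 cc(1) A_def] lim[OF sol2 cc(2) B_def]
    by (intro tendsto_intros LIMSEQ_Suc) (auto dest: LIMSEQ_Suc)
  moreover have "W \<longlonglongrightarrow> W 0" using Wc by (intro tendsto_eventually always_eventually) blast
  ultimately have W0: "W 0 = 0" using LIMSEQ_unique[of W "W 0" 0] by simp
  have a0: "(1 + k - 1 / 4) * A 0 + e / 2 * (w 1 * A 1 + w 0 * A 0) = 0"
    and b0: "(1 + k - 1 / 4) * B 0 + e / 2 * (w 1 * B 1 - w 0 * B 0) = 0"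
    using recA[of 0] recB[of 0] by (simp_all add: Am Bm)
  \<comment> \<open>The elimination that proved \<open>W\<close> constant, now applied to the edge
    equations: here the two couplings add up instead of cancelling.\<close>
  have "A 0 * B 0 = 0"
  proof -
    have "((1 + k - 1 / 4) * A 0 + e / 2 * (w 1 * A 1 + w 0 * A 0)) * (w 0 * B 0)
       - ((1 + k - 1 / 4) * B 0 + e / 2 * (w 1 * B 1 - w 0 * B 0)) * (w 0 * A 0) = e / 2 * W 0 + e * (w 0 * A 0) * (w 0 * B 0)"
      by (simp add: W_def field_simps)
    then have "e * (w 0 * A 0) * (w 0 * B 0) = 0" using a0 b0 W0 by simp
    then show ?thesis using e wne[of 0] by simp
  qed
  have allz: "F n = 0"
    if r: "\<And>n. (1 + k - (real (Suc n) + 1 / 2)\<^sup>2) * F (Suc n) + e / 2 * (w (Suc (Suc n)) * F (Suc (Suc n)) + w n * F n) = 0"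
      and F0: "F 0 = 0" and F1: "F 1 = 0" for F :: "nat \<Rightarrow> real" and n
  proof -
    have "F n = 0 \<and> F (Suc n) = 0"
    proof (induction n)
      case (Suc n)
      then have "e / 2 * (w (Suc (Suc n)) * F (Suc (Suc n))) = 0" using r[of n] by simp
      then show ?case using Suc wne[of "Suc (Suc n)"] e by simp
    qed (use F0 F1 in simp)
    then show ?thesis ..
  qed
  from \<open>A 0 * B 0 = 0\<close> consider "A 0 = 0" | "B 0 = 0" by auto
  then show False
  proof cases
    case 1
    then have "A 1 = 0" using a0 wne[of 1] e by simp
    then have "A n = 0" for n using allz[of A] recA 1 by blast
    then have z: "fourier y1 (pi / 2) (1 / 2 + real n) = 0" for n by (simp add: A_def add.commute)
    have "y1 t = 0" if "t \<in> {0<..<pi}" for t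
    proof (rule fourier_complete[OF hill_sol_continuous(1)[OF sol1] _ _ z that, where a=1 and b=0])
      fix t :: real
      have "sin (- (t / 2) + pi / 2) = sin (t / 2 + pi / 2)" by (simp only: sin_add) simp
      then show "sin ((1 / 2 - 1) * t + pi / 2) = 1 * sin (1 / 2 * t + pi / 2) + 0 * sin ((1 / 2 + 1) * t + pi / 2)" by simp
    next
      fix t :: real assume "0 < t" "t < pi"
      then show "sin (1 / 2 * t + pi / 2) > 0" by (simp add: sin_add cos_gt_zero)
    qed
    from hill_sol_zero_on_interval(1)[OF sol1 this] show False by simp
  next
    case 2
    then have "B 1 = 0" using b0 wne[of 1] e by simp
    then have "B n = 0" for n using allz[of B] recB 2 by blast
    then have z: "fourier y2 0 (1 / 2 + real n) = 0" for n by (simp add: B_def add.commute)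
    have "y2 t = 0" if "t \<in> {0<..<pi}" for t
    proof (rule fourier_complete[OF hill_sol_continuous(1)[OF sol2] _ _ z that, where a="-1" and b=0])
      fix t :: real
      show "sin ((1 / 2 - 1) * t + 0) = - 1 * sin (1 / 2 * t + 0) + 0 * sin ((1 / 2 + 1) * t + 0)" by simp
    next
      fix t :: real assume "0 < t" "t < pi"
      then show "sin (1 / 2 * t + 0) > 0" by (simp add: sin_gt_zero)
    qed
    from hill_sol_zero_on_interval(2)[OF sol2 this] show False by simp
  qed
qed

section \<open>Dependence on the parameters\<close>

abbreviation ecc_dom :: "(real \<times> real) set" where
  "ecc_dom \<equiv> UNIV \<times> {-1<..<1}"

lemma continuous_on_hill_flow_ecc:
  "continuous_on (ecc_dom \<times> UNIV) (\<lambda>(p, t). hill_flow (ecc_q (fst p) (snd p)) z t)"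
proof -
  have "continuous (at (p, t)) (\<lambda>(p, t). hill_flow (ecc_q (fst p) (snd p)) z t)" if p: "p \<in> ecc_dom" for p t
  proof -
    obtain k0 e0 where ke: "p = (k0, e0)" "\<bar>e0\<bar> < 1" using p by (cases p) auto
    \<comment> \<open>The coefficient bound blows up as \<open>e\<close> approaches 1 in modulus, so
      the uniform estimates are applied in a box around the given point.\<close>
    define K where "K = \<bar>k0\<bar> + 1" define r where "r = (1 + \<bar>e0\<bar>) / 2"
    let ?P = "{-K<..<K} \<times> {-r<..<r}"
    have r: "0 < r" "r < 1" "\<bar>e0\<bar> < r" using ke by (auto simp: r_def)
    have "continuous_on (?P \<times> UNIV) (\<lambda>(p, t). hill_flow (ecc_q (fst p) (snd p)) z t)"
    proof (rule continuous_on_hill_flow_param)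
      have "1 + snd (fst x) * cos (snd x) \<noteq> 0" if "x \<in> ?P \<times> UNIV" for x :: "(real \<times> real) \<times> real"
      proof -
        have "\<bar>snd (fst x)\<bar> < 1" using that r by auto
        from one_plus_ecc_cos_pos[OF this, of "snd x"] show ?thesis by simp
      qed
      then show "continuous_on (?P \<times> UNIV) (\<lambda>(p, t). ecc_q (fst p) (snd p) t)"
        unfolding ecc_q_def case_prod_unfold by (intro continuous_intros) auto
      fix q :: "real \<times> real" and s assume q: "q \<in> ?P"
      have "\<bar>fst q\<bar> \<le> K" "\<bar>snd q\<bar> < r" using q by auto
      then have "\<bar>fst q\<bar> / (1 - \<bar>snd q\<bar>) \<le> K / (1 - r)" using r by (intro frac_le) auto
      moreover have "1 + \<bar>ecc_q (fst q) (snd q) s\<bar> \<le> 2 + \<bar>fst q\<bar> / (1 - \<bar>snd q\<bar>)"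
        by (rule hill.bound_q[OF hill_ecc_q]) (use \<open>\<bar>snd q\<bar> < r\<close> r in auto)
      ultimately show "1 + \<bar>ecc_q (fst q) (snd q) s\<bar> \<le> 2 + K / (1 - r)" by linarith
    qed
    moreover have op: "open (?P \<times> (UNIV::real set))" by (intro open_Times) auto
    moreover have "(p, t) \<in> ?P \<times> UNIV" using ke r by (auto simp: K_def)
    ultimately show ?thesis unfolding continuous_on_eq_continuous_at[OF op] by blast
  qed
  then show ?thesis by (intro continuous_at_imp_continuous_on) blast
qed

lemma continuous_on_hill_flow_ecc_comp [continuous_intros]:
  assumes "continuous_on A f" "continuous_on A g" "continuous_on A h" "\<And>x. x \<in> A \<Longrightarrow> \<bar>g x\<bar> < 1"
  shows "continuous_on A (\<lambda>x. hill_flow (ecc_q (f x) (g x)) z (h x))"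
proof -
  have "continuous_on A (\<lambda>x. (\<lambda>(p, t). hill_flow (ecc_q (fst p) (snd p)) z t) ((f x, g x), h x))"
    by (rule continuous_on_compose2[OF continuous_on_hill_flow_ecc])
       (use assms in \<open>auto intro!: continuous_intros simp: abs_less_iff\<close>)
  then show ?thesis by simp
qed

lemma continuous_on_ecc_q [continuous_intros]:
  fixes f g h :: "'a::t2_space \<Rightarrow> real"
  assumes "continuous_on A f" "continuous_on A g" "continuous_on A h" "\<And>x. x \<in> A \<Longrightarrow> \<bar>g x\<bar> < 1"
  shows "continuous_on A (\<lambda>x. ecc_q (f x) (g x) (h x))"
proof -
  have "1 + g x * cos (h x) \<noteq> 0" if "x \<in> A" for x
    using one_plus_ecc_cos_pos[OF assms(4)[OF that], of "h x"] by simp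
  then show ?thesis unfolding ecc_q_def using assms(1-3)
    by (intro continuous_on_add continuous_on_const continuous_on_divide continuous_on_mult continuous_on_cos) auto
qed

lemma hill_flow_ecc_nonzero: "\<bar>e\<bar> < 1 \<Longrightarrow> z \<noteq> 0 \<Longrightarrow> hill_flow (ecc_q k e) z t \<noteq> 0"
  using hill.flow_nonzero[OF hill_ecc_q] by blast

lemma continuous_on_hill_angle_ecc:
  assumes z: "z \<noteq> 0"
  shows "continuous_on ecc_dom (\<lambda>p. hill_angle (ecc_q (fst p) (snd p)) z t)"
proof -
  have "continuous_on (ecc_dom \<times> cbox 0 1) (\<lambda>x. hill_field (ecc_q (fst (fst x)) (snd (fst x)) (t * snd x))
      (hill_flow (ecc_q (fst (fst x)) (snd (fst x))) z (t * snd x)) / hill_flow (ecc_q (fst (fst x)) (snd (fst x))) z (t * snd x))"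
    by (intro continuous_intros) (auto simp: hill_flow_ecc_nonzero z abs_less_iff)
  then have "continuous_on (ecc_dom \<times> cbox 0 1) (\<lambda>(p, s). hill_field (ecc_q (fst p) (snd p) (t * s))
      (hill_flow (ecc_q (fst p) (snd p)) z (t * s)) / hill_flow (ecc_q (fst p) (snd p)) z (t * s))"
    by (simp add: case_prod_unfold)
  from integral_continuous_on_param[OF this] show ?thesis
    unfolding hill_angle_def hill_log_def by (intro continuous_intros) simp
qed

lemma continuous_on_hill_angle_ecc1:
  assumes "z \<noteq> 0" "\<bar>e\<bar> < 1"
  shows "continuous_on A (\<lambda>k. hill_angle (ecc_q k e) z t)"
proof -
  have "continuous_on A (\<lambda>k. (\<lambda>p. hill_angle (ecc_q (fst p) (snd p)) z t) (k, e))"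
    by (rule continuous_on_compose2[OF continuous_on_hill_angle_ecc[OF assms(1)]])
       (use assms in \<open>auto intro!: continuous_intros\<close>)
  then show ?thesis by simp
qed

text \<open>Lagrange's identity: the Wronskian of solutions for two parameters has derivative
  \<open>-(k' - k)\<close> times their product over \<open>1 + e cos t\<close>. For
  \<open>k' = k\<close> the integrand is a weighted square, so the integral is positive, and it
  depends continuously on \<open>k'\<close>. This replaces differentiation in
  \<open>k\<close>.\<close>

lemma sturm_local:
  assumes e: "\<bar>e\<bar> < 1" and z: "z \<noteq> 0"
  shows "\<exists>\<delta>>0. \<forall>k'. \<bar>k' - k\<bar> < \<delta> \<longrightarrow> (\<exists>I>0.
    Re (hill_flow (ecc_q k' e) z pi) * Im (hill_flow (ecc_q k e) z pi)
    - Im (hill_flow (ecc_q k' e) z pi) * Re (hill_flow (ecc_q k e) z pi) = - (k' - k) * I)"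
proof -
  let ?y = "\<lambda>k t. Im (hill_flow (ecc_q k e) z t)" and ?v = "\<lambda>k t. Re (hill_flow (ecc_q k e) z t)"
  define I where "I k' = integral {0..pi} (\<lambda>t. ?y k' t * ?y k t / (1 + e * cos t))" for k'
  have sol: "hill_sol (ecc_q k e) (?y k) (?v k)" for k
    by (rule hill.hill_sol_flow[OF hill_ecc_q[OF e]])
  have pos: "1 + e * cos t > 0" for t by (rule one_plus_ecc_cos_pos[OF e])
  have ne: "1 + e * cos t \<noteq> 0" for t using pos[of t] by simp
  have lag: "?v k' pi * ?y k pi - ?y k' pi * ?v k pi = - (k' - k) * I k'" for k'
  proof -
    let ?W = "\<lambda>t. ?v k' t * ?y k t - ?y k' t * ?v k t"
    let ?h = "\<lambda>t. - (k' - k) * (?y k' t * ?y k t / (1 + e * cos t))"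
    have "(?h has_integral ?W pi - ?W 0) {0..pi}"
    proof (rule fundamental_theorem_of_calculus)
      fix t
      have "(?W has_real_derivative ?h t) (at t within {0..pi})"
        by (rule hill_solD[OF sol] derivative_eq_intros refl)+ (simp add: ecc_q_def divide_inverse algebra_simps)
      then show "(?W has_vector_derivative ?h t) (at t within {0..pi})"
        by (simp add: has_real_derivative_iff_has_vector_derivative)
    qed simp
    moreover have "?W 0 = 0" by (simp add: hill.flow_0[OF hill_ecc_q[OF e]])
    ultimately show ?thesis by (simp only: I_def integral_mult_right[symmetric] integral_unique diff_0_right)
  qed
  have "continuous_on (UNIV \<times> cbox 0 pi) (\<lambda>(k', t). ?y k' t * ?y k t / (1 + e * cos t))"
    unfolding case_prod_unfold using ne e by (intro continuous_intros) auto
  from integral_continuous_on_param[OF this] have cI: "isCont I k"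
    by (simp add: I_def[abs_def] continuous_on_eq_continuous_at)
  have "I k > 0"
  proof -
    let ?f = "\<lambda>t. ?y k t * ?y k t / (1 + e * cos t)"
    have cf: "continuous_on (cbox 0 pi) ?f" using ne e by (intro continuous_intros) auto
    have fi: "?f integrable_on cbox 0 pi" using cf by (rule integrable_continuous)
    have nn: "?f t \<ge> 0" for t using pos[of t] by simp
    have "I k \<ge> 0" unfolding I_def using fi nn by (intro integral_nonneg) auto
    moreover have "I k \<noteq> 0"
    proof
      assume "I k = 0"
      then have "(?f has_integral 0) (cbox 0 pi)" using fi by (simp add: I_def has_integral_iff)
      then have "?f t = 0" if "t \<in> {0<..<pi}" for t
        using has_integral_0_cbox_imp_0[OF cf _ _ , of t] nn that by auto
      then have "?y k t = 0" if "t \<in> {0<..<pi}" for t using that ne by fastforce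
      from hill_sol_zero_on_interval[OF sol this] z show False
        by (simp add: hill.flow_0[OF hill_ecc_q[OF e]] complex_eq_iff)
    qed
    ultimately show ?thesis by simp
  qed
  then have "\<forall>\<^sub>F k' in nhds k. I k' > 0"
    using cI by (intro order_tendstoD(1)[of I "I k"]) (auto simp: isCont_def tendsto_at_iff_tendsto_nhds)
  then obtain \<delta> where "\<delta> > 0" "\<And>k'. dist k' k < \<delta> \<Longrightarrow> I k' > 0" by (auto simp: eventually_nhds_metric)
  then show ?thesis using lag by (intro exI[of _ \<delta>]) (auto simp: dist_real_def)
qed

text \<open>The values at \<open>pi\<close> as functions of \<open>(k, e)\<close>, outside the
  locale, so that continuity in the parameters can be expressed.\<close>

definition "y1pi k e = Im (hill_flow (ecc_q k e) \<i> pi)"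
definition "v1pi k e = Re (hill_flow (ecc_q k e) \<i> pi)"
definition "y2pi k e = Im (hill_flow (ecc_q k e) 1 pi)"
definition "v2pi k e = Re (hill_flow (ecc_q k e) 1 pi)"

lemmas pi_defs = y1pi_def v1pi_def y2pi_def v2pi_def

lemma hill_pi_eq:
  assumes "\<bar>e\<bar> < 1"
  shows "hill.y1 (ecc_q k e) pi = y1pi k e" "hill.v1 (ecc_q k e) pi = v1pi k e"
    "hill.y2 (ecc_q k e) pi = y2pi k e" "hill.v2 (ecc_q k e) pi = v2pi k e"
proof -
  interpret hill "ecc_q k e" "2 + \<bar>k\<bar> / (1 - \<bar>e\<bar>)" by (rule hill_ecc_q[OF assms])
  show "y1 pi = y1pi k e" "v1 pi = v1pi k e" "y2 pi = y2pi k e" "v2 pi = v2pi k e"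
    by (simp_all add: pi_defs y1_def v1_def y2_def v2_def)
qed

lemma det_pi: "\<bar>e\<bar> < 1 \<Longrightarrow> y1pi k e * v2pi k e - v1pi k e * y2pi k e = 1"
  using hill.det_1[OF hill_ecc_q, of e k pi] by (simp add: hill_pi_eq)

lemma continuous_on_pi [continuous_intros]:
  assumes "continuous_on A f" "continuous_on A g" "\<And>x. x \<in> A \<Longrightarrow> \<bar>g x\<bar> < 1"
  shows "continuous_on A (\<lambda>x. y1pi (f x) (g x))" "continuous_on A (\<lambda>x. v1pi (f x) (g x))"
    "continuous_on A (\<lambda>x. y2pi (f x) (g x))" "continuous_on A (\<lambda>x. v2pi (f x) (g x))"
  unfolding pi_defs by (intro continuous_intros assms; (assumption)?)+

lemma sturm_pi:
  assumes e: "\<bar>e\<bar> < 1"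
  shows "\<exists>\<delta>>0. \<forall>k'. \<bar>k' - k\<bar> < \<delta> \<longrightarrow>
    (\<exists>I>0. v1pi k' e * y1pi k e - y1pi k' e * v1pi k e = - (k' - k) * I) \<and>
    (\<exists>I>0. v2pi k' e * y2pi k e - y2pi k' e * v2pi k e = - (k' - k) * I)"
proof -
  obtain d1 where d1: "d1 > 0" "\<And>k'. \<bar>k' - k\<bar> < d1 \<Longrightarrow> \<exists>I>0. v1pi k' e * y1pi k e - y1pi k' e * v1pi k e = - (k' - k) * I"
    using sturm_local[OF e, of \<i> k] by (auto simp: pi_defs)
  obtain d2 where d2: "d2 > 0" "\<And>k'. \<bar>k' - k\<bar> < d2 \<Longrightarrow> \<exists>I>0. v2pi k' e * y2pi k e - y2pi k' e * v2pi k e = - (k' - k) * I"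
    using sturm_local[OF e, of 1 k] by (auto simp: pi_defs)
  show ?thesis
    by (rule exI[of _ "min d1 d2"]) (use d1 d2 in auto)
qed

lemma coexist_pi:
  assumes e: "0 \<le> e" "e < 1" and k: "k > -1" and z: "v1pi k e * y2pi k e = 0"
  shows "v1pi k e = 0" "y2pi k e = 0"
  using ince_coexistence[OF e k] z e by (auto simp: hill_pi_eq)

text \<open>At coexistence \<open>y1 v2 = 1\<close> at \<open>pi\<close>, so these two have equal
  signs. By Lagrange's identity, increasing \<open>k\<close> gives \<open>v1\<close> the sign
  opposite to \<open>y1\<close>, and \<open>y2\<close> the sign of \<open>v2\<close>.\<close>

lemma right_of_coexistence:
  assumes e: "0 \<le> e" "e < 1" and z: "v1pi k e = 0" "y2pi k e = 0"
  shows "\<exists>\<delta>>0. \<forall>k'. k < k' \<and> k' < k + \<delta> \<longrightarrow> v1pi k' e * y2pi k' e < 0"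
proof -
  obtain d where d: "d > 0" "\<And>k'. \<bar>k' - k\<bar> < d \<Longrightarrow>
    (\<exists>I>0. v1pi k' e * y1pi k e - y1pi k' e * v1pi k e = - (k' - k) * I) \<and>
    (\<exists>I>0. v2pi k' e * y2pi k e - y2pi k' e * v2pi k e = - (k' - k) * I)"
    using sturm_pi[of e k] e by auto
  have det: "y1pi k e * v2pi k e = 1" using det_pi[of e k] e z by simp
  have "v1pi k' e * y2pi k' e < 0" if k': "k < k'" "k' < k + d" for k'
  proof -
    have "\<bar>k' - k\<bar> < d" using k' by simp
    from d(2)[OF this] obtain I J where IJ: "I > 0" "J > 0" "v1pi k' e * y1pi k e = - (k' - k) * I"
      "- (y2pi k' e * v2pi k e) = - (k' - k) * J" by (auto simp: z)
    then have IJ': "y2pi k' e * v2pi k e = (k' - k) * J" by (simp only: minus_mult_left[symmetric] neg_equal_iff_equal)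
    have "v1pi k' e * y2pi k' e = (v1pi k' e * y2pi k' e) * (y1pi k e * v2pi k e)" using det by simp
    also have "\<dots> = (v1pi k' e * y1pi k e) * (y2pi k' e * v2pi k e)" by simp
    also have "\<dots> = - ((k' - k) * I * ((k' - k) * J))" unfolding IJ(3) IJ' by (simp only: mult_minus_left)
    also have "\<dots> < 0" using IJ k' by simp
    finally show ?thesis .
  qed
  with d(1) show ?thesis by blast
qed

lemma ecc_q_0: "ecc_q 0 e = (\<lambda>t. 1)" by (simp add: ecc_q_def fun_eq_iff)

lemma hill_flow_zero_param:
  assumes e: "\<bar>e\<bar> < 1"
  shows "hill_flow (ecc_q 0 e) z t = z * cis t"
proof -
  interpret hill "ecc_q 0 e" "2 + \<bar>0\<bar> / (1 - \<bar>e\<bar>)" by (rule hill_ecc_q[OF e])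
  have c: "hill_sol (ecc_q 0 e) cos (\<lambda>t. - sin t)" and s: "hill_sol (ecc_q 0 e) sin cos"
    by (auto simp: hill_sol_def ecc_q_0 intro!: derivative_eq_intros)
  have "y1 t = cos t" "v1 t = - sin t" using hill_sol_unique[OF c, of t] by simp_all
  moreover have "y2 t = sin t" "v2 t = cos t" using hill_sol_unique[OF s, of t] by simp_all
  ultimately show ?thesis
    unfolding flow_eq by (simp add: complex_eq_iff)
qed

lemma hill_angle_zero_param:
  assumes e: "\<bar>e\<bar> < 1" and z: "z \<noteq> 0"
  shows "hill_angle (ecc_q 0 e) z t = t"
proof -
  have *: "hill_field 1 x / x = \<i>" if "x \<noteq> 0" for x
  proof -
    have "hill_field 1 x = \<i> * x" by (simp add: hill_field_def complex_eq_iff)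
    then show ?thesis using that by simp
  qed
  have "hill_flow (\<lambda>t. 1) z t \<noteq> 0" for t using hill_flow_ecc_nonzero[OF e z, of 0] by (simp add: ecc_q_0)
  then show ?thesis using * by (simp add: hill_angle_def hill_log_def ecc_q_0)
qed

text \<open>At \<open>k = 0\<close> the product is zero. Every zero is a coexistence point with
  negative values to its right, so a positive value at \<open>k\<close> would require a further zero
  beyond the last one. The bound on the trace follows from trace \<open>2 + 4 v1 y2\<close>.\<close>

lemma trace_le_2:
  assumes e: "0 \<le> e" "e < 1" and k: "k \<ge> 0"
  shows "v1pi k e * y2pi k e \<le> 0"
proof (rule ccontr)
  assume pos: "\<not> v1pi k e * y2pi k e \<le> 0"
  let ?f = "\<lambda>k. v1pi k e * y2pi k e"
  let ?S = "{x \<in> {0..k}. ?f x = 0}"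
  have e': "\<bar>e\<bar> < 1" using e by simp
  have cf: "continuous_on A ?f" for A using e' by (intro continuous_intros) auto
  have "closed ?S" by (rule continuous_closed_preimage_constant[OF cf]) auto
  moreover have "0 \<in> ?S" using k e' by (simp add: pi_defs hill_flow_zero_param)
  moreover have "bdd_above ?S" by (rule bdd_aboveI[of _ k]) auto
  ultimately have \<kappa>: "Sup ?S \<in> ?S" by (intro closed_contains_Sup) auto
  define \<kappa> where "\<kappa> = Sup ?S"
  have \<kappa>1: "0 \<le> \<kappa>" "\<kappa> \<le> k" "?f \<kappa> = 0" using \<kappa> by (auto simp: \<kappa>_def)
  then have "\<kappa> < k" using pos by (cases "\<kappa> = k") auto
  obtain d where d: "d > 0" "\<And>k'. \<kappa> < k' \<Longrightarrow> k' < \<kappa> + d \<Longrightarrow> ?f k' < 0"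
    using right_of_coexistence[OF e, of \<kappa>] coexist_pi[OF e, of \<kappa>] \<kappa>1 by auto
  define k' where "k' = min k (\<kappa> + d / 2)"
  have k': "\<kappa> < k'" "k' < \<kappa> + d" "k' \<le> k" using d(1) \<open>\<kappa> < k\<close> by (auto simp: k'_def)
  obtain x where x: "k' \<le> x" "x \<le> k" "?f x = 0"
    using IVT'[of ?f k' 0 k] d(2)[OF k'(1,2)] pos k'(3) cf by auto
  then have "x \<in> ?S" using k' \<kappa>1 by auto
  then have "x \<le> \<kappa>" unfolding \<kappa>_def by (intro cSup_upper bdd_aboveI[of _ k]) auto
  then show False using x k' by linarith
qed

section \<open>Eigenvectors and powers of the monodromy matrix\<close>

context hill
begin

abbreviation "half_trace \<equiv> y1 pi * v2 pi + v1 pi * y2 pi"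

lemma flow_2pi: "flow z (2 * pi) = Complex (Im z * (2 * y1 pi * v1 pi) + Re z * half_trace) (Im z * half_trace + Re z * (2 * y2 pi * v2 pi))"
  unfolding flow_eq[of z "2 * pi"] monodromy ..

text \<open>With \<open>s = y1 * v2\<close> at \<open>pi\<close> the half trace is
  \<open>2 * s - 1\<close>, hence at most -1, and both eigenvalues are real and negative. For
  \<open>s = 0\<close> the eigenvalue is -1 with an explicit eigenvector.\<close>

lemma negative_eigenvector:
  assumes "y1 pi * v2 pi \<le> 0"
  shows "\<exists>z r. z \<noteq> 0 \<and> r < 0 \<and> flow z (2 * pi) = of_real r * z"
proof -
  have det: "v1 pi * y2 pi = y1 pi * v2 pi - 1" using det_1[of pi] by simp
  consider "y1 pi = 0" | "v2 pi = 0" | "y1 pi * v2 pi < 0" using assms by fastforce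
  then show ?thesis
  proof cases
    case 1
    then have "flow \<i> (2 * pi) = of_real (- 1) * \<i>" using det by (simp add: flow_2pi complex_eq_iff)
    then show ?thesis by (intro exI[of _ \<i>] exI[of _ "- 1"]) simp
  next
    case 2
    then have "flow 1 (2 * pi) = of_real (- 1) * 1" using det by (simp add: flow_2pi complex_eq_iff)
    then show ?thesis by (intro exI[of _ 1] exI[of _ "- 1"]) simp
  next
    case 3
    define s where "s = y1 pi * v2 pi"
    have s: "s < 0" using 3 by (simp add: s_def)
    let ?B = "2 * y1 pi * v1 pi" and ?E = "2 * y2 pi * v2 pi" and ?D = "half_trace"
    have D: "?D = 2 * s - 1" using det by (simp add: s_def)
    have BE: "?B * ?E = 4 * (s * (s - 1))"
    proof -
      have "?B * ?E = 4 * ((y1 pi * v2 pi) * (v1 pi * y2 pi))" by simp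
      then show ?thesis by (simp only: det s_def)
    qed
    \<comment> \<open>\<open>?B * ?E\<close> equals \<open>?D^2 - 1\<close>, so
      \<open>?D + w\<close> is an eigenvalue, with eigenvector \<open>Complex ?B w\<close>.\<close>
    define w where "w = sqrt (?B * ?E)"
    have "s * (s - 1) > 0" using s by (intro mult_neg_neg) auto
    then have w: "w * w = ?B * ?E" "w > 0" unfolding w_def BE by simp_all
    have "w < 1 - 2 * s"
    proof (rule power_less_imp_less_base)
      show "w ^ 2 < (1 - 2 * s) ^ 2" using w(1) unfolding BE by (simp add: power2_eq_square algebra_simps)
    qed (use s in simp)
    then have r: "?D + w < 0" unfolding D by simp
    have "flow (Complex ?B w) (2 * pi) = of_real (?D + w) * Complex ?B w"
      unfolding flow_2pi using w(1) by (simp add: complex_eq_iff) (simp add: algebra_simps)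
    moreover have "Complex ?B w \<noteq> 0" using w by (simp add: complex_eq_iff)
    ultimately show ?thesis using r by blast
  qed
qed

text \<open>The second conjunct identifies \<open>j\<close> through the solution starting at 1,
  whose angle is continuous in the parameters.\<close>

lemma rot_half_integer:
  assumes "y1 pi * v2 pi \<le> 0"
  shows "\<exists>j::int. rot = of_int j + 1 / 2 \<and> \<bar>angle 1 (2 * pi) - pi * of_int (2 * j + 1)\<bar> < pi"
proof -
  obtain z r where z: "z \<noteq> 0" "r < 0" "flow z (2 * pi) = of_real r * z"
    using negative_eigenvector[OF assms] by blast
  have f: "flow z (2 * pi * real 1) = of_real r * z" using z by simp
  obtain j :: int where j: "angle z (2 * pi) = pi * of_int (2 * j + 1)"
    using rot_eigenvector(3)[OF z(1) _ f z(2)] by auto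
  have "rot = of_int j + 1 / 2"
    using rot_eigenvector(1)[OF z(1) _ f] j by (simp add: add_divide_distrib)
  moreover have "\<bar>angle 1 (2 * pi) - pi * of_int (2 * j + 1)\<bar> < pi"
    using angle_interlace[of 1 z "2 * pi"] z(1) j by simp
  ultimately show ?thesis by blast
qed

text \<open>The Chebyshev formula for powers of a matrix with determinant 1 and trace
  \<open>2 cos \<theta>\<close>, from Cayley-Hamilton; the factor \<open>sin \<theta>\<close> is
  multiplied out to avoid a division.\<close>

lemma flow_power:
  assumes c: "half_trace = cos \<theta>"
  shows "of_real (sin \<theta>) * flow z (2 * pi * real n) =
    of_real (sin (real n * \<theta>)) * flow z (2 * pi) - of_real (sin ((real n - 1) * \<theta>)) * z"
proof (induction n rule: induct_nat_012)
  case (ge2 n)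
  have CH: "flow (flow w (2 * pi)) (2 * pi) = of_real (2 * cos \<theta>) * flow w (2 * pi) - w" for w
  proof -
    define D B E where "D = half_trace" and "B = 2 * y1 pi * v1 pi" and "E = 2 * y2 pi * v2 pi"
    have "D * D - B * E = 1" using det_1[of "2 * pi"] unfolding monodromy D_def B_def E_def .
    then have BE: "B * E = D * D - 1" by simp
    then have BE': "B * (E * x) = (D * D - 1) * x" "E * (B * x) = (D * D - 1) * x" for x
      by (simp_all only: mult.assoc[symmetric] mult.commute[of E B])
    show ?thesis
      unfolding flow_2pi c[symmetric] D_def[symmetric] B_def[symmetric] E_def[symmetric]
      by (simp add: complex_eq_iff distrib_left distrib_right mult.left_commute[of _ B] mult.left_commute[of _ E] BE')
         (simp add: algebra_simps BE')
  qed
  have step: "flow z (2 * pi * real (Suc m)) = flow (flow z (2 * pi * real m)) (2 * pi)" for m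
    using flow_shift_n[of z "2 * pi" m] by (simp add: algebra_simps)
  have rec: "flow z (2 * pi * real (Suc (Suc n))) = of_real (2 * cos \<theta>) * flow z (2 * pi * real (Suc n)) - flow z (2 * pi * real n)"
    unfolding step[of "Suc n"] step[of n] CH ..
  have "of_real (sin \<theta>) * flow z (2 * pi * real (Suc (Suc n))) =
     of_real (2 * cos \<theta>) * (of_real (sin \<theta>) * flow z (2 * pi * real (Suc n))) - of_real (sin \<theta>) * flow z (2 * pi * real n)"
    unfolding rec by (simp only: right_diff_distrib mult.left_commute)
  also have "\<dots> = of_real (2 * cos \<theta> * sin (real (Suc n) * \<theta>) - sin (real n * \<theta>)) * flow z (2 * pi)
      - of_real (2 * cos \<theta> * sin ((real (Suc n) - 1) * \<theta>) - sin ((real n - 1) * \<theta>)) * z"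
    unfolding ge2 by (simp add: algebra_simps)
  also have "2 * cos \<theta> * sin (real (Suc n) * \<theta>) - sin (real n * \<theta>) = sin (real (Suc (Suc n)) * \<theta>)"
    using cos_mult_sin_shift[of \<theta> "real (Suc n)" 0] by (simp add: algebra_simps)
  also have "2 * cos \<theta> * sin ((real (Suc n) - 1) * \<theta>) - sin ((real n - 1) * \<theta>) = sin ((real (Suc (Suc n)) - 1) * \<theta>)"
    using cos_mult_sin_shift[of \<theta> "real n" 0] by (simp add: algebra_simps)
  finally show ?case .
qed simp_all

text \<open>Since \<open>n * \<theta>\<close> is an odd multiple of \<open>pi\<close>, the formula
  for powers collapses to minus the identity, and any vector is an eigenvector with eigenvalue
  -1.\<close>

lemma rot_of_rational_trace:
  assumes c: "half_trace = cos \<theta>" and s: "sin \<theta> \<noteq> 0" and n: "n > 0" and p: "odd p" and \<theta>: "real n * \<theta> = pi * of_int p"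
  shows "\<exists>j::int. rot = of_int (2 * j + 1) / of_int (2 * int n)"
proof -
  have "(real n - 1) * \<theta> = pi * of_int p - \<theta>" using \<theta> by (simp add: algebra_simps)
  moreover have "sin (pi * of_int p - \<theta>) = sin \<theta>" using p by (simp add: sin_diff)
  ultimately have "of_real (sin \<theta>) * flow 1 (2 * pi * real n) = - of_real (sin \<theta>) * 1"
    using flow_power[OF c, of 1 n] \<theta> by simp
  then have "of_real (sin \<theta>) * flow 1 (2 * pi * real n) = of_real (sin \<theta>) * (of_real (- 1) * 1)" by simp
  then have f: "flow 1 (2 * pi * real n) = of_real (- 1) * 1"
    using s by (simp only: mult_left_cancel of_real_eq_0_iff not_False_eq_True)
  obtain j :: int where "angle 1 (2 * pi * real n) = pi * of_int (2 * j + 1)"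
    using rot_eigenvector(3)[OF _ n f] by auto
  then show ?thesis using rot_eigenvector(1)[OF _ n f] n by (intro exI[of _ j]) simp
qed

end

section \<open>Locating the hyperbolic gaps\<close>

lemma half_square_le_cos: "1 - x\<^sup>2 / 2 \<le> cos x" for x :: real
proof -
  have "cos x = cos (x / 2 + x / 2)" by simp
  also have "\<dots> = 1 - 2 * (sin (x / 2))\<^sup>2"
    unfolding cos_add using sin_cos_squared_add[of "x / 2"] by (simp add: power2_eq_square)
  finally have "cos x = 1 - 2 * (sin (x / 2))\<^sup>2" .
  moreover have "(sin (x / 2))\<^sup>2 \<le> (x / 2)\<^sup>2"
    using abs_sin_x_le_abs_x[of "x / 2"] by (simp only: abs_le_square_iff)
  ultimately show ?thesis by (simp add: power_divide)
qed

text \<open>A primitive of \<open>s / (cos\<^sup>2 + s\<^sup>2 sin\<^sup>2)\<close>, the angle obtained by stretching the plane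
  by the factor \<open>s\<close>; it fixes the multiples of \<open>\<pi>/2\<close>.\<close>

definition stretch :: "real \<Rightarrow> real \<Rightarrow> real" where
  "stretch s x = x + arctan ((s - 1) * (sin x * cos x) / ((cos x)\<^sup>2 + s * (sin x)\<^sup>2))"

lemma cos2_stretch_pos: "s > 0 \<Longrightarrow> (cos x)\<^sup>2 + s * (sin x)\<^sup>2 > 0" for s x :: real
  by (metis add_nonneg_pos add_pos_nonneg mult_nonneg_nonneg mult_pos_pos order_le_less sin_zero_norm_cos_one zero_le_power2 zero_less_power2 norm_zero zero_neq_one)

lemma stretch_deriv:
  assumes s: "s > 0"
  shows "(stretch s has_real_derivative s / ((cos x)\<^sup>2 + s\<^sup>2 * (sin x)\<^sup>2)) (at x)"
proof -
  define S C where "S = sin x" and "C = cos x"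
  have SC: "C * C = 1 - S * S" using sin_cos_squared_add[of x] by (simp add: S_def C_def power2_eq_square)
  let ?D = "C\<^sup>2 + s * S\<^sup>2" let ?N = "(s - 1) * (S * C)"
  have D: "?D > 0" using cos2_stretch_pos[OF s, of x] by (simp add: S_def C_def)
  have E: "C\<^sup>2 + s\<^sup>2 * S\<^sup>2 > 0" using cos2_stretch_pos[of "s\<^sup>2" x] s by (simp add: S_def C_def)
  let ?N' = "(s - 1) * (C * C - S * S)" let ?D' = "2 * (s - 1) * (S * C)"
  have "((\<lambda>x. (s - 1) * (sin x * cos x) / ((cos x)\<^sup>2 + s * (sin x)\<^sup>2)) has_real_derivative (?N' * ?D - ?N * ?D') / (?D * ?D)) (at x)"
    using D by (auto intro!: derivative_eq_intros simp: S_def[symmetric] C_def[symmetric] algebra_simps)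
  from DERIV_add[OF DERIV_ident DERIV_chain2[OF DERIV_arctan this]]
  have "(stretch s has_real_derivative 1 + inverse (1 + (?N / ?D)\<^sup>2) * ((?N' * ?D - ?N * ?D') / (?D * ?D))) (at x)"
    by (simp add: stretch_def[abs_def] S_def C_def)
  moreover have "1 + inverse (1 + (?N / ?D)\<^sup>2) * ((?N' * ?D - ?N * ?D') / (?D * ?D)) = s / (C\<^sup>2 + s\<^sup>2 * S\<^sup>2)"
  proof -
    have C4: "C * (C * y) = (1 - S * S) * y" for y using SC by (simp flip: mult.assoc)
    \<comment> \<open>\<open>?D\<close> and \<open>?N\<close> are the real and imaginary parts of
      \<open>(C + \<i> s S) (C - \<i> S)\<close>, whose squared modulus is
      \<open>C^2 + s^2 S^2\<close>; its argument is the stretched angle minus \<open>x\<close>, and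
      \<open>?D > 0\<close> keeps it on the branch of \<open>arctan\<close>.\<close>
    have DN: "?D\<^sup>2 + ?N\<^sup>2 = C\<^sup>2 + s\<^sup>2 * S\<^sup>2"
      by (simp add: power2_eq_square algebra_simps SC C4)
    have num: "?N' * ?D - ?N * ?D' = (s - 1) * (C\<^sup>2 - s * S\<^sup>2)"
      by (simp add: power2_eq_square algebra_simps SC C4)
    have "inverse (1 + (?N / ?D)\<^sup>2) = ?D\<^sup>2 / (?D\<^sup>2 + ?N\<^sup>2)"
    proof -
      have "1 + (?N / ?D)\<^sup>2 = (?D\<^sup>2 + ?N\<^sup>2) / ?D\<^sup>2" using D by (simp add: power_divide add_divide_distrib)
      then show ?thesis by simp
    qed
    then have "1 + inverse (1 + (?N / ?D)\<^sup>2) * ((?N' * ?D - ?N * ?D') / (?D * ?D))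
        = 1 + (s - 1) * (C\<^sup>2 - s * S\<^sup>2) / (C\<^sup>2 + s\<^sup>2 * S\<^sup>2)"
      unfolding DN num using D by (simp add: power2_eq_square)
    also have "\<dots> = ((C\<^sup>2 + s\<^sup>2 * S\<^sup>2) + (s - 1) * (C\<^sup>2 - s * S\<^sup>2)) / (C\<^sup>2 + s\<^sup>2 * S\<^sup>2)"
      using E by (simp add: add_divide_distrib)
    also have "(C\<^sup>2 + s\<^sup>2 * S\<^sup>2) + (s - 1) * (C\<^sup>2 - s * S\<^sup>2) = s"
      by (simp add: power2_eq_square algebra_simps SC C4)
    finally show ?thesis .
  qed
  ultimately show ?thesis by (simp add: S_def C_def)
qed

lemma stretch_strict_mono: "s > 0 \<Longrightarrow> x < y \<Longrightarrow> stretch s x < stretch s y"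
  by (rule DERIV_pos_imp_increasing[of x y]) (use stretch_deriv cos2_stretch_pos[of "s\<^sup>2"] in \<open>auto intro!: exI divide_pos_pos\<close>)

lemma stretch_quadrant: "stretch s (real j * (pi / 2)) = real j * (pi / 2)"
proof -
  have "sin (real j * (pi / 2)) * cos (real j * (pi / 2)) = sin (real j * pi) / 2"
    using sin_double[of "real j * (pi / 2)"] by (simp add: field_simps)
  then show ?thesis by (simp add: stretch_def)
qed

section \<open>Counting quadrants by comparison with constant coefficients\<close>

context hill
begin

text \<open>The Pruefer equation for the phase of a solution.\<close>

lemma logdiff_angle:
  assumes z: "z \<noteq> 0"
  shows "Im (logdiff z t) = (cos (Arg z + angle z t))\<^sup>2 + q t * (sin (Arg z + angle z t))\<^sup>2"
proof -
  define r x where "r = cmod (flow z t)" and "x = Arg z + angle z t"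
  have r: "r \<noteq> 0" using flow_nonzero[OF z, of t] by (simp add: r_def)
  have f: "flow z t = of_real r * cis x" using flow_polar[OF z, of t] by (simp add: r_def x_def)
  have "hill_field (q t) (flow z t) / flow z t = Complex (- q t * sin x) (cos x) * cis (- x)"
  proof -
    have "hill_field (q t) (flow z t) = of_real r * Complex (- q t * sin x) (cos x)"
      unfolding f by (simp add: hill_field_def complex_eq_iff)
    then have "hill_field (q t) (flow z t) / flow z t = Complex (- q t * sin x) (cos x) / cis x"
      unfolding f using r by simp
    then show ?thesis by (simp add: divide_inverse)
  qed
  then show ?thesis
    by (simp add: logdiff_def x_def[symmetric] power2_eq_square algebra_simps)
qed

text \<open>For the constant coefficient \<open>s^2\<close> the stretched phase moves at speed
  exactly \<open>s\<close>; a larger coefficient can only speed it up. As \<open>stretch\<close> is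
  increasing and fixes multiples of \<open>pi / 2\<close>, the number of quadrants passed can be
  read off in the original phase.\<close>

lemma angle_quadrants:
  assumes z: "z \<noteq> 0" and t: "t1 \<le> t2" and s: "s > 0" and q: "\<And>t. t1 \<le> t \<Longrightarrow> t \<le> t2 \<Longrightarrow> s\<^sup>2 \<le> q t"
    and start: "real j * (pi / 2) \<le> Arg z + angle z t1" and len: "real n * (pi / 2) \<le> s * (t2 - t1)"
  shows "real (j + n) * (pi / 2) \<le> Arg z + angle z t2"
proof (rule ccontr)
  assume neg: "\<not> ?thesis"
  let ?\<eta> = "\<lambda>t. Arg z + angle z t"
  let ?h = "\<lambda>x. (cos x)\<^sup>2 + s\<^sup>2 * (sin x)\<^sup>2"
  have d: "((\<lambda>t. stretch s (?\<eta> t) - s * t) has_real_derivative s / ?h (?\<eta> t) * Im (logdiff z t) - s) (at t)" for t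
  proof -
    have "(?\<eta> has_real_derivative Im (logdiff z t)) (at t)"
      using DERIV_add[OF DERIV_const angle_deriv[OF z]] by simp
    from DERIV_chain2[OF stretch_deriv[OF s] this]
    have "((\<lambda>t. stretch s (?\<eta> t)) has_real_derivative s / ?h (?\<eta> t) * Im (logdiff z t)) (at t)" .
    moreover have "((\<lambda>t. s * t) has_real_derivative s) (at t)" by (auto intro!: derivative_eq_intros)
    ultimately show ?thesis by (rule DERIV_diff)
  qed
  have nn: "s / ?h (?\<eta> t) * Im (logdiff z t) - s \<ge> 0" if "t1 \<le> t" "t \<le> t2" for t
  proof -
    have h: "?h (?\<eta> t) > 0" using cos2_stretch_pos[of "s\<^sup>2" "?\<eta> t"] s by simp
    have "?h (?\<eta> t) \<le> Im (logdiff z t)"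
      unfolding logdiff_angle[OF z] using q[OF that] by (simp add: mult_right_mono)
    then have "s / ?h (?\<eta> t) * ?h (?\<eta> t) \<le> s / ?h (?\<eta> t) * Im (logdiff z t)"
      using s h by (intro mult_left_mono) auto
    then show ?thesis using h by simp
  qed
  have "stretch s (?\<eta> t1) - s * t1 \<le> stretch s (?\<eta> t2) - s * t2"
    by (rule DERIV_nonneg_imp_nondecreasing[OF t]) (use d nn in blast)
  moreover have "stretch s (real j * (pi / 2)) \<le> stretch s (?\<eta> t1)"
    using stretch_strict_mono[OF s, of "real j * (pi / 2)" "?\<eta> t1"] start by (metis less_eq_real_def)
  then have "real j * (pi / 2) \<le> stretch s (?\<eta> t1)" by (simp only: stretch_quadrant)
  ultimately have "real (j + n) * (pi / 2) \<le> stretch s (?\<eta> t2)"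
    using len by (simp add: algebra_simps)
  moreover have "stretch s (?\<eta> t2) < stretch s (real (j + n) * (pi / 2))"
    by (rule stretch_strict_mono[OF s]) (use neg in simp)
  ultimately show False by (simp only: stretch_quadrant)
qed

text \<open>If \<open>y1\<close> vanishes at \<open>pi\<close>, the period map sends
  \<open>\<i>\<close> to \<open>- \<i>\<close>, so reflection about \<open>pi\<close> changes the
  sign of \<open>y1\<close> and preserves \<open>v1\<close>. The angular velocity is symmetric about
  \<open>pi\<close>, and both half periods contribute equally.\<close>

lemma angle_double:
  assumes y: "y1 pi = 0"
  shows "angle \<i> (2 * pi) = 2 * angle \<i> pi"
proof -
  have i: "\<i> \<noteq> 0" by simp
  have f: "flow \<i> (2 * pi) = of_real (- 1) * \<i>"
    using y det_1[of pi] by (simp add: flow_2pi complex_eq_iff)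
  have refl: "y1 (2 * pi - t) = - y1 t \<and> v1 (2 * pi - t) = v1 t" for t
  proof -
    have "flow \<i> ((- t) + 2 * pi) = of_real (- 1) * flow \<i> (- t)"
      unfolding flow_shift f by (rule flow_scaleR)
    then have "flow \<i> (2 * pi - t) = - flow \<i> (- t)" by (simp add: algebra_simps)
    then have "y1 (2 * pi - t) = - y1 (- t)" "v1 (2 * pi - t) = - v1 (- t)"
      by (simp_all add: y1_def v1_def)
    then show ?thesis by (simp add: parity)
  qed
  have sym: "Im (logdiff \<i> (2 * pi - t)) = Im (logdiff \<i> t)" for t
  proof -
    have q: "q (2 * pi - t) = q t" using periodic_q[of "- t"] even_q[of t] by (simp add: algebra_simps)
    have "flow \<i> t = Complex (v1 t) (y1 t)" for t by (simp add: y1_def v1_def)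
    then show ?thesis using refl[of t] by (simp add: logdiff_def hill_field_def q Im_divide)
  qed
  have "((\<lambda>t. angle \<i> t + angle \<i> (2 * pi - t)) has_real_derivative 0) (at t)" for t
  proof -
    have "((\<lambda>t. angle \<i> (2 * pi - t)) has_real_derivative Im (logdiff \<i> (2 * pi - t)) * (- 1)) (at t)"
      by (rule DERIV_chain2[OF angle_deriv[OF i]]) (auto intro!: derivative_eq_intros)
    from DERIV_add[OF angle_deriv[OF i] this] show ?thesis by (simp add: sym)
  qed
  then have "angle \<i> 0 + angle \<i> (2 * pi - 0) = angle \<i> pi + angle \<i> (2 * pi - pi)"
    by (rule DERIV_isconst_all[rule_format, of "\<lambda>t. angle \<i> t + angle \<i> (2 * pi - t)"])
  then show ?thesis by simp
qed

end

text \<open>Within distance \<open>1 / 8^i\<close> of \<open>pi\<close> the denominator is at most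
  \<open>1 / 64^i\<close>, so the frequency is at least of order \<open>8^i\<close>, while the shell
  between consecutive scales has length \<open>7/8 * 1/8^i\<close>. Each of the \<open>M\<close>
  shells thus yields one quadrant.\<close>

lemma angle_large:
  assumes e: "0 \<le> e" "e < 1" and E: "1 - e \<le> 1 / (2 * 64 ^ M)"
  shows "real M * (pi / 2) \<le> hill_angle (ecc_q (63 / 10) e) \<i> pi"
proof -
  have e': "\<bar>e\<bar> < 1" using e by simp
  let ?q = "ecc_q (63 / 10) e"
  interpret hill ?q "2 + \<bar>63 / 10\<bar> / (1 - \<bar>e\<bar>)" by (rule hill_ecc_q[OF e'])
  have q1: "?q t \<ge> 1\<^sup>2" for t using one_plus_ecc_cos_pos[OF e', of t] by (simp add: ecc_q_def)
  define t where "t i = pi - 1 / 8 ^ i" for i :: nat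
  have start: "real 1 * (pi / 2) \<le> Arg \<i> + angle \<i> (t 0)"
    using angle_quadrants[of \<i> 0 "t 0" 1 1 0] q1 pi_gt3 by (simp add: t_def)
  have "real (1 + i) * (pi / 2) \<le> Arg \<i> + angle \<i> (t i)" if "i \<le> M" for i
    using that
  proof (induction i)
    case (Suc i)
    \<comment> \<open>The constant \<open>5 / 2\<close> satisfies two demands: its square
      \<open>25 / 4\<close> stays below \<open>63 / 10\<close>, and \<open>5/2 * 7/8 = 35/16\<close>
      exceeds \<open>pi / 2\<close>.\<close>
    define s :: real where "s = 5 / 2 * 8 ^ i"
    have s: "s > 0" by (simp add: s_def)
    have "real (1 + i + 1) * (pi / 2) \<le> Arg \<i> + angle \<i> (t (Suc i))"
    proof (rule angle_quadrants[OF _ _ s])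
      show "t i \<le> t (Suc i)" by (simp add: t_def field_simps)
      show "real (1 + i) * (pi / 2) \<le> Arg \<i> + angle \<i> (t i)" using Suc by simp
      have "s * (t (Suc i) - t i) = 35 / 16" by (simp add: s_def t_def field_simps)
      then show "real 1 * (pi / 2) \<le> s * (t (Suc i) - t i)" using pi_less_4 by simp
      fix x assume x: "t i \<le> x" "x \<le> t (Suc i)"
      define y where "y = pi - x"
      have y: "0 \<le> y" "y \<le> 1 / 8 ^ i" using x by (auto simp: y_def t_def intro: order_trans[OF _ x(2)])
      have "y\<^sup>2 \<le> (1 / 8 ^ i)\<^sup>2" using y by (intro power_mono) auto
      also have "(1 / 8 ^ i)\<^sup>2 = (1 / 64 ^ i :: real)"
        by (simp add: power_divide power_mult[symmetric] mult.commute[of i]) (simp add: power_mult)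
      finally have y2: "y\<^sup>2 \<le> 1 / 64 ^ i" .
      have "cos x = - cos y" by (simp add: y_def cos_diff)
      then have "1 + e * cos x = (1 - e) + e * (1 - cos y)" by (simp add: algebra_simps)
      also have "\<dots> \<le> 1 / (2 * 64 ^ i) + 1 * (y\<^sup>2 / 2)"
      proof (intro add_mono mult_mono)
        have "1 / (2 * 64 ^ M) \<le> 1 / (2 * 64 ^ i :: real)"
          using Suc.prems by (intro divide_left_mono mult_left_mono power_increasing) auto
        then show "1 - e \<le> 1 / (2 * 64 ^ i)" using E by simp
        show "1 - cos y \<le> y\<^sup>2 / 2" using half_square_le_cos[of y] by simp
      qed (use e in auto)
      also have "\<dots> \<le> 1 / 64 ^ i" using y2 by simp
      finally have den: "1 + e * cos x \<le> 1 / 64 ^ i" .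
      have pos: "1 + e * cos x > 0" by (rule one_plus_ecc_cos_pos[OF e'])
      have "63 / 10 * 64 ^ i \<le> 63 / 10 / (1 + e * cos x)"
        using divide_left_mono[OF den, of "63 / 10"] pos by simp
      moreover have "s\<^sup>2 = 25 / 4 * 64 ^ i"
        by (simp add: s_def power_mult_distrib power_divide power_mult[symmetric] mult.commute[of i]) (simp add: power_mult)
      moreover have "(25 / 4 * 64 ^ i :: real) \<le> 63 / 10 * 64 ^ i" by simp
      ultimately show "s\<^sup>2 \<le> ?q x" unfolding ecc_q_def by linarith
    qed auto
    then show ?case by simp
  qed (use start in simp)
  from this[of M] have "real (1 + M) * (pi / 2) \<le> Arg \<i> + angle \<i> (t M)" by simp
  then have "real (1 + M + 0) * (pi / 2) \<le> Arg \<i> + angle \<i> pi"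
    by (intro angle_quadrants[of \<i> "t M" pi 1 "1 + M" 0]) (use q1 in \<open>auto simp: t_def\<close>)
  then show ?thesis by (simp add: algebra_simps)
qed

text \<open>The coefficient is at least \<open>1 + 63 / 11\<close>, which exceeds the square of
  \<open>5 / 2\<close>, so the half period holds five quadrants. This covers
  \<open>m + 1 / 2\<close> for \<open>m\<close> equal to 1 and 2.\<close>

lemma angle_tenth: "5 * (pi / 2) \<le> hill_angle (ecc_q (63 / 10) (1 / 10)) \<i> pi"
proof -
  let ?q = "ecc_q (63 / 10) (1 / 10)"
  interpret hill ?q "2 + \<bar>63 / 10\<bar> / (1 - \<bar>1 / 10\<bar>)" by (rule hill_ecc_q) simp
  have "real (1 + 5) * (pi / 2) \<le> Arg \<i> + angle \<i> pi"
  proof (rule angle_quadrants[of \<i> 0 pi "5 / 2"])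
    fix t :: real
    have "0 < 1 + 1 / 10 * cos t" "1 + 1 / 10 * cos t \<le> 11 / 10"
      using one_plus_ecc_cos_pos[of "1 / 10" t] by simp_all
    then have "63 / 10 / (11 / 10) \<le> 63 / 10 / (1 + 1 / 10 * cos t)" by (intro divide_left_mono) auto
    then show "(5 / 2)\<^sup>2 \<le> ?q t" unfolding ecc_q_def by (simp add: power2_eq_square)
  qed auto
  then show ?thesis by simp
qed

lemma eventually_same_sign:
  fixes f :: "real \<Rightarrow> real"
  assumes "isCont f a" "f a \<noteq> 0" shows "\<forall>\<^sub>F x in at a. 0 < f x * f a"
proof (rule order_tendstoD(1))
  show "((\<lambda>x. f x * f a) \<longlongrightarrow> f a * f a) (at a)"
    using assms(1) unfolding isCont_def by (intro tendsto_mult tendsto_const)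
  show "0 < f a * f a" using assms(2) by (simp add: zero_less_mult_iff) linarith
qed

text \<open>Raising \<open>k\<close> from 0, the even solution acquires phase
  \<open>(m + 1/2) pi\<close> at time \<open>pi\<close>, which means \<open>y1 = 0\<close> there.
  Coexistence being excluded, \<open>v2\<close> is nonzero, so \<open>y1 v2\<close> becomes negative
  on one side of this \<open>k\<close>. The doubled angle with interlacing places the solution
  starting at 1 in the window of \<open>m\<close>.\<close>

lemma gap_exists:
  assumes e: "0 < e" "e < 1" and m: "m \<ge> 1" and A: "(real m + 1 / 2) * pi \<le> hill_angle (ecc_q (63 / 10) e) \<i> pi"
  shows "\<exists>k. 0 < k \<and> k < 64 / 10 \<and> y1pi k e * v2pi k e < 0 \<and>
    2 * real m * pi < hill_angle (ecc_q k e) 1 (2 * pi) \<and> hill_angle (ecc_q k e) 1 (2 * pi) < (2 * real m + 2) * pi"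
proof -
  have e': "\<bar>e\<bar> < 1" using e by simp
  have "hill_angle (ecc_q 0 e) \<i> pi = pi" by (simp add: hill_angle_zero_param e')
  then have "hill_angle (ecc_q 0 e) \<i> pi \<le> (real m + 1 / 2) * pi" using m by simp
  from IVT'[of "\<lambda>k. hill_angle (ecc_q k e) \<i> pi", OF this A]
  obtain k where k: "0 \<le> k" "k \<le> 63 / 10" "hill_angle (ecc_q k e) \<i> pi = (real m + 1 / 2) * pi"
    using continuous_on_hill_angle_ecc1[of \<i> e] e' by auto
  have k0: "k > 0"
  proof (rule ccontr)
    assume "\<not> k > 0"
    then have "k = 0" using k by simp
    then show False using k(3) m by (simp add: hill_angle_zero_param e')
  qed
  interpret hill "ecc_q k e" "2 + \<bar>k\<bar> / (1 - \<bar>e\<bar>)" by (rule hill_ecc_q[OF e'])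
  have "sin (Arg \<i> + angle \<i> pi) = 0"
  proof -
    have "Arg \<i> + angle \<i> pi = real (m + 1) * pi" unfolding k(3) by (simp add: algebra_simps)
    then show ?thesis by (simp only: sin_npi)
  qed
  then have "y1 pi = 0" unfolding y1_def by (subst flow_polar) simp_all
  then have y1: "y1pi k e = 0" by (simp add: hill_pi_eq e')
  have "angle \<i> (2 * pi) = (2 * real m + 1) * pi" using angle_double[OF \<open>y1 pi = 0\<close>] k(3) by (simp add: algebra_simps)
  then have a1: "2 * real m * pi < angle 1 (2 * pi)" "angle 1 (2 * pi) < (2 * real m + 2) * pi"
    using angle_interlace[of 1 \<i> "2 * pi"] by (simp_all add: abs_less_iff algebra_simps)
  have v2: "v2pi k e \<noteq> 0" using ince_no_antiperiodic_coexistence[OF e, of k] y1 by (simp add: hill_pi_eq e')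
  have v1: "v1pi k e \<noteq> 0" using det_pi[OF e', of k] y1 by auto
  obtain d where d: "d > 0" "\<And>k'. \<bar>k' - k\<bar> < d \<Longrightarrow> \<exists>I>0. v1pi k' e * y1pi k e - y1pi k' e * v1pi k e = - (k' - k) * I"
    using sturm_pi[OF e', of k] by blast
  let ?a = "\<lambda>k. hill_angle (ecc_q k e) 1 (2 * pi)"
  have ca: "isCont ?a k" using continuous_on_hill_angle_ecc1[of 1 e UNIV] e' by (simp add: continuous_on_eq_continuous_at)
  have "\<forall>\<^sub>F k' in at k. 2 * real m * pi < ?a k'" "\<forall>\<^sub>F k' in at k. ?a k' < (2 * real m + 2) * pi"
    using ca a1 by (auto simp: isCont_def dest: order_tendstoD)
  moreover have "\<forall>\<^sub>F k' in at k. v2pi k' e * v2pi k e > 0"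
  proof (rule eventually_same_sign[where f="\<lambda>k. v2pi k e", OF _ v2])
    show "isCont (\<lambda>k. v2pi k e) k"
      using continuous_on_pi(4)[of UNIV "\<lambda>k. k" "\<lambda>_. e"] e'
      by (simp add: continuous_on_eq_continuous_at continuous_on_id continuous_on_const)
  qed
  ultimately have "\<forall>\<^sub>F k' in at k. 2 * real m * pi < ?a k' \<and> ?a k' < (2 * real m + 2) * pi \<and> v2pi k' e * v2pi k e > 0"
    by eventually_elim simp
  then obtain d' where d': "d' > 0" "\<And>k'. k' \<noteq> k \<Longrightarrow> \<bar>k' - k\<bar> < d' \<Longrightarrow> 2 * real m * pi < ?a k' \<and> ?a k' < (2 * real m + 2) * pi \<and> v2pi k' e * v2pi k e > 0"
    by (auto simp: eventually_at dist_real_def)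
  \<comment> \<open>Small enough for both local statements, for \<open>k'\<close> to stay positive,
    and for \<open>k'\<close> to exceed \<open>63 / 10\<close> by less than
    \<open>1 / 10\<close>.\<close>
  define h where "h = min (min d d') (min k (1 / 10)) / 2"
  have h: "h > 0" "h < d" "h < d'" "h < k" "h < 1 / 10" using d d' k0 by (auto simp: h_def)
  \<comment> \<open>Near \<open>k\<close> the product \<open>y1 v2\<close> has the sign of
    \<open>k' - k\<close> times the sign of \<open>v1 v2\<close> at \<open>k\<close>; the side is
    chosen to make it negative.\<close>
  define k' where "k' = (if v1pi k e * v2pi k e > 0 then k - h else k + h)"
  have k': "k' \<noteq> k" "\<bar>k' - k\<bar> < d" "\<bar>k' - k\<bar> < d'" "0 < k'" "k' < 64 / 10"
    using h k k0 by (auto simp: k'_def)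
  obtain I where I: "I > 0" "y1pi k' e * v1pi k e = (k' - k) * I" using d(2)[OF k'(2)] y1 by (auto simp: algebra_simps)
  have "(k' - k) * (v1pi k e * v2pi k e) < 0"
  proof (cases "v1pi k e * v2pi k e > 0")
    case True
    then show ?thesis using h by (simp add: k'_def)
  next
    case False
    then have "v1pi k e * v2pi k e < 0" using v1 v2 by (metis linorder_neqE_linordered_idom mult_eq_0_iff)
    then show ?thesis using h by (simp add: k'_def mult_pos_neg)
  qed
  moreover have "0 < I * (v2pi k' e * v2pi k e)" using I(1) d'(2)[OF k'(1,3)] by (simp only: mult_pos_pos)
  ultimately have "(k' - k) * (v1pi k e * v2pi k e) * (I * (v2pi k' e * v2pi k e)) < 0" by (rule mult_neg_pos)
  also have "(k' - k) * (v1pi k e * v2pi k e) * (I * (v2pi k' e * v2pi k e))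
     = (y1pi k' e * v1pi k e) * (v1pi k e * v2pi k e * (v2pi k' e * v2pi k e))" unfolding I(2) by simp
  also have "\<dots> = (y1pi k' e * v2pi k' e) * ((v1pi k e)\<^sup>2 * (v2pi k e)\<^sup>2)" by (simp add: power2_eq_square)
  finally have "y1pi k' e * v2pi k' e < 0"
    using v1 v2 by (simp add: mult_less_0_iff)
  with k' d'(2)[OF k'(1,3)] show ?thesis by blast
qed

lemma gap_exists_all:
  assumes m: "m \<ge> 1"
  shows "\<exists>k e. 0 < e \<and> e < 1 \<and> 0 < k \<and> k < 64 / 10 \<and> y1pi k e * v2pi k e < 0 \<and>
    2 * real m * pi < hill_angle (ecc_q k e) 1 (2 * pi) \<and> hill_angle (ecc_q k e) 1 (2 * pi) < (2 * real m + 2) * pi"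
proof -
  \<comment> \<open>Close enough to 1 for \<open>2 m + 1\<close> quadrants, that is, a phase gain of
    \<open>(m + 1/2) pi\<close>.\<close>
  define e :: real where "e = 1 - 1 / (2 * 64 ^ (2 * m + 1))"
  have "(1::real) \<le> 64 ^ (2 * m + 1)" by (rule one_le_power) simp
  then have e: "0 < e" "e < 1" by (auto simp: e_def field_simps)
  have "real (2 * m + 1) * (pi / 2) \<le> hill_angle (ecc_q (63 / 10) e) \<i> pi"
    by (rule angle_large) (use e in \<open>auto simp: e_def\<close>)
  then have "(real m + 1 / 2) * pi \<le> hill_angle (ecc_q (63 / 10) e) \<i> pi" by (simp add: algebra_simps)
  from gap_exists[OF e m this] e show ?thesis by blast
qed

lemma gap_exists_small:
  assumes m: "m = 1 \<or> m = 2"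
  shows "\<exists>k. 0 < k \<and> k < 64 / 10 \<and> y1pi k (1 / 10) * v2pi k (1 / 10) < 0 \<and>
    2 * real m * pi < hill_angle (ecc_q k (1 / 10)) 1 (2 * pi) \<and> hill_angle (ecc_q k (1 / 10)) 1 (2 * pi) < (2 * real m + 2) * pi"
proof (rule gap_exists)
  have "(real m + 1 / 2) * pi \<le> 5 * (pi / 2)" using m by auto
  then show "(real m + 1 / 2) * pi \<le> hill_angle (ecc_q (63 / 10) (1 / 10)) \<i> pi"
    using angle_tenth by linarith
qed (use m in auto)

section \<open>Density of rotation numbers with odd numerator and even denominator\<close>

lemma trace_not_locally_constant:
  assumes e: "\<bar>e\<bar> < 1" and ell: "0 < y1pi k e * v2pi k e" "v1pi k e * y2pi k e < 0" and \<epsilon>: "\<epsilon> > 0"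
  shows "\<exists>k'. k < k' \<and> k' < k + \<epsilon> \<and> y1pi k' e * v2pi k' e \<noteq> y1pi k e * v2pi k e"
proof -
  let ?a = "\<lambda>k. y1pi k e" and ?b = "\<lambda>k. v1pi k e" and ?c = "\<lambda>k. y2pi k e" and ?d = "\<lambda>k. v2pi k e"
  obtain d where d: "d > 0" "\<And>k'. \<bar>k' - k\<bar> < d \<Longrightarrow>
    (\<exists>I>0. ?b k' * ?a k - ?a k' * ?b k = - (k' - k) * I) \<and> (\<exists>I>0. ?d k' * ?c k - ?c k' * ?d k = - (k' - k) * I)"
    using sturm_pi[OF e, of k] by blast
  have cont: "isCont ?a k" "isCont ?c k"
    using continuous_on_pi[of UNIV "\<lambda>k. k" "\<lambda>_. e"] e
    by (simp_all add: continuous_on_eq_continuous_at continuous_on_id continuous_on_const)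
  have ne: "?a k \<noteq> 0" "?c k \<noteq> 0" "?d k \<noteq> 0" "?b k \<noteq> 0" using ell by auto
  have "\<forall>\<^sub>F k' in at k. 0 < ?a k' * ?a k" "\<forall>\<^sub>F k' in at k. 0 < ?c k' * ?c k"
    by (rule eventually_same_sign[OF cont(1) ne(1)], rule eventually_same_sign[OF cont(2) ne(2)])
  then have "\<forall>\<^sub>F k' in at k. 0 < ?a k' * ?a k \<and> 0 < ?c k' * ?c k" by eventually_elim simp
  then obtain d' where d': "d' > 0" "\<And>k'. k' \<noteq> k \<Longrightarrow> \<bar>k' - k\<bar> < d' \<Longrightarrow> 0 < ?a k' * ?a k \<and> 0 < ?c k' * ?c k"
    by (auto simp: eventually_at dist_real_def)
  define k' where "k' = k + min (min d d') \<epsilon> / 2"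
  have k': "k < k'" "k' < k + \<epsilon>" "\<bar>k' - k\<bar> < d" "\<bar>k' - k\<bar> < d'" using d d' \<epsilon> by (auto simp: k'_def)
  have pos: "0 < ?a k' * ?a k" "0 < ?c k' * ?c k" using d'(2)[of k'] k' by auto
  obtain I J where IJ: "I > 0" "J > 0" "?b k' * ?a k - ?a k' * ?b k = - (k' - k) * I" "?d k' * ?c k - ?c k' * ?d k = - (k' - k) * J"
    using d(2)[OF k'(3)] by blast
  have neg: "- (k' - k) * x < 0" if "x > 0" for x using k' that by (simp add: mult_neg_pos)
  \<comment> \<open>Equal products \<open>a d\<close> force equal products \<open>b c\<close> by the
    determinant. Then both Lagrange expressions become multiples of the same \<open>?w\<close>, with
    factors \<open>b c < 0\<close> and \<open>a d > 0\<close>, although near \<open>k\<close> both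
    must be negative.\<close>
  have "?a k' * ?d k' \<noteq> ?a k * ?d k"
  proof
    assume eq: "?a k' * ?d k' = ?a k * ?d k"
    have eq': "?b k' * ?c k' = ?b k * ?c k" using det_pi[OF e, of k] det_pi[OF e, of k'] eq by simp
    let ?X = "?b k' * ?a k - ?a k' * ?b k" and ?Y = "?d k' * ?c k - ?c k' * ?d k" and ?w = "?a k * ?c k - ?a k' * ?c k'"
    have "?X * (?c k' * ?c k) = (?b k' * ?c k') * (?a k * ?c k) - (?b k * ?c k) * (?a k' * ?c k')" by (simp add: algebra_simps)
    then have X: "?X * (?c k' * ?c k) = (?b k * ?c k) * ?w" unfolding eq' by (simp add: algebra_simps)
    have "?Y * (?a k' * ?a k) = (?a k' * ?d k') * (?a k * ?c k) - (?a k * ?d k) * (?a k' * ?c k')" by (simp add: algebra_simps)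
    then have Y: "?Y * (?a k' * ?a k) = (?a k * ?d k) * ?w" unfolding eq by (simp add: algebra_simps)
    have "?X < 0" "?Y < 0" unfolding IJ(3,4) using neg IJ by auto
    then have "?X * (?c k' * ?c k) < 0" "?Y * (?a k' * ?a k) < 0" using pos by (simp_all only: mult_neg_pos)
    then have "0 < (?X * (?c k' * ?c k)) * (?Y * (?a k' * ?a k))" by (rule mult_neg_neg)
    also have "\<dots> = (?b k * ?c k) * (?a k * ?d k) * (?w * ?w)" unfolding X Y by simp
    also have "\<dots> \<le> 0"
      by (rule mult_nonpos_nonneg[OF less_imp_le[OF mult_neg_pos[OF ell(2) ell(1)]] zero_le_square])
    finally show False by simp
  qed
  with k' show ?thesis by blast
qed

lemma odd_multiple_between:
  assumes "x < (y::real)"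
  shows "\<exists>p::int. \<exists>n::nat. odd p \<and> n > 0 \<and> x < pi * of_int p / real n \<and> pi * of_int p / real n < y"
proof -
  obtain n :: nat where n: "real n > 2 * pi / (y - x)" using reals_Archimedean2 by blast
  have "2 * pi / (y - x) > 0" using assms by simp
  with n have n0: "real n > 0" by linarith
  \<comment> \<open>A gap longer than 2 is needed to be sure of an odd integer.\<close>
  have len: "real n * x / pi + 2 < real n * y / pi"
  proof -
    have "2 * pi < real n * (y - x)" using n assms by (simp add: pos_divide_less_eq)
    then have "(real n * x + 2 * pi) / pi < real n * y / pi" by (intro divide_strict_right_mono) (auto simp: algebra_simps)
    then show ?thesis by (simp add: add_divide_distrib)
  qed
  define m where "m = \<lfloor>real n * x / pi\<rfloor>"
  have m: "of_int m \<le> real n * x / pi" "real n * x / pi < of_int m + 1" unfolding m_def by linarith+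
  define p where "p = (if odd m then m + 2 else m + 1)"
  have p: "odd p" "real n * x / pi < of_int p" "of_int p < real n * y / pi"
    using m len by (auto simp: p_def)
  then have "x < pi * of_int p / real n" "pi * of_int p / real n < y"
    using n0 by (simp_all add: field_simps)
  then show ?thesis using p n0 by (intro exI[of _ p] exI[of _ n]) auto
qed

text \<open>Only \<open>k\<close> is moved, and only to the right. A trace of at most -2 gives a
  half-integer directly. Otherwise the trace stays above -2, and an elliptic parameter exists
  because coexistence points are left at once; there the trace varies, so the angle
  \<open>arccos\<close> of half the trace takes a value \<open>pi * p / n\<close> with
  \<open>p\<close> odd.\<close>

lemma odd_even_rotation_dense:
  assumes e: "0 \<le> e" "e < 1" and k: "k \<ge> 0" and \<epsilon>: "\<epsilon> > 0"
  shows "\<exists>k'. k < k' \<and> k' < k + \<epsilon> \<and>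
    (\<exists>(p::int) (n::int). odd p \<and> n > 0 \<and> hill.rot (ecc_q k' e) = of_int p / of_int (2 * n))"
proof -
  have e': "\<bar>e\<bar> < 1" using e by simp
  let ?f = "\<lambda>k. y1pi k e * v2pi k e" and ?g = "\<lambda>k. v1pi k e * y2pi k e"
  have det: "?f x - ?g x = 1" for x by (rule det_pi[OF e'])
  show ?thesis
  proof (cases "\<exists>k'. k < k' \<and> k' < k + \<epsilon> \<and> ?f k' \<le> 0")
    case True
    then obtain k' where k': "k < k'" "k' < k + \<epsilon>" "?f k' \<le> 0" by blast
    obtain j :: int where "hill.rot (ecc_q k' e) = of_int j + 1 / 2"
      using hill.rot_half_integer[OF hill_ecc_q[OF e'], of k'] k'(3) by (auto simp: hill_pi_eq e')
    then have "hill.rot (ecc_q k' e) = of_int (2 * j + 1) / of_int (2 * 1)" by (simp add: add_divide_distrib)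
    moreover have "odd (2 * j + 1)" "(1::int) > 0" by auto
    ultimately show ?thesis using k' by blast
  next
    case False
    then have pos: "?f x > 0" if "k < x" "x < k + \<epsilon>" for x using that by (meson not_le)
    obtain k1 where k1: "k < k1" "k1 < k + \<epsilon>" "?g k1 < 0"
    proof (cases "?g (k + \<epsilon> / 2) < 0")
      case True
      then show ?thesis using that[of "k + \<epsilon> / 2"] \<epsilon> by simp
    next
      case False
      moreover have "?g (k + \<epsilon> / 2) \<le> 0" by (rule trace_le_2[OF e]) (use k \<epsilon> in simp)
      ultimately have "?g (k + \<epsilon> / 2) = 0" by linarith
      then have "v1pi (k + \<epsilon> / 2) e = 0" "y2pi (k + \<epsilon> / 2) e = 0"
        using coexist_pi[OF e, of "k + \<epsilon> / 2"] k \<epsilon> by linarith+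
      from right_of_coexistence[OF e this]
      obtain d where d: "d > 0" "\<And>k'. k + \<epsilon> / 2 < k' \<Longrightarrow> k' < k + \<epsilon> / 2 + d \<Longrightarrow> ?g k' < 0"
        by blast
      show ?thesis
      proof (rule that[of "k + \<epsilon> / 2 + min d (\<epsilon> / 2) / 2"])
        show "?g (k + \<epsilon> / 2 + min d (\<epsilon> / 2) / 2) < 0" by (rule d(2)) (use d(1) \<epsilon> in auto)
      qed (use d(1) \<epsilon> in auto)
    qed
    obtain k2 where k2: "k1 < k2" "k2 < k + \<epsilon>" "?f k2 \<noteq> ?f k1"
      using trace_not_locally_constant[OF e' pos[OF k1(1,2)] k1(3), of "k + \<epsilon> - k1"] k1 by auto
    let ?h = "\<lambda>x. arccos (2 * ?f x - 1)"
    have rng: "-1 < 2 * ?f x - 1" "2 * ?f x - 1 \<le> 1" if "x \<in> {k1..k2}" for x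
    proof -
      show "-1 < 2 * ?f x - 1" using pos[of x] that k1 k2 by auto
      show "2 * ?f x - 1 \<le> 1" using trace_le_2[OF e, of x] det[of x] that k1 k by auto
    qed
    have ch: "continuous_on {k1..k2} ?h"
      using rng e' by (intro continuous_on_arccos continuous_intros) (auto intro: less_imp_le)
    have ne: "?h k1 \<noteq> ?h k2"
    proof
      assume "?h k1 = ?h k2"
      then have "cos (?h k1) = cos (?h k2)" by simp
      then have "2 * ?f k1 - 1 = 2 * ?f k2 - 1" using rng[of k1] rng[of k2] k2 by (simp add: cos_arccos)
      then show False using k2 by simp
    qed
    let ?lo = "min (?h k1) (?h k2)" and ?hi = "max (?h k1) (?h k2)"
    have "?lo < ?hi" using ne by linarith
    from odd_multiple_between[OF this]
    obtain p :: int and n :: nat where pn: "odd p" "n > 0" "?lo < pi * of_int p / real n" "pi * of_int p / real n < ?hi"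
      by blast
    let ?\<theta> = "pi * of_int p / real n"
    have "connected (?h ` {k1..k2})" by (rule connected_continuous_image[OF ch]) auto
    moreover have "?lo \<in> ?h ` {k1..k2}" "?hi \<in> ?h ` {k1..k2}" using k2 by (auto simp: min_def max_def)
    ultimately have "?\<theta> \<in> ?h ` {k1..k2}"
      by (rule connectedD_interval) (use pn in \<open>auto intro: less_imp_le\<close>)
    then obtain k' where k': "k' \<in> {k1..k2}" "?h k' = ?\<theta>" by auto
    have \<theta>: "0 < ?\<theta>" "?\<theta> < pi"
    proof -
      have b: "0 \<le> ?h x" "?h x \<le> pi" if "x \<in> {k1..k2}" for x
        using arccos_lbound[of "2 * ?f x - 1"] arccos_ubound[of "2 * ?f x - 1"] rng[OF that] by linarith+
      have "0 \<le> ?lo" using b[of k1] b[of k2] k2 by simp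
      then show "0 < ?\<theta>" using pn by linarith
      have "?hi \<le> pi" using b[of k1] b[of k2] k2 by simp
      then show "?\<theta> < pi" using pn by linarith
    qed
    have "cos ?\<theta> = 2 * ?f k' - 1" using rng[OF k'(1)] by (simp add: k'(2)[symmetric] cos_arccos)
    then have c: "?f k' + ?g k' = cos ?\<theta>" using det[of k'] by linarith
    interpret hill "ecc_q k' e" "2 + \<bar>k'\<bar> / (1 - \<bar>e\<bar>)" by (rule hill_ecc_q[OF e'])
    have "half_trace = cos ?\<theta>" using c by (simp add: hill_pi_eq e')
    moreover have "sin ?\<theta> \<noteq> 0" using sin_gt_zero[OF \<theta>] by simp
    moreover have "real n * ?\<theta> = pi * of_int p" using pn by simp
    ultimately obtain j :: int where "rot = of_int (2 * j + 1) / of_int (2 * int n)"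
      using rot_of_rational_trace pn by blast
    moreover have "odd (2 * j + 1)" "int n > 0" using pn by auto
    ultimately have "\<exists>(p::int) (n::int). odd p \<and> n > 0 \<and> rot = of_int p / of_int (2 * n)" by blast
    moreover have "k < k'" "k' < k + \<epsilon>" using k' k1 k2 by auto
    ultimately show ?thesis by blast
  qed
qed

section \<open>The Hamiltonian vector field near the Euler orbit\<close>

text \<open>\<open>grav_r\<close> and \<open>grav_z\<close> are the partial derivatives of
  \<open>potential\<close>; the power \<open>3 / 2\<close> is written as a product with a square
  root.\<close>

definition grav_r :: "real \<Rightarrow> real \<Rightarrow> real \<Rightarrow> real \<Rightarrow> real" where
  "grav_r \<alpha> w r z = - (w\<^sup>2 / r ^ 3) + 1 / r\<^sup>2 + 4 / \<alpha> * (r / ((r\<^sup>2 + (1 + 2 * \<alpha>) * z\<^sup>2) * sqrt (r\<^sup>2 + (1 + 2 * \<alpha>) * z\<^sup>2)))"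

definition grav_z :: "real \<Rightarrow> real \<Rightarrow> real \<Rightarrow> real" where
  "grav_z \<alpha> r z = 4 / \<alpha> * ((1 + 2 * \<alpha>) * (z / ((r\<^sup>2 + (1 + 2 * \<alpha>) * z\<^sup>2) * sqrt (r\<^sup>2 + (1 + 2 * \<alpha>) * z\<^sup>2))))"

lemma quadratic_pos: "\<alpha> > 0 \<Longrightarrow> r > 0 \<Longrightarrow> r\<^sup>2 + (1 + 2 * \<alpha>) * z\<^sup>2 > 0" for \<alpha> r z :: real
  by (intro add_pos_nonneg) auto

lemma inverse_sqrt_deriv:
  assumes "x > (0::real)"
  shows "((\<lambda>x. 1 / sqrt x) has_real_derivative - (1 / 2) * (1 / (x * sqrt x))) (at x)"
proof -
  have "sqrt x * sqrt x = x" using assms by simp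
  then show ?thesis using assms by (auto intro!: derivative_eq_intros simp: field_simps)
qed

lemma inverse_sqrt3_deriv:
  assumes "x > (0::real)"
  shows "((\<lambda>x. 1 / (x * sqrt x)) has_real_derivative - (3 / 2) * (1 / (x\<^sup>2 * sqrt x))) (at x)"
proof -
  have s: "sqrt x * sqrt x = x" using assms by simp
  have "((\<lambda>x. 1 / (x * sqrt x)) has_real_derivative - (sqrt x + x * (inverse (sqrt x) / 2)) / (x * sqrt x)\<^sup>2) (at x)"
    using assms by (auto intro!: derivative_eq_intros simp: power2_eq_square)
  moreover have "x * (inverse (sqrt x) / 2) = sqrt x / 2"
    using assms s by (simp add: field_simps)
  moreover have "- (sqrt x + sqrt x / 2) / (x * sqrt x)\<^sup>2 = - (3 / 2) * (1 / (x\<^sup>2 * sqrt x))"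
    using assms s by (simp add: field_simps power2_eq_square)
  ultimately show ?thesis by simp
qed

text \<open>Stated for compositions, so that one computation yields both the derivative of the
  Hamiltonian and the one-variable derivatives \<open>dV_dr\<close> and
  \<open>dV_dz\<close>.\<close>

lemma potential_has_derivative:
  assumes \<alpha>: "\<alpha> > 0" and r: "r > 0"
    and f: "(f has_derivative f') (at x)" "f x = r" and g: "(g has_derivative g') (at x)" "g x = z"
  shows "((\<lambda>x. potential \<alpha> w (f x) (g x)) has_derivative (\<lambda>h. grav_r \<alpha> w r z * f' h + grav_z \<alpha> r z * g' h)) (at x)"
proof -
  define G where "G = r\<^sup>2 + (1 + 2 * \<alpha>) * z\<^sup>2"
  have G: "G > 0" unfolding G_def by (rule quadratic_pos[OF \<alpha> r])
  have gr: "grav_r \<alpha> w r z = - (w\<^sup>2 / r ^ 3) + 1 / r\<^sup>2 + 4 / \<alpha> * (r * (1 / (G * sqrt G)))"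
    "grav_z \<alpha> r z = 4 / \<alpha> * ((1 + 2 * \<alpha>) * (z * (1 / (G * sqrt G))))"
    by (simp_all add: grav_r_def grav_z_def G_def)
  have d1: "((\<lambda>r. 1 / r\<^sup>2) has_real_derivative - (2 / r ^ 3)) (at r)"
    using r by (auto intro!: derivative_eq_intros simp: field_simps power2_eq_square power3_eq_cube)
  have d2: "((\<lambda>r. 1 / r) has_real_derivative - (1 / r\<^sup>2)) (at r)"
    using r by (auto intro!: derivative_eq_intros simp: field_simps power2_eq_square)
  have g': "((\<lambda>x. (f x)\<^sup>2 + (1 + 2 * \<alpha>) * (g x)\<^sup>2) has_derivative (\<lambda>h. 2 * r * f' h + (1 + 2 * \<alpha>) * (2 * z * g' h))) (at x)"
    using f g by (auto intro!: derivative_eq_intros simp: fun_eq_iff algebra_simps)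
  have c1: "((\<lambda>x. 1 / (f x)\<^sup>2) has_derivative (\<lambda>h. f' h * - (2 / r ^ 3))) (at x)"
    by (rule DERIV_compose_FDERIV[OF _ f(1), of "\<lambda>r. 1 / r\<^sup>2"]) (use d1 f(2) in simp)
  have c2: "((\<lambda>x. 1 / f x) has_derivative (\<lambda>h. f' h * - (1 / r\<^sup>2))) (at x)"
    by (rule DERIV_compose_FDERIV[OF _ f(1), of "\<lambda>r. 1 / r"]) (use d2 f(2) in simp)
  have c3: "((\<lambda>x. 1 / sqrt ((f x)\<^sup>2 + (1 + 2 * \<alpha>) * (g x)\<^sup>2)) has_derivative
      (\<lambda>h. (2 * r * f' h + (1 + 2 * \<alpha>) * (2 * z * g' h)) * (- (1 / 2) * (1 / (G * sqrt G))))) (at x)"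
    by (rule DERIV_compose_FDERIV[OF _ g', of "\<lambda>x. 1 / sqrt x"])
       (use inverse_sqrt_deriv[OF G] f(2) g(2) in \<open>simp add: G_def\<close>)
  have "((\<lambda>x. w\<^sup>2 / 2 * (1 / (f x)\<^sup>2) - 1 / f x - 4 / \<alpha> * (1 / sqrt ((f x)\<^sup>2 + (1 + 2 * \<alpha>) * (g x)\<^sup>2))) has_derivative
     (\<lambda>h. w\<^sup>2 / 2 * (f' h * - (2 / r ^ 3)) - f' h * - (1 / r\<^sup>2) -
        4 / \<alpha> * ((2 * r * f' h + (1 + 2 * \<alpha>) * (2 * z * g' h)) * (- (1 / 2) * (1 / (G * sqrt G)))))) (at x)"
    by (intro has_derivative_diff has_derivative_mult_right c1 c2 c3)
  then have "((\<lambda>x. potential \<alpha> w (f x) (g x)) has_derivative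
     (\<lambda>h. w\<^sup>2 / 2 * (f' h * - (2 / r ^ 3)) - f' h * - (1 / r\<^sup>2) -
        4 / \<alpha> * ((2 * r * f' h + (1 + 2 * \<alpha>) * (2 * z * g' h)) * (- (1 / 2) * (1 / (G * sqrt G)))))) (at x)"
    by (simp add: potential_def)
  then show ?thesis
    by (rule has_derivative_eq_rhs) (unfold gr, auto simp: fun_eq_iff algebra_simps)
qed

lemma has_derivative_phase_proj:
  "(fst has_derivative fst) F" "((\<lambda>x. fst (snd x)) has_derivative (\<lambda>x. fst (snd x))) F"
  "((\<lambda>x. fst (snd (snd x))) has_derivative (\<lambda>x. fst (snd (snd x)))) F"
  "((\<lambda>x. snd (snd (snd x))) has_derivative (\<lambda>x. snd (snd (snd x)))) F"
  by (auto intro!: derivative_eq_intros)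

lemma X_H_eq:
  assumes \<alpha>: "\<alpha> > 0" and r: "r > 0"
  shows "X_H \<alpha> w (pr, pz, r, z) = (- grav_r \<alpha> w r z, - grav_z \<alpha> r z, pr, pz)"
proof -
  let ?x = "(pr, pz, r, z)"
  have "((\<lambda>x. ((fst x)\<^sup>2 + (fst (snd x))\<^sup>2) / 2 + potential \<alpha> w (fst (snd (snd x))) (snd (snd (snd x)))) has_derivative
     (\<lambda>h. pr * fst h + pz * fst (snd h) + (grav_r \<alpha> w r z * fst (snd (snd h)) + grav_z \<alpha> r z * snd (snd (snd h))))) (at ?x)"
    by (rule has_derivative_add[OF _ potential_has_derivative[OF \<alpha> r]])
       (auto intro!: derivative_eq_intros has_derivative_phase_proj simp: fun_eq_iff)
  then have d: "frechet_derivative (hamiltonian \<alpha> w) (at ?x) =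
     (\<lambda>h. pr * fst h + pz * fst (snd h) + (grav_r \<alpha> w r z * fst (snd (snd h)) + grav_z \<alpha> r z * snd (snd (snd h))))"
    by (intro frechet_derivative_at[symmetric]) (simp add: hamiltonian_def[abs_def] case_prod_unfold)
  show ?thesis
    unfolding ham_field_def d
  proof (rule the_equality)
    show "\<forall>Y. omega0 (- grav_r \<alpha> w r z, - grav_z \<alpha> r z, pr, pz) Y =
      - (pr * fst Y + pz * fst (snd Y) + (grav_r \<alpha> w r z * fst (snd (snd Y)) + grav_z \<alpha> r z * snd (snd (snd Y))))"
      by (auto simp: omega0_def)
    fix X assume "\<forall>Y. omega0 X Y = - (pr * fst Y + pz * fst (snd Y) + (grav_r \<alpha> w r z * fst (snd (snd Y)) + grav_z \<alpha> r z * snd (snd (snd Y))))"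
    then have X: "omega0 X Y = - (pr * fst Y + pz * fst (snd Y) + (grav_r \<alpha> w r z * fst (snd (snd Y)) + grav_z \<alpha> r z * snd (snd (snd Y))))" for Y
      by blast
    \<comment> \<open>Nondegeneracy of \<open>omega0\<close>: pairing with the four basis vectors
      determines the field.\<close>
    obtain a b c d where "X = (a, b, c, d)" by (metis prod.collapse)
    then show "X = (- grav_r \<alpha> w r z, - grav_z \<alpha> r z, pr, pz)"
      using X[of "(1, 0, 0, 0)"] X[of "(0, 1, 0, 0)"] X[of "(0, 0, 1, 0)"] X[of "(0, 0, 0, 1)"]
      by (simp add: omega0_def)
  qed
qed

lemma grav_planar:
  assumes "r > 0"
  shows "grav_r \<alpha> w r 0 = - (w\<^sup>2 / r ^ 3) + (1 + 4 / \<alpha>) / r\<^sup>2" "grav_z \<alpha> r 0 = 0"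
  using assms by (simp_all add: grav_r_def grav_z_def power2_eq_square power3_eq_cube add_divide_distrib)

lemma dV_planar:
  assumes \<alpha>: "\<alpha> > 0" and r: "r > 0"
  shows "dV_dr \<alpha> w r 0 = - (w\<^sup>2 / r ^ 3) + (1 + 4 / \<alpha>) / r\<^sup>2" "dV_dz \<alpha> w r 0 = 0"
proof -
  have "((\<lambda>s. potential \<alpha> w s 0) has_derivative (\<lambda>h. grav_r \<alpha> w r 0 * h + grav_z \<alpha> r 0 * 0)) (at r)"
    by (rule potential_has_derivative[OF \<alpha> r]) (auto intro!: derivative_eq_intros)
  then have "((\<lambda>s. potential \<alpha> w s 0) has_real_derivative grav_r \<alpha> w r 0) (at r)"
    by (simp add: has_field_derivative_def)
  from DERIV_imp_deriv[OF this] show "dV_dr \<alpha> w r 0 = - (w\<^sup>2 / r ^ 3) + (1 + 4 / \<alpha>) / r\<^sup>2"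
    by (simp add: dV_dr_def grav_planar(1)[OF r])
  have "((\<lambda>s. potential \<alpha> w r s) has_derivative (\<lambda>h. grav_r \<alpha> w r 0 * 0 + grav_z \<alpha> r 0 * h)) (at 0)"
    by (rule potential_has_derivative[OF \<alpha> r]) (auto intro!: derivative_eq_intros)
  then have "((\<lambda>s. potential \<alpha> w r s) has_real_derivative grav_z \<alpha> r 0) (at 0)"
    by (simp add: has_field_derivative_def)
  from DERIV_imp_deriv[OF this] show "dV_dz \<alpha> w r 0 = 0"
    by (simp add: dV_dz_def grav_planar(2)[OF r])
qed

text \<open>At \<open>z = 0\<close> the linearization splits into an \<open>(p_r, r)\<close> and a
  \<open>(p_z, z)\<close> block. Transversally only the second matters, so the entry
  \<open>m\<close> of the first is left unspecified.\<close>

lemma X_H_derivative_planar: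
  assumes \<alpha>: "\<alpha> > 0" and r: "r > 0"
  shows "\<exists>m. frechet_derivative (X_H \<alpha> w) (at (pr, 0, r, 0)) =
    (\<lambda>(a, b, c, d). (m * c, - (4 / \<alpha> * (1 + 2 * \<alpha>) / r ^ 3) * d, a, b))"
proof -
  let ?x = "(pr, 0, r, 0) :: phase"
  let ?r = "\<lambda>x::phase. fst (snd (snd x))" and ?z = "\<lambda>x::phase. snd (snd (snd x))"
  let ?G = "\<lambda>x. (?r x)\<^sup>2 + (1 + 2 * \<alpha>) * (?z x)\<^sup>2"
  let ?q = "\<lambda>x. 1 / (?G x * sqrt (?G x))"
  have G: "(?G has_derivative (\<lambda>h. 2 * r * ?r h)) (at ?x)"
    by (auto intro!: derivative_eq_intros has_derivative_phase_proj simp: fun_eq_iff)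
  have r2: "r\<^sup>2 > 0" using r by simp
  define m1 where "m1 = 2 * r * (- (3 / 2) * (1 / ((r\<^sup>2)\<^sup>2 * sqrt (r\<^sup>2))))"
  have q: "(?q has_derivative (\<lambda>h. ?r h * m1)) (at ?x)"
  proof -
    have "(?q has_derivative (\<lambda>h. 2 * r * ?r h * (- (3 / 2) * (1 / ((r\<^sup>2)\<^sup>2 * sqrt (r\<^sup>2)))))) (at ?x)"
      by (rule DERIV_compose_FDERIV[OF _ G, of "\<lambda>x. 1 / (x * sqrt x)"]) (use inverse_sqrt3_deriv[OF r2] in simp)
    then show ?thesis unfolding m1_def by (simp only: ac_simps)
  qed
  have qx: "?q ?x = 1 / r ^ 3" using r by (simp add: power2_eq_square power3_eq_cube)
  define m2 where "m2 = (r * m1 + 1 / r ^ 3) * (4 / \<alpha>)"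
  have t1: "((\<lambda>x. 4 / \<alpha> * (?r x * ?q x)) has_derivative (\<lambda>h. m2 * ?r h)) (at ?x)"
  proof -
    have "((\<lambda>x. 4 / \<alpha> * (?r x * ?q x)) has_derivative (\<lambda>h. 4 / \<alpha> * (?r ?x * (?r h * m1) + ?r h * ?q ?x))) (at ?x)"
      by (intro has_derivative_mult_right has_derivative_mult has_derivative_phase_proj q)
    then show ?thesis by (rule has_derivative_eq_rhs) (unfold qx, simp add: fun_eq_iff m2_def algebra_simps)
  qed
  have t2: "((\<lambda>x. 4 / \<alpha> * ((1 + 2 * \<alpha>) * (?z x * ?q x))) has_derivative (\<lambda>h. 4 / \<alpha> * (1 + 2 * \<alpha>) / r ^ 3 * ?z h)) (at ?x)"
  proof -
    have "((\<lambda>x. 4 / \<alpha> * ((1 + 2 * \<alpha>) * (?z x * ?q x))) has_derivative (\<lambda>h. 4 / \<alpha> * ((1 + 2 * \<alpha>) * (?z ?x * (?r h * m1) + ?z h * ?q ?x)))) (at ?x)"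
      by (intro has_derivative_mult_right has_derivative_mult has_derivative_phase_proj q)
    then show ?thesis by (rule has_derivative_eq_rhs) (unfold qx, simp add: fun_eq_iff algebra_simps)
  qed
  obtain m3 where m3: "((\<lambda>r. - (w\<^sup>2 / r ^ 3) + 1 / r\<^sup>2) has_real_derivative m3) (at r)"
  proof -
    have "((\<lambda>r. - (w\<^sup>2 / r ^ 3) + 1 / r\<^sup>2) has_real_derivative 3 * w\<^sup>2 / r ^ 4 - 2 / r ^ 3) (at r)"
      using r by (auto intro!: derivative_eq_intros simp: field_simps power2_eq_square power3_eq_cube power4_eq_xxxx)
    then show ?thesis by (rule that)
  qed
  have t3: "((\<lambda>x. - (w\<^sup>2 / ?r x ^ 3) + 1 / (?r x)\<^sup>2) has_derivative (\<lambda>h. ?r h * m3)) (at ?x)"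
    using DERIV_compose_FDERIV[OF _ has_derivative_phase_proj(3), of "\<lambda>r. - (w\<^sup>2 / r ^ 3) + 1 / r\<^sup>2" m3 ?x] m3 by simp
  let ?F = "\<lambda>x. (- ((- (w\<^sup>2 / ?r x ^ 3) + 1 / (?r x)\<^sup>2) + 4 / \<alpha> * (?r x * ?q x)), - (4 / \<alpha> * ((1 + 2 * \<alpha>) * (?z x * ?q x))), fst x, fst (snd x))"
  let ?D = "\<lambda>h::phase. (- (?r h * m3 + m2 * ?r h), - (4 / \<alpha> * (1 + 2 * \<alpha>) / r ^ 3 * ?z h), fst h, fst (snd h))"
  have "(?F has_derivative ?D) (at ?x)"
    by (intro has_derivative_Pair has_derivative_minus has_derivative_add t1 t2 t3 has_derivative_phase_proj)
  moreover have op: "open {x::phase. ?r x > 0}"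
    by (intro open_Collect_less continuous_intros)
  ultimately have "(X_H \<alpha> w has_derivative ?D) (at ?x)"
  proof (rule has_derivative_transform_within_open)
    fix x :: phase assume "x \<in> {x. ?r x > 0}"
    then obtain a b c d where "x = (a, b, c, d)" "c > 0" by (cases x) auto
    then show "?F x = X_H \<alpha> w x" by (simp add: X_H_eq \<alpha> grav_r_def grav_z_def)
  qed (use r in auto)
  then have "frechet_derivative (X_H \<alpha> w) (at ?x) = ?D" by (rule frechet_derivative_at[symmetric])
  then show ?thesis by (intro exI[of _ "- (m3 + m2)"]) (auto simp: fun_eq_iff algebra_simps)
qed

section \<open>Rotation rates and hyperbolic matrices\<close>

lemma continuous_argument_unique:
  assumes "continuous_argument f \<eta>" "continuous_argument f \<mu>"
  shows "\<exists>c. \<forall>t\<ge>0. \<eta> t - \<mu> t = c"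
proof -
  have "(\<lambda>t. \<eta> t - \<mu> t) constant_on {0::real..}"
  proof (rule continuous_discrete_range_constant)
    show "continuous_on {0..} (\<lambda>t. \<eta> t - \<mu> t)"
      using assms by (auto simp: continuous_argument_def intro!: continuous_intros)
    fix t :: real assume t: "t \<in> {0..}"
    have int: "\<exists>n::int. \<eta> s - \<mu> s = 2 * pi * of_int n" if "s \<ge> 0" for s
    proof -
      have "of_real (cmod (f s)) * cis (\<eta> s) = of_real (cmod (f s)) * cis (\<mu> s)" "f s \<noteq> 0"
        using assms that by (auto simp: continuous_argument_def)
      then have "cis (\<eta> s) = cis (\<mu> s)" by simp
      then have "sin (\<eta> s) = sin (\<mu> s)" "cos (\<eta> s) = cos (\<mu> s)" by (simp_all add: complex_eq_iff)
      then obtain n :: int where "\<eta> s = \<mu> s + 2 * pi * of_int n" using sin_cos_eq_iff by (metis mult.commute)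
      then show ?thesis by (intro exI[of _ n]) simp
    qed
    show "\<exists>e>0. \<forall>s. s \<in> {0..} \<and> \<eta> s - \<mu> s \<noteq> \<eta> t - \<mu> t \<longrightarrow> e \<le> norm (\<eta> s - \<mu> s - (\<eta> t - \<mu> t))"
    proof (intro exI[of _ "2 * pi"] conjI allI impI)
      fix s assume s: "s \<in> {0..} \<and> \<eta> s - \<mu> s \<noteq> \<eta> t - \<mu> t"
      obtain m n :: int where mn: "\<eta> s - \<mu> s = 2 * pi * of_int m" "\<eta> t - \<mu> t = 2 * pi * of_int n"
        using int[of s] int[of t] s t by auto
      then have "m \<noteq> n" using s by auto
      then have "1 \<le> \<bar>of_int (m - n) :: real\<bar>" by linarith
      then have "2 * pi * 1 \<le> 2 * pi * \<bar>of_int (m - n)\<bar>" by (intro mult_left_mono) auto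
      then show "2 * pi \<le> norm (\<eta> s - \<mu> s - (\<eta> t - \<mu> t))"
        unfolding mn by (simp add: abs_mult right_diff_distrib[symmetric])
    qed simp
  qed auto
  then show ?thesis by (auto simp: constant_on_def)
qed

text \<open>This makes the definite descriptions in the two rotation numbers meaningful: two
  continuous arguments differ by a constant, which disappears after division by
  \<open>t\<close>.\<close>

lemma rotation_rate_unique:
  assumes "has_rotation_rate \<Psi> c" "has_rotation_rate \<Psi> d"
  shows "c = d"
proof -
  let ?v = "axis 1 1 :: real ^ 2"
  have v: "?v \<noteq> 0" by (simp add: axis_eq_0_iff)
  obtain \<eta> where e: "continuous_argument (\<lambda>t. vec_complex (\<Psi> t *v ?v)) \<eta>" "((\<lambda>t. \<eta> t / t) \<longlongrightarrow> c) at_top"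
    using assms(1)[unfolded has_rotation_rate_def, rule_format, OF v] by blast
  obtain \<mu> where m: "continuous_argument (\<lambda>t. vec_complex (\<Psi> t *v ?v)) \<mu>" "((\<lambda>t. \<mu> t / t) \<longlongrightarrow> d) at_top"
    using assms(2)[unfolded has_rotation_rate_def, rule_format, OF v] by blast
  obtain k where k: "\<forall>t\<ge>0. \<eta> t - \<mu> t = k" using continuous_argument_unique[OF e(1) m(1)] by blast
  have "((\<lambda>t. \<eta> t / t - \<mu> t / t) \<longlongrightarrow> c - d) at_top" by (intro tendsto_diff e m)
  moreover have "\<forall>\<^sub>F t in at_top. \<eta> t / t - \<mu> t / t = k / t"
    using eventually_ge_at_top[of 0] by eventually_elim (use k in \<open>simp add: diff_divide_distrib[symmetric]\<close>)
  ultimately have "((\<lambda>t. k / t) \<longlongrightarrow> c - d) at_top" by (rule Lim_transform_eventually)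
  moreover have "((\<lambda>t::real. k / t) \<longlongrightarrow> 0) at_top"
    by (rule tendsto_divide_0[OF tendsto_const filterlim_at_top_imp_at_infinity[OF filterlim_ident]])
  ultimately have "c - d = 0" using tendsto_unique[OF trivial_limit_at_top_linorder] by blast
  then show ?thesis by simp
qed

definition cvec :: "complex \<Rightarrow> real ^ 2" where "cvec z = vector [Re z, Im z]"

lemma cvec_nth [simp]: "cvec z $ 1 = Re z" "cvec z $ 2 = Im z" by (simp_all add: cvec_def)
lemma vec_complex_cvec [simp]: "vec_complex (cvec z) = z" by (simp add: vec_complex_def)
lemma cvec_vec_complex [simp]: "cvec (vec_complex v) = v" by (simp add: vec_complex_def vec_eq_iff forall_2)
lemma vec_complex_eq_0 [simp]: "vec_complex v = 0 \<longleftrightarrow> v = 0"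
  by (auto simp: vec_complex_def complex_eq_iff vec_eq_iff forall_2)
lemma vec_complex_inject: "vec_complex v = vec_complex u \<longleftrightarrow> v = u"
  by (metis cvec_vec_complex)
lemma Re_vec_complex [simp]: "Re (vec_complex v) = v $ 1" and Im_vec_complex [simp]: "Im (vec_complex v) = v $ 2"
  by (simp_all add: vec_complex_def)

definition cmat :: "(complex \<Rightarrow> complex) \<Rightarrow> real ^ 2 ^ 2" where
  "cmat f = vector [vector [Re (f 1), Re (f \<i>)], vector [Im (f 1), Im (f \<i>)]]"

lemma cmat_works:
  assumes "\<And>z. f z = of_real (Re z) * f 1 + of_real (Im z) * f \<i>"
  shows "vec_complex (cmat f *v v) = f (vec_complex v)"
  by (subst assms) (simp add: complex_eq_iff cmat_def matrix_vector_mult_def sum_2)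

text \<open>When the characteristic polynomial vanishes, a nonzero column of the adjugate of
  \<open>A - \<mu>\<close> is an eigenvector; if both columns vanish, so does
  \<open>A - \<mu>\<close> and any vector will do.\<close>

lemma complex_eigenvalue_iff:
  fixes A :: "real ^ 2 ^ 2"
  shows "complex_eigenvalue A \<mu> \<longleftrightarrow> \<mu>\<^sup>2 - of_real (trace A) * \<mu> + of_real (det A) = 0"
proof -
  let ?a = "of_real (A $ 1 $ 1) :: complex" and ?b = "of_real (A $ 1 $ 2) :: complex"
    and ?c = "of_real (A $ 2 $ 1) :: complex" and ?d = "of_real (A $ 2 $ 2) :: complex"
  have char: "\<mu>\<^sup>2 - of_real (trace A) * \<mu> + of_real (det A) = (?a - \<mu>) * (?d - \<mu>) - ?b * ?c"
    by (simp add: trace_def sum_2 det_2 power2_eq_square algebra_simps)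
  have eq: "(map_matrix complex_of_real A *v u = \<mu> *s u) \<longleftrightarrow>
      (?a - \<mu>) * (u $ 1) + ?b * (u $ 2) = 0 \<and> ?c * (u $ 1) + (?d - \<mu>) * (u $ 2) = 0" for u
    by (simp add: vec_eq_iff forall_2 matrix_vector_mult_def sum_2 map_matrix_def algebra_simps)
  show ?thesis
  proof
    assume "complex_eigenvalue A \<mu>"
    then obtain u where u0: "u \<noteq> 0" "map_matrix complex_of_real A *v u = \<mu> *s u"
      unfolding complex_eigenvalue_def by (elim exE conjE)
    note u = u0(1) conjunct1[OF u0(2)[unfolded eq]] conjunct2[OF u0(2)[unfolded eq]]
    let ?D = "(?a - \<mu>) * (?d - \<mu>) - ?b * ?c"
    have "?D * (u $ 1) = (?d - \<mu>) * ((?a - \<mu>) * (u $ 1) + ?b * (u $ 2)) - ?b * (?c * (u $ 1) + (?d - \<mu>) * (u $ 2))"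
      "?D * (u $ 2) = (?a - \<mu>) * (?c * (u $ 1) + (?d - \<mu>) * (u $ 2)) - ?c * ((?a - \<mu>) * (u $ 1) + ?b * (u $ 2))"
      by (simp_all add: algebra_simps)
    then have "?D * (u $ 1) = 0" "?D * (u $ 2) = 0" unfolding u by (simp_all only: mult_zero_right diff_self)
    moreover have "u $ 1 \<noteq> 0 \<or> u $ 2 \<noteq> 0" using u(1) by (auto simp: vec_eq_iff forall_2)
    ultimately have "?D = 0" by (metis mult_eq_0_iff)
    then show "\<mu>\<^sup>2 - of_real (trace A) * \<mu> + of_real (det A) = 0" unfolding char .
  next
    assume "\<mu>\<^sup>2 - of_real (trace A) * \<mu> + of_real (det A) = 0"
    then have D: "(?a - \<mu>) * (?d - \<mu>) = ?b * ?c" unfolding char by (simp only: right_minus_eq)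
    have mk: "complex_eigenvalue A \<mu>"
      if "x \<noteq> 0 \<or> y \<noteq> 0" "(?a - \<mu>) * x + ?b * y = 0" "?c * x + (?d - \<mu>) * y = 0" for x y
      unfolding complex_eigenvalue_def
    proof (intro exI conjI)
      show "vector [x, y] \<noteq> (0 :: complex ^ 2)" using that(1) by (auto simp: vec_eq_iff forall_2)
      show "map_matrix complex_of_real A *v vector [x, y] = \<mu> *s vector [x, y]"
        unfolding eq using that(2,3) by simp
    qed
    show "complex_eigenvalue A \<mu>"
    proof (cases "- ?b = 0 \<and> ?a - \<mu> = 0")
      case False
      show ?thesis
      proof (rule mk[of "- ?b" "?a - \<mu>"])
        show "?c * - ?b + (?d - \<mu>) * (?a - \<mu>) = 0"
          using D by (simp only: mult.commute[of "?d - \<mu>"] mult_minus_right mult.commute[of ?c]) simp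
      qed (use False in \<open>simp_all only: mult_minus_right mult.commute[of ?b] de_Morgan_conj add.left_inverse simp_thms\<close>)
    next
      case True
      show ?thesis
      proof (cases "?d - \<mu> = 0 \<and> ?c = 0")
        case True
        with \<open>- ?b = 0 \<and> ?a - \<mu> = 0\<close> show ?thesis by (intro mk[of 1 0]) simp_all
      next
        case False
        show ?thesis
        proof (rule mk[of "?d - \<mu>" "- ?c"])
          show "?d - \<mu> \<noteq> 0 \<or> - ?c \<noteq> 0" using False by auto
          show "(?a - \<mu>) * (?d - \<mu>) + ?b * - ?c = 0" using True by (simp only:) simp
          show "?c * (?d - \<mu>) + (?d - \<mu>) * - ?c = 0" by (simp only: mult_minus_right mult.commute[of ?c] right_minus)
        qed
      qed
    qed
  qed
qed

text \<open>A root on the unit circle has its conjugate as inverse, so the trace is twice its real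
  part; conversely a trace \<open>2 cos x\<close> has the root \<open>cis x\<close>.\<close>

lemma hyperbolic_matrix_iff:
  fixes A :: "real ^ 2 ^ 2"
  assumes "det A = 1"
  shows "hyperbolic_matrix A \<longleftrightarrow> \<bar>trace A\<bar> > 2"
proof -
  define t where "t = trace A"
  have ev: "complex_eigenvalue A \<mu> \<longleftrightarrow> \<mu>\<^sup>2 - of_real t * \<mu> + 1 = 0" for \<mu>
    by (simp add: complex_eigenvalue_iff assms t_def)
  show ?thesis
  proof
    assume h: "hyperbolic_matrix A"
    show "\<bar>trace A\<bar> > 2"
    proof (rule ccontr)
      assume "\<not> ?thesis"
      then have t: "\<bar>t / 2\<bar> \<le> 1" by (simp add: t_def)
      define x where "x = arccos (t / 2)"
      have "cos x = t / 2" unfolding x_def using t by (intro cos_arccos) auto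
      then have tx: "t = 2 * cos x" by simp
      have "(cis x)\<^sup>2 - of_real t * cis x + 1 = 0"
        using sin_cos_squared_add[of x] by (simp add: tx complex_eq_iff power2_eq_square algebra_simps)
      then have "complex_eigenvalue A (cis x)" by (simp add: ev)
      then show False using h by (auto simp: hyperbolic_matrix_def)
    qed
  next
    assume "\<bar>trace A\<bar> > 2"
    then have t: "\<bar>t\<bar> > 2" by (simp add: t_def)
    show "hyperbolic_matrix A" unfolding hyperbolic_matrix_def ev
    proof (intro allI impI notI)
      fix \<mu> assume \<mu>: "\<mu>\<^sup>2 - of_real t * \<mu> + 1 = 0" and n: "cmod \<mu> = 1"
      have c: "\<mu> * cnj \<mu> = 1" using n complex_norm_square[of \<mu>] by simp
      have "(\<mu>\<^sup>2 - of_real t * \<mu> + 1) * cnj \<mu> = \<mu> * (\<mu> * cnj \<mu>) - of_real t * (\<mu> * cnj \<mu>) + cnj \<mu>"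
        by (simp add: power2_eq_square algebra_simps)
      then have z: "\<mu> - of_real t + cnj \<mu> = 0" unfolding \<mu> c by simp
      have "of_real t = (\<mu> + cnj \<mu>) - (\<mu> - of_real t + cnj \<mu>)" by simp
      then have "of_real t = \<mu> + cnj \<mu>" unfolding z by simp
      then have "t = 2 * Re \<mu>" by (simp add: complex_eq_iff)
      then show False using t abs_Re_le_cmod[of \<mu>] n by simp
    qed
  qed
qed

lemma similar_matrices:
  fixes A B P :: "real ^ 2 ^ 2"
  assumes PA: "P ** A = B ** P" and P: "det P \<noteq> 0"
  shows "trace A = trace B" "det A = det B"
proof -
  have "invertible P" using P by (simp add: invertible_det_nz)
  then obtain Q where Q: "P ** Q = mat 1" "Q ** P = mat 1" by (auto simp: invertible_def)
  have "A = Q ** (B ** P)" using PA Q by (metis matrix_mul_assoc matrix_mul_lid)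
  then have "trace A = trace (Q ** (B ** P))" by simp
  also have "\<dots> = trace ((B ** P) ** Q)" by (rule trace_mul_sym)
  also have "(B ** P) ** Q = B" using Q by (simp add: matrix_mul_assoc[symmetric])
  finally show "trace A = trace B" .
  have "det P * det A = det B * det P" using PA by (metis det_mul)
  then show "det A = det B" using P by simp
qed

context hill
begin

lemma flow_linear: "flow z t = of_real (Re z) * flow 1 t + of_real (Im z) * flow \<i> t"
  unfolding flow_eq[of z] flow_eq[of 1] flow_eq[of \<i>] by (simp add: complex_eq_iff)

definition "monodromy_matrix = cmat (\<lambda>z. flow z (2 * pi))"

lemma monodromy_matrix: "vec_complex (monodromy_matrix *v v) = flow (vec_complex v) (2 * pi)"
  unfolding monodromy_matrix_def by (rule cmat_works[of "\<lambda>z. flow z (2 * pi)"]) (rule flow_linear)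

lemma trace_monodromy: "trace monodromy_matrix = 2 * half_trace"
  by (simp add: monodromy_matrix_def cmat_def trace_def sum_2 flow_2pi)

lemma det_monodromy: "det monodromy_matrix = 1"
proof -
  have "det monodromy_matrix = y1 (2 * pi) * v2 (2 * pi) - v1 (2 * pi) * y2 (2 * pi)"
    by (simp add: monodromy_matrix_def cmat_def det_2 flow_eq)
  then show ?thesis by (simp add: det_1)
qed

end

text \<open>The trace is \<open>4 s - 2\<close> with \<open>s = y1 v2\<close> at \<open>pi\<close>,
  and \<open>s\<close> is at most 1 by \<open>trace_le_2\<close>; the upper half of the hyperbolic
  range is thereby excluded.\<close>

lemma hyperbolic_monodromy:
  assumes e: "0 \<le> e" "e < 1" and k: "k \<ge> 0"
  shows "hyperbolic_matrix (hill.monodromy_matrix (ecc_q k e)) \<longleftrightarrow> y1pi k e * v2pi k e < 0"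
proof -
  have e': "\<bar>e\<bar> < 1" using e by simp
  interpret hill "ecc_q k e" "2 + \<bar>k\<bar> / (1 - \<bar>e\<bar>)" by (rule hill_ecc_q[OF e'])
  have "half_trace = 2 * (y1pi k e * v2pi k e) - 1" using det_pi[OF e', of k] unfolding hill_pi_eq[OF e'] by linarith
  moreover have "y1pi k e * v2pi k e \<le> 1" using det_pi[OF e', of k] trace_le_2[OF e k] by linarith
  moreover have "2 < \<bar>2 * h\<bar> \<longleftrightarrow> s < 0" if "h = 2 * s - 1" "s \<le> 1" for h s :: real
    using that by (auto simp: abs_if)
  ultimately show ?thesis
    unfolding hyperbolic_matrix_iff[OF det_monodromy] trace_monodromy by blast
qed

section \<open>The linear system\<close>

lemma lin_coeff_eq: "vec_complex (lin_coeff \<beta> e t *v u) = hill_field (ecc_q (7 * \<beta>) e t) (vec_complex u)"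
  by (simp add: lin_coeff_def J0_def hill_field_def ecc_q_def complex_eq_iff matrix_vector_mult_def matrix_matrix_mult_def sum_2)

lemma bounded_linear_vec_complex: "bounded_linear vec_complex"
proof -
  have "vec_complex = (\<lambda>v. of_real (v $ 1) + \<i> * of_real (v $ 2))"
    by (auto simp: vec_complex_def complex_eq_iff)
  moreover have "bounded_linear (\<lambda>v::real ^ 2. complex_of_real (v $ 1) + \<i> * of_real (v $ 2))"
    by (intro bounded_linear_add bounded_linear_const_mult bounded_linear_compose[OF bounded_linear_of_real bounded_linear_vec_nth])
  ultimately show ?thesis by simp
qed

lemma lin_fundamental_iff:
  assumes e: "\<bar>e\<bar> < 1"
  shows "lin_fundamental \<beta> e \<Phi> \<longleftrightarrow> (\<forall>t v. vec_complex (\<Phi> t *v v) = hill_flow (ecc_q (7 * \<beta>) e) (vec_complex v) t)"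
proof -
  interpret hill "ecc_q (7 * \<beta>) e" "2 + \<bar>7 * \<beta>\<bar> / (1 - \<bar>e\<bar>)" by (rule hill_ecc_q[OF e])
  show ?thesis
  proof
    assume L: "lin_fundamental \<beta> e \<Phi>"
    show "\<forall>t v. vec_complex (\<Phi> t *v v) = flow (vec_complex v) t"
    proof (intro allI)
      fix t v
      have "((\<lambda>t. vec_complex (\<Phi> t *v v)) has_vector_derivative vec_complex ((lin_coeff \<beta> e t ** \<Phi> t) *v v)) (at t)" for t
      proof -
        have "bounded_linear (\<lambda>M :: real ^ 2 ^ 2. vec_complex (M *v v))"
          by (intro bounded_linear_compose[OF bounded_linear_vec_complex] linear_conv_bounded_linear[THEN iffD1])
             (auto intro!: linearI simp: matrix_vector_mult_add_rdistrib scaleR_matrix_vector_assoc)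
        from bounded_linear.has_vector_derivative[OF this] show ?thesis
          using L by (simp add: lin_fundamental_def)
      qed
      then have d: "((\<lambda>t. vec_complex (\<Phi> t *v v)) has_vector_derivative hill_field (ecc_q (7 * \<beta>) e t) (vec_complex (\<Phi> t *v v))) (at t)" for t
        by (simp add: matrix_vector_mul_assoc[symmetric] lin_coeff_eq)
      have "hill_sol (ecc_q (7 * \<beta>) e) (\<lambda>t. Im (vec_complex (\<Phi> t *v v))) (\<lambda>t. Re (vec_complex (\<Phi> t *v v)))"
        using bounded_linear.has_vector_derivative[OF bounded_linear_Re d] bounded_linear.has_vector_derivative[OF bounded_linear_Im d]
        unfolding hill_sol_def has_real_derivative_iff_has_vector_derivative by (simp add: hill_field_def)
      from hill_sol_unique[OF this, of t] show "vec_complex (\<Phi> t *v v) = flow (vec_complex v) t"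
        using L by (simp add: flow_eq complex_eq_iff lin_fundamental_def matrix_vector_mul_lid)
    qed
  next
    assume F: "\<forall>t v. vec_complex (\<Phi> t *v v) = flow (vec_complex v) t"
    have col: "\<Phi> t = (\<Sum>i\<in>UNIV. \<Sum>j\<in>UNIV. (\<Phi> t $ i $ j) *\<^sub>R axis i (axis j 1))" for t
      by (simp add: vec_eq_iff forall_2 sum_2 axis_def)
    have A: "\<Phi> t *v axis j 1 = column j (\<Phi> t)" for t j by (simp add: matrix_vector_mult_basis)
    have "\<Phi> 0 *v v = mat 1 *v v" for v
      using F[rule_format, of 0 v] by (simp add: vec_complex_inject matrix_vector_mul_lid)
    then have 0: "\<Phi> 0 = mat 1" by (simp add: matrix_eq)
    have ent: "((\<lambda>t. \<Phi> t $ i $ j) has_vector_derivative (lin_coeff \<beta> e t ** \<Phi> t) $ i $ j) (at t)" for t i j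
    proof -
      have d: "((\<lambda>t. vec_complex (\<Phi> t *v axis j 1)) has_vector_derivative vec_complex ((lin_coeff \<beta> e t ** \<Phi> t) *v axis j 1)) (at t)"
        using flow_deriv[of "vec_complex (axis j 1)" t UNIV]
        by (simp only: F matrix_vector_mul_assoc[symmetric] lin_coeff_eq)
      show ?thesis
        using exhaust_2[of i] bounded_linear.has_vector_derivative[OF bounded_linear_Re d] bounded_linear.has_vector_derivative[OF bounded_linear_Im d]
        by (auto simp: A column_def matrix_vector_mult_basis)
    qed
    have "((\<lambda>t. \<Sum>i\<in>UNIV. \<Sum>j\<in>UNIV. (\<Phi> t $ i $ j) *\<^sub>R axis i (axis j 1)) has_vector_derivative
        (\<Sum>i\<in>UNIV. \<Sum>j\<in>UNIV. ((lin_coeff \<beta> e t ** \<Phi> t) $ i $ j) *\<^sub>R axis i (axis j (1::real)))) (at t)" for t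
      by (intro has_vector_derivative_sum bounded_linear.has_vector_derivative[OF bounded_linear_scaleR_left ent])
    moreover have "(\<Sum>i\<in>UNIV. \<Sum>j\<in>UNIV. (M $ i $ j) *\<^sub>R axis i (axis j (1::real))) = M" for M :: "real ^ 2 ^ 2"
      by (simp add: vec_eq_iff forall_2 sum_2 axis_def)
    ultimately show "lin_fundamental \<beta> e \<Phi>" using 0 by (simp add: lin_fundamental_def)
  qed
qed

text \<open>Serves the case \<open>e = 0\<close>, where rotation number and hyperbolicity are
  defined by the linear system.\<close>

lemma lin_system:
  assumes e: "\<bar>e\<bar> < 1"
  shows "lin_rotation_number \<beta> e = hill.rot (ecc_q (7 * \<beta>) e)"
    and "lin_hyperbolic \<beta> e \<longleftrightarrow> hyperbolic_matrix (hill.monodromy_matrix (ecc_q (7 * \<beta>) e))"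
proof -
  interpret hill "ecc_q (7 * \<beta>) e" "2 + \<bar>7 * \<beta>\<bar> / (1 - \<bar>e\<bar>)" by (rule hill_ecc_q[OF e])
  note lf = lin_fundamental_iff[OF e]
  have ex: "lin_fundamental \<beta> e (\<lambda>t. cmat (\<lambda>z. flow z t))"
    unfolding lf by (intro allI cmat_works flow_linear)
  have rate: "has_rotation_rate \<Phi> rot" if "lin_fundamental \<beta> e \<Phi>" for \<Phi>
    unfolding has_rotation_rate_def
  proof (intro allI impI)
    fix v :: "real ^ 2" assume v: "v \<noteq> 0"
    let ?z = "vec_complex v"
    have z: "?z \<noteq> 0" using v by simp
    have eq: "vec_complex (\<Phi> t *v v) = flow ?z t" for t using that lf by blast
    have "continuous_argument (\<lambda>t. vec_complex (\<Phi> t *v v)) (\<lambda>t. Arg ?z + angle ?z t)"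
      unfolding continuous_argument_def eq
      using flow_nonzero[OF z] flow_polar[OF z] by (auto intro!: continuous_intros continuous_on_angle z)
    moreover have "((\<lambda>t. (Arg ?z + angle ?z t) / t) \<longlongrightarrow> rot) at_top"
    proof -
      have "((\<lambda>t::real. Arg ?z / t) \<longlongrightarrow> 0) at_top"
        by (rule tendsto_divide_0[OF tendsto_const filterlim_at_top_imp_at_infinity[OF filterlim_ident]])
      from tendsto_add[OF this rot_tendsto[OF z]] show ?thesis by (simp add: add_divide_distrib)
    qed
    ultimately show "\<exists>\<eta>. continuous_argument (\<lambda>t. vec_complex (\<Phi> t *v v)) \<eta> \<and> ((\<lambda>t. \<eta> t / t) \<longlongrightarrow> rot) at_top" by blast
  qed
  show "lin_rotation_number \<beta> e = rot"
    unfolding lin_rotation_number_def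
    by (rule the_equality) (use ex rate rotation_rate_unique in blast)+
  have "\<Phi> (2 * pi) = monodromy_matrix" if "lin_fundamental \<beta> e \<Phi>" for \<Phi>
  proof -
    have "vec_complex (\<Phi> (2 * pi) *v v) = vec_complex (monodromy_matrix *v v)" for v
      using that lf monodromy_matrix by simp
    then show ?thesis by (simp add: vec_complex_inject matrix_eq)
  qed
  then show "lin_hyperbolic \<beta> e \<longleftrightarrow> hyperbolic_matrix monodromy_matrix"
    unfolding lin_hyperbolic_def using ex by metis
qed

section \<open>The linearized flow along the Euler orbit\<close>

lemma has_vector_derivative_phase:
  "((\<lambda>t. (a t, b t, c t, d t)) has_vector_derivative (a', b', c', d')) (at x within S) \<longleftrightarrow>
     (a has_vector_derivative a') (at x within S) \<and> (b has_vector_derivative b') (at x within S) \<and>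
     (c has_vector_derivative c') (at x within S) \<and> (d has_vector_derivative d') (at x within S)"
proof
  assume h: "((\<lambda>t. (a t, b t, c t, d t)) has_vector_derivative (a', b', c', d')) (at x within S)"
  note s = bounded_linear.has_vector_derivative[OF bounded_linear_snd] and f = bounded_linear.has_vector_derivative[OF bounded_linear_fst]
  show "(a has_vector_derivative a') (at x within S) \<and> (b has_vector_derivative b') (at x within S) \<and>
     (c has_vector_derivative c') (at x within S) \<and> (d has_vector_derivative d') (at x within S)"
    using f[OF h] f[OF s[OF h]] f[OF s[OF s[OF h]]] s[OF s[OF s[OF h]]] by simp
next
  assume "(a has_vector_derivative a') (at x within S) \<and> (b has_vector_derivative b') (at x within S) \<and>
     (c has_vector_derivative c') (at x within S) \<and> (d has_vector_derivative d') (at x within S)"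
  then show "((\<lambda>t. (a t, b t, c t, d t)) has_vector_derivative (a', b', c', d')) (at x within S)"
    by (elim conjE) (intro has_vector_derivative_Pair)
qed

context hill
begin

text \<open>Uniqueness after a change of time: the Wronskians with the fundamental solutions taken
  along \<open>\<theta>\<close> are constant, and their values give the initial vector
  \<open>z\<close>.\<close>

lemma flow_reparametrized:
  assumes \<theta>: "\<And>t. (\<theta> has_real_derivative \<omega> t) (at t)"
    and a: "\<And>t. (a has_real_derivative - (\<omega> t * q (\<theta> t) * b t)) (at t)"
    and b: "\<And>t. (b has_real_derivative \<omega> t * a t) (at t)"
  shows "\<exists>z. \<forall>t. Complex (a t) (b t) = flow z (\<theta> t)"
proof -
  note d = DERIV_chain2[OF hill_solD(1)[OF sol1] \<theta>] DERIV_chain2[OF hill_solD(2)[OF sol1] \<theta>]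
    DERIV_chain2[OF hill_solD(1)[OF sol2] \<theta>] DERIV_chain2[OF hill_solD(2)[OF sol2] \<theta>]
  have "((\<lambda>t. a t * y1 (\<theta> t) - b t * v1 (\<theta> t)) has_real_derivative 0) (at t)" for t
    by (rule a b d derivative_eq_intros refl)+ (simp add: algebra_simps)
  then have 1: "a t * y1 (\<theta> t) - b t * v1 (\<theta> t) = a 0 * y1 (\<theta> 0) - b 0 * v1 (\<theta> 0)" for t
    using DERIV_isconst_all[of "\<lambda>t. a t * y1 (\<theta> t) - b t * v1 (\<theta> t)"] by blast
  have "((\<lambda>t. b t * v2 (\<theta> t) - a t * y2 (\<theta> t)) has_real_derivative 0) (at t)" for t
    by (rule a b d derivative_eq_intros refl)+ (simp add: algebra_simps)
  then have 2: "b t * v2 (\<theta> t) - a t * y2 (\<theta> t) = b 0 * v2 (\<theta> 0) - a 0 * y2 (\<theta> 0)" for t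
    using DERIV_isconst_all[of "\<lambda>t. b t * v2 (\<theta> t) - a t * y2 (\<theta> t)"] by blast
  define z where "z = Complex (a 0 * y1 (\<theta> 0) - b 0 * v1 (\<theta> 0)) (b 0 * v2 (\<theta> 0) - a 0 * y2 (\<theta> 0))"
  have "Complex (a t) (b t) = flow z (\<theta> t)" for t
  proof -
    have z: "z = Complex (a t * y1 (\<theta> t) - b t * v1 (\<theta> t)) (b t * v2 (\<theta> t) - a t * y2 (\<theta> t))"
      unfolding z_def 1[of t, symmetric] 2[of t, symmetric] ..
    have "Im z * v1 (\<theta> t) + Re z * v2 (\<theta> t) = a t * (y1 (\<theta> t) * v2 (\<theta> t) - v1 (\<theta> t) * y2 (\<theta> t))"
      "Im z * y1 (\<theta> t) + Re z * y2 (\<theta> t) = b t * (y1 (\<theta> t) * v2 (\<theta> t) - v1 (\<theta> t) * y2 (\<theta> t))"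
      by (simp_all add: z algebra_simps)
    then show ?thesis unfolding flow_eq det_1 by simp
  qed
  then show ?thesis by blast
qed

end

lemma tendsto_linear_growth:
  fixes f :: "real \<Rightarrow> real"
  assumes "\<And>t. t \<ge> 0 \<Longrightarrow> \<bar>f t - L * t\<bar> \<le> K"
  shows "((\<lambda>t. f t / t) \<longlongrightarrow> L) at_top"
proof -
  have "((\<lambda>t. f t / t - L) \<longlongrightarrow> 0) at_top"
  proof (rule Lim_null_comparison)
    show "\<forall>\<^sub>F t in at_top. norm (f t / t - L) \<le> K / t"
      using eventually_gt_at_top[of 0]
    proof eventually_elim
      case (elim t)
      then have "f t / t - L = (f t - L * t) / t" by (simp add: field_simps)
      then show ?case using assms[of t] elim by (simp add: divide_right_mono)
    qed
    show "((\<lambda>t. K / t) \<longlongrightarrow> 0) at_top"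
      by (rule tendsto_divide_0[OF tendsto_const filterlim_at_top_imp_at_infinity[OF filterlim_ident]])
  qed
  then show ?thesis by (simp add: LIM_zero_iff)
qed

section \<open>The Euler orbit as a Kepler ellipse\<close>

locale kepler =
  fixes \<beta> e :: real
  assumes \<beta>: "0 < \<beta>" "\<beta> < 1" and e: "0 < e" "e < 1"
begin

definition "\<alpha> = alpha_of \<beta>"
definition "w = varpi_of \<beta> e"
text \<open>In the plane \<open>z = 0\<close> this is the Kepler problem with attraction
  \<open>1 / \<beta>\<close> and angular momentum \<open>w\<close>: \<open>p\<close> is the
  semi-latus rectum, and \<open>R\<close>, \<open>U\<close>, \<open>speed\<close> are the radius,
  radial momentum and angular velocity at true anomaly \<open>x\<close>.\<close>

definition "p = w\<^sup>2 * \<beta>"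
definition "R x = p / (1 + e * cos x)"
definition "U x = w * e / p * sin x"
definition "speed x = w / (R x)\<^sup>2"
definition \<Gamma> :: "real \<Rightarrow> phase" where "\<Gamma> x = (U x, 0, R x, 0)"

lemma e': "\<bar>e\<bar> < 1" using e by simp

sublocale hill "ecc_q (7 * \<beta>) e" "2 + \<bar>7 * \<beta>\<bar> / (1 - \<bar>e\<bar>)" by (rule hill_ecc_q[OF e'])

text \<open>The last equation is the origin of the 7: the vertical attraction is
  \<open>4 / \<alpha> + 8\<close>, which exceeds the planar one
  \<open>1 + 4 / \<alpha> = 1 / \<beta>\<close> by 7.\<close>

lemma \<alpha>: "\<alpha> > 0" "1 + 4 / \<alpha> = 1 / \<beta>" "4 / \<alpha> * (1 + 2 * \<alpha>) = 1 / \<beta> + 7"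
proof -
  show a: "\<alpha> > 0" using \<beta> by (simp add: \<alpha>_def alpha_of_def)
  show b: "1 + 4 / \<alpha> = 1 / \<beta>" using \<beta> by (simp add: \<alpha>_def alpha_of_def field_simps)
  have "4 / \<alpha> * (1 + 2 * \<alpha>) = (1 + 4 / \<alpha>) + 7" using a by (simp add: field_simps)
  then show "4 / \<alpha> * (1 + 2 * \<alpha>) = 1 / \<beta> + 7" by (simp only: b)
qed

lemma w: "w > 0" "2 * p * \<beta> = 1 - e\<^sup>2" "w\<^sup>2 = p / \<beta>" "p > 0"
proof -
  have e2: "e\<^sup>2 < 1" using e by (simp add: power_less_one_iff abs_square_less_1)
  then show w0: "w > 0" using \<beta> by (simp add: w_def varpi_of_def)
  have "w\<^sup>2 * \<beta>\<^sup>2 = (1 - e\<^sup>2) / 2"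
    using e2 \<beta> by (simp add: w_def varpi_of_def power_divide)
  then show "2 * p * \<beta> = 1 - e\<^sup>2" by (simp add: p_def power2_eq_square)
  show "w\<^sup>2 = p / \<beta>" using \<beta> by (simp add: p_def)
  show "p > 0" using w0 \<beta> by (simp add: p_def)
qed

lemma den: "1 + e * cos x > 0" "1 + e * cos x \<noteq> 0"
  using one_plus_ecc_cos_pos[OF e', of x] by simp_all

lemma R: "R x > 0" "R x \<noteq> 0" using den[of x] w by (simp_all add: R_def)

lemma p_over_R: "p / R x = 1 + e * cos x" using den[of x] w by (simp add: R_def)

lemma speed_pos: "speed x > 0" using R[of x] w by (simp add: speed_def)

lemma speed_nz: "speed x \<noteq> 0" using speed_pos[of x] by simp

lemma continuous_on_R [continuous_intros]: "continuous_on A R" and continuous_on_U [continuous_intros]: "continuous_on A U"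
  unfolding R_def[abs_def] U_def[abs_def] using den w(4) by (auto intro!: continuous_intros)

lemma periodic: "R (x + 2 * pi) = R x" "U (x + 2 * pi) = U x" "speed (x + 2 * pi) = speed x"
  by (simp_all add: R_def U_def speed_def)

lemma force: "- (w\<^sup>2 / R x ^ 3) + (1 / \<beta>) / (R x)\<^sup>2 = - (e * cos x / (\<beta> * (R x)\<^sup>2))"
proof -
  have "w\<^sup>2 / R x ^ 3 = (p / R x) / (\<beta> * (R x)\<^sup>2)" using w by (simp add: power2_eq_square power3_eq_cube)
  then show ?thesis unfolding p_over_R using \<beta> R[of x] by (simp add: field_simps)
qed

lemma R_deriv: "(R has_real_derivative U x / speed x) (at x)"
proof -
  have "(R has_real_derivative p * (e * sin x) / (1 + e * cos x)\<^sup>2) (at x)"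
    unfolding R_def[abs_def] using den[of x] by (auto intro!: derivative_eq_intros simp: power2_eq_square)
  moreover have "p * (e * sin x) / (1 + e * cos x)\<^sup>2 = U x / speed x"
  proof -
    define D where "D = 1 + e * cos x"
    have "D \<noteq> 0" using den[of x] by (simp add: D_def)
    then show ?thesis unfolding U_def speed_def R_def D_def[symmetric] using w(1,4) by (simp add: field_simps power2_eq_square)
  qed
  ultimately show ?thesis by simp
qed

lemma U_deriv: "(U has_real_derivative e * cos x / (\<beta> * (R x)\<^sup>2) / speed x) (at x)"
proof -
  have "(U has_real_derivative w * e / p * cos x) (at x)"
    unfolding U_def[abs_def] using w(4) by (auto intro!: derivative_eq_intros)
  moreover have "w * e / p * cos x = e * cos x / (\<beta> * (R x)\<^sup>2) / speed x"
  proof -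
    have "w * e / p = e / (\<beta> * w)" using w(1) by (simp add: p_def power2_eq_square)
    then show ?thesis using w(1) R[of x] \<beta> by (simp add: speed_def)
  qed
  ultimately show ?thesis by simp
qed

text \<open>These coordinates are \<open>e cos\<close> and \<open>e sin\<close> of the true anomaly,
  so the energy level becomes a circle of radius \<open>e\<close>.\<close>

lemma energy_iff:
  assumes r: "r > 0"
  shows "hamiltonian \<alpha> w (pr, 0, r, 0) = -1 \<longleftrightarrow> (p / r - 1)\<^sup>2 + (p * pr / w)\<^sup>2 = e\<^sup>2"
proof -
  have "hamiltonian \<alpha> w (pr, 0, r, 0) = pr\<^sup>2 / 2 + w\<^sup>2 / (2 * r\<^sup>2) - (1 + 4 / \<alpha>) / r"
    using r by (simp add: hamiltonian_def potential_def add_divide_distrib)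
  then have H: "hamiltonian \<alpha> w (pr, 0, r, 0) = pr\<^sup>2 / 2 + p / \<beta> / (2 * r\<^sup>2) - 1 / \<beta> / r"
    unfolding \<alpha> w(3) .
  have "(p * pr / w)\<^sup>2 = p * \<beta> * pr\<^sup>2"
    unfolding power_divide power_mult_distrib w(3) using \<beta> w by (simp add: power2_eq_square)
  then have "(p / r - 1)\<^sup>2 + (p * pr / w)\<^sup>2 - e\<^sup>2 = (p / r)\<^sup>2 - 2 * (p / r) + p * \<beta> * pr\<^sup>2 + 2 * p * \<beta>"
    unfolding w(2) by (simp add: power2_eq_square algebra_simps)
  also have "\<dots> = 2 * p * \<beta> * (hamiltonian \<alpha> w (pr, 0, r, 0) + 1)"
    unfolding H using \<beta> r by (simp add: power2_eq_square field_simps)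
  finally have "(p / r - 1)\<^sup>2 + (p * pr / w)\<^sup>2 - e\<^sup>2 = 2 * p * \<beta> * (hamiltonian \<alpha> w (pr, 0, r, 0) + 1)" .
  moreover have "2 * p * \<beta> \<noteq> 0" using w(4) \<beta> by simp
  ultimately show ?thesis by (metis add_eq_0_iff mult_eq_0_iff right_minus_eq minus_minus add.commute)
qed

lemma \<Gamma>_in_orbit: "\<Gamma> x \<in> euler_orbit \<alpha> w"
proof -
  have "p * U x / w = e * sin x" using w(1,4) by (simp add: U_def)
  then have "(p / R x - 1)\<^sup>2 + (p * U x / w)\<^sup>2 = e\<^sup>2 * ((cos x)\<^sup>2 + (sin x)\<^sup>2)"
    unfolding p_over_R by (simp only: power_mult_distrib distrib_left add_diff_cancel_left')
  then have "hamiltonian \<alpha> w (U x, 0, R x, 0) = -1" unfolding energy_iff[OF R(1)] by simp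
  then show ?thesis using R[of x] by (simp add: euler_orbit_def energy_surface_def \<Gamma>_def)
qed

lemma X_H_\<Gamma>: "X_H \<alpha> w (\<Gamma> x) = (e * cos x / (\<beta> * (R x)\<^sup>2), 0, U x, 0)"
  using force[of x] R[of x] by (simp add: \<Gamma>_def X_H_eq[OF \<alpha>(1)] grav_planar \<alpha>)

text \<open>The true anomaly along the Kepler ellipse with semi-latus rectum \<open>p\<close>.\<close>

definition anomaly :: "(real \<Rightarrow> real) \<Rightarrow> bool" where
  "anomaly \<theta> \<longleftrightarrow> (\<forall>t. (\<theta> has_real_derivative speed (\<theta> t)) (at t))"

lemma anomalyD: "anomaly \<theta> \<Longrightarrow> (\<theta> has_real_derivative speed (\<theta> t)) (at t within S)"
  by (auto simp: anomaly_def intro: has_field_derivative_at_within)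

lemma R_anomaly:
  assumes "anomaly \<theta>" shows "((\<lambda>t. R (\<theta> t)) has_real_derivative U (\<theta> t)) (at t)"
  using DERIV_chain2[OF R_deriv anomalyD[OF assms]] by (simp add: speed_nz)

lemma U_anomaly:
  assumes "anomaly \<theta>" shows "((\<lambda>t. U (\<theta> t)) has_real_derivative e * cos (\<theta> t) / (\<beta> * (R (\<theta> t))\<^sup>2)) (at t)"
  using DERIV_chain2[OF U_deriv anomalyD[OF assms], of t] by (simp add: speed_nz)

lemma euler_solution_anomaly:
  assumes "anomaly \<theta>" shows "euler_solution \<alpha> w (\<lambda>t. \<Gamma> (\<theta> t))"
  unfolding euler_solution_def X_H_\<Gamma>
  using \<Gamma>_in_orbit R_anomaly[OF assms] U_anomaly[OF assms]
  by (auto simp: \<Gamma>_def has_vector_derivative_phase has_real_derivative_iff_has_vector_derivative)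

text \<open>In the coordinates of \<open>energy_iff\<close> the motion is a rotation with angular
  velocity \<open>w / r^2\<close>. The anomaly is that velocity integrated from the initial angle;
  rotating the coordinates back by it makes them constant.\<close>

lemma anomaly_of_euler_solution:
  assumes "euler_solution \<alpha> w \<gamma>"
  shows "\<exists>\<theta>. anomaly \<theta> \<and> \<gamma> = (\<lambda>t. \<Gamma> (\<theta> t))"
proof -
  define pr r where "pr t = fst (\<gamma> t)" and "r t = fst (snd (snd (\<gamma> t)))" for t
  have orb: "\<gamma> t \<in> euler_orbit \<alpha> w" and der: "(\<gamma> has_vector_derivative X_H \<alpha> w (\<gamma> t)) (at t)" for t
    using assms by (auto simp: euler_solution_def)
  have \<gamma>: "\<gamma> t = (pr t, 0, r t, 0)" and r: "r t > 0" and H: "hamiltonian \<alpha> w (pr t, 0, r t, 0) = -1" for t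
    using orb[of t] by (auto simp: euler_orbit_def energy_surface_def pr_def r_def)
  have r0: "r t \<noteq> 0" for t using r[of t] by simp
  have "((\<lambda>t. (pr t, 0 :: real, r t, 0 :: real)) has_vector_derivative (w\<^sup>2 / r t ^ 3 - 1 / \<beta> / (r t)\<^sup>2, 0, pr t, 0)) (at t)" for t
    using der[of t] r[of t] unfolding \<gamma>[abs_def] by (simp add: X_H_eq[OF \<alpha>(1)] grav_planar \<alpha>)
  then have dpr: "(pr has_real_derivative w\<^sup>2 / r t ^ 3 - 1 / \<beta> / (r t)\<^sup>2) (at t)" and dr: "(r has_real_derivative pr t) (at t)" for t
    by (auto simp: has_vector_derivative_phase has_real_derivative_iff_has_vector_derivative)
  define A B where "A t = p / r t - 1" and "B t = p * pr t / w" for t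
  define \<omega> where "\<omega> t = w / (r t)\<^sup>2" for t
  have dA: "(A has_real_derivative - (\<omega> t * B t)) (at t)" for t
    unfolding A_def[abs_def] using r0[of t] w
    by (auto intro!: derivative_eq_intros dr simp: \<omega>_def B_def power2_eq_square)
  have dB: "(B has_real_derivative \<omega> t * A t) (at t)" for t
  proof -
    have "(B has_real_derivative p * (w\<^sup>2 / r t ^ 3 - 1 / \<beta> / (r t)\<^sup>2) / w) (at t)"
      unfolding B_def[abs_def] by (rule DERIV_cdivide[OF DERIV_cmult[OF dpr]])
    moreover have "p * (w\<^sup>2 / r t ^ 3 - 1 / \<beta> / (r t)\<^sup>2) / w = \<omega> t * A t"
    proof -
      have "p * (1 / \<beta> / (r t)\<^sup>2) / w = w / (r t)\<^sup>2" using w(1) \<beta> by (simp add: p_def power2_eq_square)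
      moreover have "p * (w\<^sup>2 / r t ^ 3) / w = w / (r t)\<^sup>2 * (p / r t)" using w(1) by (simp add: power2_eq_square power3_eq_cube ac_simps)
      ultimately show ?thesis unfolding right_diff_distrib diff_divide_distrib by (simp add: \<omega>_def A_def right_diff_distrib)
    qed
    ultimately show ?thesis by simp
  qed
  have AB: "(A t)\<^sup>2 + (B t)\<^sup>2 = e\<^sup>2" for t using H[of t] energy_iff[OF r[of t]] by (simp add: A_def B_def)
  have "(A 0 / e)\<^sup>2 + (B 0 / e)\<^sup>2 = 1" using AB[of 0] e by (simp add: power_divide add_divide_distrib[symmetric])
  then obtain \<theta>0 where "A 0 / e = cos \<theta>0" "B 0 / e = sin \<theta>0" using sincos_total_2pi by metis
  then have \<theta>0: "A 0 = e * cos \<theta>0" "B 0 = e * sin \<theta>0" using e by (simp_all add: field_simps)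
  have cr: "continuous_on UNIV r" using dr by (meson DERIV_isCont continuous_at_imp_continuous_on)
  have "continuous_on UNIV \<omega>" unfolding \<omega>_def[abs_def] using r0 by (intro continuous_intros cr) simp
  from has_vector_derivative_scaled_integral[OF this]
  obtain I where I: "\<And>t. (I has_real_derivative \<omega> t) (at t)" unfolding has_real_derivative_iff_has_vector_derivative by blast
  define \<theta> where "\<theta> t = \<theta>0 + (I t - I 0)" for t
  have d\<theta>: "(\<theta> has_real_derivative \<omega> t) (at t)" for t
    unfolding \<theta>_def[abs_def] by (auto intro!: derivative_eq_intros I)
  have "((\<lambda>t. A t * cos (\<theta> t) + B t * sin (\<theta> t)) has_real_derivative 0) (at t)" for t
    by (rule derivative_eq_intros dA dB d\<theta> refl)+ (simp add: algebra_simps)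
  then have "A t * cos (\<theta> t) + B t * sin (\<theta> t) = A 0 * cos (\<theta> 0) + B 0 * sin (\<theta> 0)" for t
    using DERIV_isconst_all[of "\<lambda>t. A t * cos (\<theta> t) + B t * sin (\<theta> t)"] by blast
  also have "A 0 * cos (\<theta> 0) + B 0 * sin (\<theta> 0) = e * ((cos \<theta>0)\<^sup>2 + (sin \<theta>0)\<^sup>2)" 
    by (simp only: \<theta>0 \<theta>_def diff_self add_0_right power2_eq_square distrib_left mult.assoc)
  finally have c1: "A t * cos (\<theta> t) + B t * sin (\<theta> t) = e" for t by simp
  have "((\<lambda>t. B t * cos (\<theta> t) - A t * sin (\<theta> t)) has_real_derivative 0) (at t)" for t
    by (rule derivative_eq_intros dA dB d\<theta> refl)+ (simp add: algebra_simps)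
  then have "B t * cos (\<theta> t) - A t * sin (\<theta> t) = B 0 * cos (\<theta> 0) - A 0 * sin (\<theta> 0)" for t
    using DERIV_isconst_all[of "\<lambda>t. B t * cos (\<theta> t) - A t * sin (\<theta> t)"] by blast
  then have c2: "B t * cos (\<theta> t) - A t * sin (\<theta> t) = 0" for t by (simp add: \<theta>0 \<theta>_def)
  have At: "A t = e * cos (\<theta> t)" and Bt: "B t = e * sin (\<theta> t)" for t
  proof -
    have rot: "x * (c\<^sup>2 + s\<^sup>2) = (x * c + y * s) * c - (y * c - x * s) * s"
      "y * (c\<^sup>2 + s\<^sup>2) = (x * c + y * s) * s + (y * c - x * s) * c" for x y c s :: real
      by (simp_all add: power2_eq_square algebra_simps)
    have "A t * ((cos (\<theta> t))\<^sup>2 + (sin (\<theta> t))\<^sup>2) = e * cos (\<theta> t)" "B t * ((cos (\<theta> t))\<^sup>2 + (sin (\<theta> t))\<^sup>2) = e * sin (\<theta> t)"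
      using rot(1)[of "A t" "cos (\<theta> t)" "sin (\<theta> t)" "B t"] rot(2)[of "B t" "cos (\<theta> t)" "sin (\<theta> t)" "A t"]
      by (simp_all only: c1 c2 mult_zero_left diff_0_right add_0_right)
    then show "A t = e * cos (\<theta> t)" "B t = e * sin (\<theta> t)" by simp_all
  qed
  have rR: "r t = R (\<theta> t)" for t
  proof -
    have "p / r t = 1 + e * cos (\<theta> t)" using At[of t] by (simp add: A_def)
    then show ?thesis using r0[of t] den[of "\<theta> t"] by (simp add: R_def field_simps)
  qed
  have pU: "pr t = U (\<theta> t)" for t
    using Bt[of t] w by (simp add: B_def U_def field_simps)
  have "anomaly \<theta>" unfolding anomaly_def using d\<theta> by (simp add: \<omega>_def speed_def rR)
  moreover have "\<gamma> = (\<lambda>t. \<Gamma> (\<theta> t))" by (rule ext) (simp add: \<gamma> \<Gamma>_def rR pU)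
  ultimately show ?thesis by blast
qed

section \<open>Time as a function of the anomaly, and the period\<close>

definition "time x = x *\<^sub>R integral {0..1} (\<lambda>s. 1 / speed (x * s))"
definition "period = time (2 * pi)"

lemma time_deriv: "(time has_real_derivative 1 / speed x) (at x)"
proof -
  have "continuous_on UNIV (\<lambda>x. 1 / speed x)"
    unfolding speed_def using w R by (intro continuous_intros) auto
  from has_vector_derivative_scaled_integral[OF this]
  show ?thesis unfolding time_def[abs_def] has_real_derivative_iff_has_vector_derivative .
qed

lemma time_0 [simp]: "time 0 = 0" by (simp add: time_def)

lemma time_strict_mono: "x < y \<Longrightarrow> time x < time y"
  by (rule DERIV_pos_imp_increasing) (use time_deriv speed_pos in force)+

lemma time_inject: "time x = time y \<longleftrightarrow> x = y"
  using time_strict_mono[of x y] time_strict_mono[of y x] by (cases x y rule: linorder_cases) auto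

lemma period_pos: "period > 0" using time_strict_mono[of 0 "2 * pi"] by (simp add: period_def)

lemma time_add: "time (x + 2 * pi) = time x + period"
proof -
  have "((\<lambda>x. time (x + 2 * pi)) has_real_derivative 1 / speed x) (at x)" for x
    using time_deriv[of "x + 2 * pi"] by (simp add: DERIV_shift periodic)
  from real_const_if_deriv_eq[OF this time_deriv, of x 0] show ?thesis by (simp add: period_def)
qed

lemma time_anomaly:
  assumes "anomaly \<theta>" shows "time (\<theta> t) = time (\<theta> s) + (t - s)"
proof -
  have "((\<lambda>t. time (\<theta> t)) has_real_derivative 1) (at t)" for t
    using DERIV_chain2[OF time_deriv anomalyD[OF assms]] by (simp add: speed_nz)
  from real_const_if_deriv_eq[OF this DERIV_ident, of t s] show ?thesis by simp
qed

lemma anomaly_period: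
  assumes "anomaly \<theta>" shows "\<theta> (t + period) = \<theta> t + 2 * pi"
proof -
  have "time (\<theta> (t + period)) = time (\<theta> t + 2 * pi)"
    using time_anomaly[OF assms, of "t + period" t] by (simp add: time_add)
  then show ?thesis by (simp only: time_inject)
qed

lemma anomaly_mono:
  assumes "anomaly \<theta>" "s < t" shows "\<theta> s < \<theta> t"
  by (rule DERIV_pos_imp_increasing[OF assms(2)]) (use anomalyD[OF assms(1)] speed_pos in blast)

text \<open>The anomaly is the inverse function of \<open>time\<close>; a positive lower bound on
  the derivative makes \<open>time\<close> surjective, so the solution is global.\<close>

lemma anomaly_exists: "\<exists>\<theta>. anomaly \<theta>"
proof -
  \<comment> \<open>The value of \<open>1 / speed\<close> at the smallest radius
    \<open>p / (1 + e)\<close>.\<close>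
  define c where "c = (p / (1 + e))\<^sup>2 / w"
  have c: "c > 0" using w e by (simp add: c_def)
  have ge: "c \<le> 1 / speed x" for x
  proof -
    have "e * cos x \<le> e * 1" using e by (intro mult_left_mono) auto
    then have "p / (1 + e) \<le> R x" unfolding R_def using w den[of x] by (intro divide_left_mono mult_pos_pos) auto
    then have "(p / (1 + e))\<^sup>2 \<le> (R x)\<^sup>2" using w e by (intro power_mono) auto
    then show ?thesis using w by (simp add: c_def speed_def divide_right_mono)
  qed
  have mono: "time x - c * x \<le> time y - c * y" if "x \<le> y" for x y
  proof (rule DERIV_nonneg_imp_nondecreasing[OF that])
    fix x
    have "((\<lambda>x. time x - c * x) has_real_derivative 1 / speed x - c) (at x)"
      by (auto intro!: derivative_eq_intros time_deriv)
    then show "\<exists>d. ((\<lambda>x. time x - c * x) has_real_derivative d) (at x) \<and> 0 \<le> d" using ge[of x] by (intro exI conjI) auto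
  qed
  have ct: "continuous_on A time" for A using DERIV_continuous_on[of A time "\<lambda>x. 1 / speed x"] time_deriv has_field_derivative_at_within by blast
  have surj: "\<exists>x. time x = y" for y
  proof -
    have "time (- \<bar>y\<bar> / c) \<le> c * (- \<bar>y\<bar> / c)" using mono[of "- \<bar>y\<bar> / c" 0] c by simp
    then have 1: "time (- \<bar>y\<bar> / c) \<le> y" using c by simp
    have "c * (\<bar>y\<bar> / c) \<le> time (\<bar>y\<bar> / c)" using mono[of 0 "\<bar>y\<bar> / c"] c by simp
    then have 2: "y \<le> time (\<bar>y\<bar> / c)" using c by simp
    have "- \<bar>y\<bar> / c \<le> \<bar>y\<bar> / c" using c by (simp add: divide_right_mono)
    from IVT'[OF 1 2 this ct] show ?thesis by blast
  qed
  define \<theta> where "\<theta> y = (SOME x. time x = y)" for y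
  have inv: "time (\<theta> y) = y" for y unfolding \<theta>_def by (rule someI_ex[OF surj])
  have inv': "\<theta> (time x) = x" for x using inv[of "time x"] by (simp only: time_inject)
  have "(\<theta> has_real_derivative speed (\<theta> y)) (at y)" for y
  proof -
    have "isCont \<theta> (time (\<theta> y))"
      by (rule isCont_inverse_function[of 1]) (use inv' DERIV_isCont[OF time_deriv] in auto)
    then have "isCont \<theta> y" by (simp only: inv)
    from DERIV_inverse_function[OF time_deriv _ _ _ inv this, of "y - 1" "y + 1"] speed_pos[of "\<theta> y"]
    show ?thesis by simp
  qed
  then show ?thesis by (auto simp: anomaly_def)
qed

lemma \<Gamma>_eq_imp: "\<Gamma> x = \<Gamma> y \<Longrightarrow> x < y \<Longrightarrow> x + 2 * pi \<le> y"
proof -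
  assume h: "\<Gamma> x = \<Gamma> y" "x < y"
  have "U x = U y" "R x = R y" using h by (simp_all add: \<Gamma>_def)
  then have s: "sin x = sin y" using w e by (simp add: U_def)
  have "p / R x = p / R y" using \<open>R x = R y\<close> by simp
  then have c: "cos x = cos y" unfolding p_over_R using e by simp
  from s c obtain n :: int where n: "y = x + 2 * pi * of_int n" using sin_cos_eq_iff by (metis mult.commute)
  then have "2 * pi * of_int n > 0" using h by simp
  then have "n \<ge> 1" by (simp add: zero_less_mult_iff)
  then have "2 * pi * 1 \<le> 2 * pi * of_int n" by (intro mult_left_mono) auto
  then show ?thesis using n by simp
qed

lemma least_period_iff:
  assumes \<theta>: "anomaly \<theta>" shows "least_period (\<lambda>t. \<Gamma> (\<theta> t)) T \<longleftrightarrow> T = period"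
proof -
  have per: "\<Gamma> (\<theta> (t + period)) = \<Gamma> (\<theta> t)" for t
    by (simp add: anomaly_period[OF \<theta>] \<Gamma>_def periodic)
  have noret: "\<Gamma> (\<theta> (t + S)) \<noteq> \<Gamma> (\<theta> t)" if "0 < S" "S < period" for S t
  proof
    assume "\<Gamma> (\<theta> (t + S)) = \<Gamma> (\<theta> t)"
    then have "\<theta> t + 2 * pi \<le> \<theta> (t + S)" using \<Gamma>_eq_imp[of "\<theta> t" "\<theta> (t + S)"] anomaly_mono[OF \<theta>, of t "t + S"] that by simp
    moreover have "\<theta> (t + S) < \<theta> t + 2 * pi" using anomaly_mono[OF \<theta>, of "t + S" "t + period"] that by (simp add: anomaly_period[OF \<theta>])
    ultimately show False by simp
  qed
  show ?thesis
  proof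
    assume L: "least_period (\<lambda>t. \<Gamma> (\<theta> t)) T"
    show "T = period"
    proof (cases T period rule: linorder_cases)
      case less
      have "0 < T" "\<Gamma> (\<theta> (0 + T)) = \<Gamma> (\<theta> 0)" using L unfolding least_period_def by blast+
      then show ?thesis using noret[of T 0] less by blast
    next
      case greater
      then show ?thesis using L per period_pos by (auto simp: least_period_def)
    qed
  next
    assume "T = period"
    then show "least_period (\<lambda>t. \<Gamma> (\<theta> t)) T" using per noret period_pos by (auto simp: least_period_def)
  qed
qed

lemma anomaly_growth:
  assumes \<theta>: "anomaly \<theta>" shows "((\<lambda>t. \<theta> t / t) \<longlongrightarrow> 2 * pi / period) at_top"
proof (rule tendsto_linear_growth)
  fix t :: real assume t: "t \<ge> 0"
  define n where "n = nat \<lfloor>t / period\<rfloor>"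
  have rn: "real n = of_int \<lfloor>t / period\<rfloor>" using t period_pos by (simp add: n_def)
  have "real n \<le> t / period" "t / period < real n + 1" unfolding rn by linarith+
  then have n: "real n * period \<le> t" "t < (real n + 1) * period" using period_pos by (simp_all add: field_simps)
  have mult: "\<theta> (real k * period) = \<theta> 0 + 2 * pi * real k" for k
  proof (induction k)
    case (Suc k)
    have "\<theta> (real (Suc k) * period) = \<theta> (real k * period + period)" by (simp add: algebra_simps)
    also have "\<dots> = \<theta> (real k * period) + 2 * pi" by (rule anomaly_period[OF \<theta>])
    finally show ?case using Suc by (simp add: algebra_simps)
  qed simp
  have lo: "\<theta> 0 + 2 * pi * real n \<le> \<theta> t"
    using mult[of n] anomaly_mono[OF \<theta>, of "real n * period" t] n(1) by (cases "real n * period = t") auto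
  have hi: "\<theta> t \<le> \<theta> 0 + 2 * pi * (real n + 1)"
    using mult[of "Suc n"] anomaly_mono[OF \<theta>, of t "real (Suc n) * period"] n(2) by (simp add: add.commute)
  have "2 * pi * real n \<le> 2 * pi / period * t" "2 * pi / period * t \<le> 2 * pi * (real n + 1)"
  proof -
    have "2 * pi * real n * period \<le> 2 * pi * t" "2 * pi * t \<le> 2 * pi * (real n + 1) * period"
      using mult_left_mono[OF n(1), of "2 * pi"] mult_left_mono[OF less_imp_le[OF n(2)], of "2 * pi"] by (simp_all add: mult.assoc)
    then show "2 * pi * real n \<le> 2 * pi / period * t" "2 * pi / period * t \<le> 2 * pi * (real n + 1)"
      using period_pos by (simp_all add: pos_le_divide_eq pos_divide_le_eq)
  qed
  then show "\<bar>\<theta> t - 2 * pi / period * t\<bar> \<le> \<bar>\<theta> 0\<bar> + 2 * pi"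
    using lo hi by (simp add: distrib_left)
qed

text \<open>In the \<open>(p_z, z)\<close>-plane, read as complex numbers, \<open>X1\<close> is \<open>frame\<close> and \<open>X2\<close> is
  \<open>\<i>\<close> times \<open>frame\<close>; \<open>unstretch\<close> inverts the symplectic change of coordinates
  \<open>(p_z, z) \<mapsto> ((r p_z - p_r z) / w, z / r)\<close> up to a constant factor.\<close>

definition "frame x = Complex (e * cos x / (\<beta> * (R x)\<^sup>2)) (- U x)"
definition "unstretch x \<xi> = Complex (w * Re \<xi> / R x + U x * Im \<xi>) (R x * Im \<xi>)"
definition "lin x z = unstretch x (flow z x) / frame x"

text \<open>The frame stays within a right angle of \<open>cis (- x)\<close>, so it turns backwards
  once per revolution; this is the summand 1 in the rotation number.\<close>

lemma frame_cis_pos: "Re (frame x * cis x) > 0"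
proof -
  have "Re (frame x * cis x) = e / (\<beta> * (R x)\<^sup>2) * (cos x)\<^sup>2 + w * e / p * (sin x)\<^sup>2"
    by (simp add: frame_def U_def power2_eq_square)
  moreover have "a * (cos x)\<^sup>2 + b * (sin x)\<^sup>2 > 0" if "a > 0" "b > 0" for a b
  proof -
    have "0 < a * ((cos x)\<^sup>2 + b / a * (sin x)\<^sup>2)" using cos2_stretch_pos[of "b / a" x] that by simp
    then show ?thesis using that by (simp add: distrib_left)
  qed
  moreover have "e / (\<beta> * (R x)\<^sup>2) > 0" "w * e / p > 0" using \<beta> e w(1,4) R[of x] by simp_all
  ultimately show ?thesis by metis
qed

lemma frame_nonzero: "frame x \<noteq> 0" using frame_cis_pos[of x] by auto

lemma periodic_frame: "frame (x + 2 * pi) = frame x" "unstretch (x + 2 * pi) \<xi> = unstretch x \<xi>"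
  by (simp_all add: frame_def unstretch_def periodic)

lemma unstretch_inj: "unstretch x \<xi> = unstretch x \<eta> \<Longrightarrow> \<xi> = \<eta>"
  using R[of x] w(1) by (auto simp: unstretch_def complex_eq_iff)

text \<open>In real coordinates \<open>unstretch x\<close> is upper triangular with positive
  diagonal, so it has no eigenvalue below or at 0. Hence it turns a vector by less than
  \<open>pi\<close>, and a principal logarithm measures by how much.\<close>

lemma unstretch_nonneg_real:
  assumes \<xi>: "\<xi> \<noteq> 0" shows "unstretch x \<xi> / \<xi> \<notin> \<real>\<^sub>\<le>\<^sub>0"
proof
  assume "unstretch x \<xi> / \<xi> \<in> \<real>\<^sub>\<le>\<^sub>0"
  then obtain s where s: "unstretch x \<xi> / \<xi> = of_real s" "s \<le> 0" by (auto simp: nonpos_Reals_def)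
  then have "unstretch x \<xi> = of_real s * \<xi>" using \<xi> by (simp add: field_simps)
  then have 1: "w * Re \<xi> / R x + U x * Im \<xi> = s * Re \<xi>" and 2: "R x * Im \<xi> = s * Im \<xi>"
    by (simp_all add: unstretch_def complex_eq_iff)
  have "Im \<xi> = 0" using 2 R[of x] s(2) by auto
  moreover from this have "w / R x * Re \<xi> = s * Re \<xi>" using 1 by simp
  then have "Re \<xi> = 0" using R[of x] s(2) w(1) by (metis divide_pos_pos mult_right_cancel not_less)
  ultimately show False using \<xi> by (simp add: complex_eq_iff)
qed

section \<open>The transverse flow in the moving frame\<close>

lemma lin_linear: "lin x z = of_real (Re z) * lin x 1 + of_real (Im z) * lin x \<i>"
proof -
  have "unstretch x (flow z x) = of_real (Re z) * unstretch x (flow 1 x) + of_real (Im z) * unstretch x (flow \<i> x)"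
    unfolding flow_linear[of z x] by (simp add: unstretch_def complex_eq_iff add_divide_distrib algebra_simps)
  then show ?thesis by (simp add: lin_def add_divide_distrib)
qed

lemma lin_inj: "lin x z = lin x z' \<Longrightarrow> z = z'"
proof -
  assume "lin x z = lin x z'"
  then have "unstretch x (flow z x) = unstretch x (flow z' x)" using frame_nonzero[of x] by (simp add: lin_def)
  then have "flow z x = flow z' x" by (rule unstretch_inj)
  then have "flow (z - z') x = 0"
    unfolding flow_eq by (simp add: complex_eq_iff algebra_simps)
  then show "z = z'" using flow_nonzero[of "z - z'" x] by auto
qed

lemma lin_0 [simp]: "lin x 0 = 0" using lin_linear[of x 0] by simp

lemma lin_shift: "lin (x + 2 * pi) z = lin x (flow z (2 * pi))"
  by (simp add: lin_def periodic_frame flow_shift)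

lemma D_X_H: "\<exists>m. frechet_derivative (X_H \<alpha> w) (at (\<Gamma> x)) = (\<lambda>(a, b, c, d). (m * c, - ((1 / \<beta> + 7) / R x ^ 3) * d, a, b))"
  using X_H_derivative_planar[OF \<alpha>(1) R(1), of w "U x" x] by (simp only: \<Gamma>_def \<alpha>(3))

lemma frame_X1_X2:
  "a *\<^sub>R X1 \<alpha> w (\<Gamma> x) + b *\<^sub>R X2 \<alpha> w (\<Gamma> x) =
     (0, Re (Complex a b * frame x), 0, Im (Complex a b * frame x))"
proof -
  have "dV_dr \<alpha> w (R x) 0 = - (e * cos x / (\<beta> * (R x)\<^sup>2))"
    using dV_planar(1)[OF \<alpha>(1) R(1), of w x] force[of x] by (simp only: \<alpha>(2))
  then show ?thesis by (simp add: X1_def X2_def \<Gamma>_def dV_planar(2)[OF \<alpha>(1) R(1)] frame_def)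
qed

text \<open>Substituting \<open>z = R b\<close> with the anomaly as time, the part
  \<open>1 / \<beta>\<close> of the vertical attraction cancels against the Kepler attraction in the
  radial acceleration; the centrifugal part gives the 1 and the remaining 7 gives
  \<open>7 \<beta> / (1 + e cos)\<close> in the Hill coefficient.\<close>

lemma normal_solution:
  fixes z :: complex
  assumes \<theta>: "anomaly \<theta>"
  defines "Z \<equiv> \<lambda>t. unstretch (\<theta> t) (flow z (\<theta> t))"
  shows "((\<lambda>t. Im (Z t)) has_real_derivative Re (Z t)) (at t)"
    and "((\<lambda>t. Re (Z t)) has_real_derivative - ((1 / \<beta> + 7) / R (\<theta> t) ^ 3) * Im (Z t)) (at t)"
proof -
  define a b where "a t = Re (flow z (\<theta> t))" and "b t = Im (flow z (\<theta> t))" for t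
  note dR = R_anomaly[OF \<theta>] and dU = U_anomaly[OF \<theta>]
  have db: "(b has_real_derivative a t * speed (\<theta> t)) (at t)" for t
    unfolding a_def[abs_def] b_def[abs_def] by (rule DERIV_chain2[OF hill_solD(1)[OF hill_sol_flow] anomalyD[OF \<theta>]])
  have da: "(a has_real_derivative - ecc_q (7 * \<beta>) e (\<theta> t) * b t * speed (\<theta> t)) (at t)" for t
    unfolding a_def[abs_def] b_def[abs_def] by (rule DERIV_chain2[OF hill_solD(2)[OF hill_sol_flow] anomalyD[OF \<theta>]])
  have Z: "Im (Z t) = R (\<theta> t) * b t" "Re (Z t) = w * a t / R (\<theta> t) + U (\<theta> t) * b t" for t
    by (simp_all add: Z_def unstretch_def a_def b_def)
  have r: "R (\<theta> t) \<noteq> 0" by (rule R)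
  have "((\<lambda>t. R (\<theta> t) * b t) has_real_derivative U (\<theta> t) * b t + a t * speed (\<theta> t) * R (\<theta> t)) (at t)"
    by (rule DERIV_mult[OF dR db])
  moreover have "a t * speed (\<theta> t) * R (\<theta> t) = w * a t / R (\<theta> t)"
    using r by (simp add: speed_def power2_eq_square)
  ultimately show "((\<lambda>t. Im (Z t)) has_real_derivative Re (Z t)) (at t)" unfolding Z by (simp add: add.commute)
  let ?q = "ecc_q (7 * \<beta>) e (\<theta> t)"
  have "((\<lambda>t. w * a t / R (\<theta> t) + U (\<theta> t) * b t) has_real_derivative
     (w * (- ?q * b t * speed (\<theta> t)) * R (\<theta> t) - w * a t * U (\<theta> t)) / (R (\<theta> t) * R (\<theta> t))
     + (e * cos (\<theta> t) / (\<beta> * (R (\<theta> t))\<^sup>2) * b t + a t * speed (\<theta> t) * U (\<theta> t))) (at t)"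
    by (rule DERIV_add[OF DERIV_divide[OF DERIV_cmult[OF da] dR r] DERIV_mult[OF dU db]])
  moreover have "(w * (- ?q * b t * speed (\<theta> t)) * R (\<theta> t) - w * a t * U (\<theta> t)) / (R (\<theta> t) * R (\<theta> t))
     + (e * cos (\<theta> t) / (\<beta> * (R (\<theta> t))\<^sup>2) * b t + a t * speed (\<theta> t) * U (\<theta> t))
     = - ((1 / \<beta> + 7) / R (\<theta> t) ^ 3) * (R (\<theta> t) * b t)"
  proof -
    define r where "r = R (\<theta> t)"
    have r0: "r \<noteq> 0" using R by (simp add: r_def)
    have c: "e * cos (\<theta> t) = p / r - 1" using p_over_R[of "\<theta> t"] by (simp add: r_def)
    have q: "?q = 1 + 7 * \<beta> * r / p"
      using w(4) by (simp add: ecc_q_def r_def R_def)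
    have w2: "w * w = p / \<beta>" using w(3) by (simp add: power2_eq_square)
    have "(w * (- ?q * b t * speed (\<theta> t)) * r - w * a t * U (\<theta> t)) / (r * r) + (e * cos (\<theta> t) / (\<beta> * r\<^sup>2) * b t + a t * speed (\<theta> t) * U (\<theta> t))
       = b t * ((p / r - 1) / (\<beta> * r\<^sup>2) - (w * w) * ?q / r ^ 3)"
      unfolding c[symmetric] using r0 by (simp add: speed_def r_def[symmetric] field_simps power2_eq_square power3_eq_cube)
    also have "\<dots> = - ((1 / \<beta> + 7) / r ^ 3) * (r * b t)"
      unfolding w2 q using r0 w(4) \<beta> by (simp add: field_simps power2_eq_square power3_eq_cube)
    finally show ?thesis by (simp add: r_def)
  qed
  ultimately show "((\<lambda>t. Re (Z t)) has_real_derivative - ((1 / \<beta> + 7) / R (\<theta> t) ^ 3) * Im (Z t)) (at t)" unfolding Z by simp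
qed

text \<open>Inverts the change of coordinates: \<open>b = Q / R\<close> and the matching
  \<open>a\<close> solve the Hill equation with the anomaly as time.\<close>

lemma normal_solution_unique:
  assumes \<theta>: "anomaly \<theta>"
    and Q: "\<And>t. (Q has_real_derivative P t) (at t)"
    and P: "\<And>t. (P has_real_derivative - ((1 / \<beta> + 7) / R (\<theta> t) ^ 3) * Q t) (at t)"
  shows "\<exists>z. \<forall>t. Complex (P t) (Q t) = unstretch (\<theta> t) (flow z (\<theta> t))"
proof -
  note dR = R_anomaly[OF \<theta>] and dU = U_anomaly[OF \<theta>]
  define a b where "a t = (R (\<theta> t) * P t - U (\<theta> t) * Q t) / w" and "b t = Q t / R (\<theta> t)" for t
  have "\<exists>z. \<forall>t. Complex (a t) (b t) = flow z (\<theta> t)"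
  proof (rule flow_reparametrized)
    fix t
    define r where "r = R (\<theta> t)"
    have r0: "r \<noteq> 0" using R by (simp add: r_def)
    have c: "e * cos (\<theta> t) = p / r - 1" using p_over_R[of "\<theta> t"] by (simp add: r_def)
    have q: "ecc_q (7 * \<beta>) e (\<theta> t) = 1 + 7 * \<beta> * r / p"
      using w(4) by (simp add: ecc_q_def r_def R_def)
    have w2: "w * w = p / \<beta>" using w(3) by (simp add: power2_eq_square)
    show "(\<theta> has_real_derivative speed (\<theta> t)) (at t)" by (rule anomalyD[OF \<theta>])
    have "(b has_real_derivative (P t * R (\<theta> t) - Q t * U (\<theta> t)) / (R (\<theta> t) * R (\<theta> t))) (at t)"
      unfolding b_def[abs_def] by (rule DERIV_divide[OF Q dR R(2)])
    moreover have "(P t * R (\<theta> t) - Q t * U (\<theta> t)) / (R (\<theta> t) * R (\<theta> t)) = speed (\<theta> t) * a t"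
      using w(1) by (simp add: speed_def a_def power2_eq_square mult.commute)
    ultimately show "(b has_real_derivative speed (\<theta> t) * a t) (at t)" by simp
    have "(a has_real_derivative (U (\<theta> t) * P t + (- ((1 / \<beta> + 7) / R (\<theta> t) ^ 3) * Q t) * R (\<theta> t)
       - (e * cos (\<theta> t) / (\<beta> * (R (\<theta> t))\<^sup>2) * Q t + P t * U (\<theta> t))) / w) (at t)"
      unfolding a_def[abs_def] by (rule DERIV_cdivide[OF DERIV_diff[OF DERIV_mult[OF dR P] DERIV_mult[OF dU Q]]])
    moreover have "(U (\<theta> t) * P t + (- ((1 / \<beta> + 7) / R (\<theta> t) ^ 3) * Q t) * R (\<theta> t)
       - (e * cos (\<theta> t) / (\<beta> * (R (\<theta> t))\<^sup>2) * Q t + P t * U (\<theta> t))) / w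
      = - (speed (\<theta> t) * ecc_q (7 * \<beta>) e (\<theta> t) * b t)"
    proof -
      have "(U (\<theta> t) * P t + (- ((1 / \<beta> + 7) / r ^ 3) * Q t) * r - (e * cos (\<theta> t) / (\<beta> * r\<^sup>2) * Q t + P t * U (\<theta> t))) / w
        = - Q t * (w * w) * (7 * \<beta> / p + 1 / r) / (r\<^sup>2 * w)"
        unfolding c w2 using r0 w(1,4) \<beta> by (simp add: field_simps power2_eq_square power3_eq_cube)
      also have "\<dots> = - (speed (\<theta> t) * ecc_q (7 * \<beta>) e (\<theta> t) * b t)"
        unfolding q speed_def b_def r_def[symmetric] using r0 w(1,4) by (simp add: field_simps power2_eq_square)
      finally show ?thesis by (simp only: r_def)
    qed
    ultimately show "(a has_real_derivative - (speed (\<theta> t) * ecc_q (7 * \<beta>) e (\<theta> t) * b t)) (at t)" by simp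
  qed
  then obtain z where z: "\<And>t. Complex (a t) (b t) = flow z (\<theta> t)" by blast
  have "Complex (P t) (Q t) = unstretch (\<theta> t) (flow z (\<theta> t))" for t
    unfolding z[of t, symmetric] unstretch_def using R[of "\<theta> t"] w(1)
    by (simp add: a_def b_def complex_eq_iff) (simp add: field_simps)
  then show ?thesis by blast
qed

text \<open>The Hamiltonian field has no \<open>(p_z, z)\<close> component on the orbit, whereas the
  frame spans exactly that plane. Comparing these components removes the quotient and determines the
  coordinates in the frame.\<close>

lemma transverse_flow_imp:
  assumes \<theta>: "anomaly \<theta>" and \<Psi>: "transverse_flow \<alpha> w (\<lambda>t. \<Gamma> (\<theta> t)) \<Psi>"
  shows "\<exists>z. \<forall>t. vec_complex (\<Psi> t *v v) = lin (\<theta> t) z"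
proof -
  obtain Y where Y: "variational_solution \<alpha> w (\<lambda>t. \<Gamma> (\<theta> t)) Y"
    and span: "\<And>t. Y t - ((\<Psi> t *v v) $ 1 *\<^sub>R X1 \<alpha> w (\<Gamma> (\<theta> t)) + (\<Psi> t *v v) $ 2 *\<^sub>R X2 \<alpha> w (\<Gamma> (\<theta> t)))
               \<in> span {X_H \<alpha> w (\<Gamma> (\<theta> t))}"
    using \<Psi> unfolding transverse_flow_def by blast
  define A P B Q where "A t = fst (Y t)" and "P t = fst (snd (Y t))" and "B t = fst (snd (snd (Y t)))" and "Q t = snd (snd (snd (Y t)))" for t
  have YE: "Y = (\<lambda>t. (A t, P t, B t, Q t))" by (simp add: A_def P_def B_def Q_def)
  have "(P has_real_derivative - ((1 / \<beta> + 7) / R (\<theta> t) ^ 3) * Q t) (at t) \<and> (Q has_real_derivative P t) (at t)" for t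
  proof -
    obtain m where m: "frechet_derivative (X_H \<alpha> w) (at (\<Gamma> (\<theta> t))) = (\<lambda>(a, b, c, d). (m * c, - ((1 / \<beta> + 7) / R (\<theta> t) ^ 3) * d, a, b))"
      using D_X_H by blast
    have "((\<lambda>t. (A t, P t, B t, Q t)) has_vector_derivative (m * B t, - ((1 / \<beta> + 7) / R (\<theta> t) ^ 3) * Q t, A t, P t)) (at t)"
      using Y m unfolding variational_solution_def YE by (metis (no_types, lifting) case_prod_conv)
    then show ?thesis by (simp add: has_vector_derivative_phase has_real_derivative_iff_has_vector_derivative)
  qed
  then obtain z where z: "\<And>t. Complex (P t) (Q t) = unstretch (\<theta> t) (flow z (\<theta> t))"
    using normal_solution_unique[OF \<theta>, of Q P] by blast
  have "vec_complex (\<Psi> t *v v) = lin (\<theta> t) z" for t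
  proof -
    let ?u = "Complex ((\<Psi> t *v v) $ 1) ((\<Psi> t *v v) $ 2) * frame (\<theta> t)"
    obtain k where "(A t, P t, B t, Q t) - (0, Re ?u, 0, Im ?u) = k *\<^sub>R (e * cos (\<theta> t) / (\<beta> * (R (\<theta> t))\<^sup>2), 0, U (\<theta> t), 0)"
      using span[of t] unfolding frame_X1_X2 X_H_\<Gamma> span_singleton YE by blast
    then have "P t = Re ?u" "Q t = Im ?u" by simp_all
    then have "?u = Complex (P t) (Q t)" by (simp add: complex_eq_iff)
    then have "vec_complex (\<Psi> t *v v) * frame (\<theta> t) = unstretch (\<theta> t) (flow z (\<theta> t))"
      unfolding z by (simp add: vec_complex_def)
    then show ?thesis using frame_nonzero[of "\<theta> t"] by (simp add: lin_def field_simps)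
  qed
  then show ?thesis by blast
qed

lemma lin_matrix:
  "vec_complex (cmat (lin x) *v v) = lin x (vec_complex v)" "invertible (cmat (lin x))"
proof -
  show w: "vec_complex (cmat (lin x) *v v) = lin x (vec_complex v)" for v by (rule cmat_works[OF lin_linear])
  have "v = 0" if "cmat (lin x) *v v = 0" for v
  proof -
    have "lin x (vec_complex v) = lin x 0" unfolding w[symmetric] that by simp
    from lin_inj[OF this] show ?thesis by simp
  qed
  then show "invertible (cmat (lin x))" by (simp add: invertible_left_inverse matrix_left_invertible_ker)
qed

lemma transverse_flow_exists:
  assumes \<theta>: "anomaly \<theta>"
  shows "\<exists>\<Psi>. transverse_flow \<alpha> w (\<lambda>t. \<Gamma> (\<theta> t)) \<Psi>"
proof -
  \<comment> \<open>Normalises the value at time 0 to the identity, whatever the initial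
    anomaly.\<close>
  obtain N where N: "cmat (lin (\<theta> 0)) ** N = mat 1" using lin_matrix(2)[of "\<theta> 0"] by (auto simp: invertible_def)
  define \<Psi> where "\<Psi> t = cmat (lin (\<theta> t)) ** N" for t
  have lin: "vec_complex (\<Psi> t *v v) = lin (\<theta> t) (vec_complex (N *v v))" for t v
    by (simp add: \<Psi>_def matrix_vector_mul_assoc[symmetric] lin_matrix)
  have "\<exists>Y. variational_solution \<alpha> w (\<lambda>t. \<Gamma> (\<theta> t)) Y \<and>
        (\<forall>t. Y t - ((\<Psi> t *v v) $ 1 *\<^sub>R X1 \<alpha> w (\<Gamma> (\<theta> t)) + (\<Psi> t *v v) $ 2 *\<^sub>R X2 \<alpha> w (\<Gamma> (\<theta> t)))
               \<in> span {X_H \<alpha> w (\<Gamma> (\<theta> t))})" for v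
  proof -
    let ?z = "vec_complex (N *v v)"
    define Z where "Z t = unstretch (\<theta> t) (flow ?z (\<theta> t))" for t
    define Y :: "real \<Rightarrow> phase" where "Y t = (0, Re (Z t), 0, Im (Z t))" for t
    have "variational_solution \<alpha> w (\<lambda>t. \<Gamma> (\<theta> t)) Y"
      unfolding variational_solution_def
    proof
      fix t
      obtain m where m: "frechet_derivative (X_H \<alpha> w) (at (\<Gamma> (\<theta> t))) = (\<lambda>(a, b, c, d). (m * c, - ((1 / \<beta> + 7) / R (\<theta> t) ^ 3) * d, a, b))"
        using D_X_H by blast
      show "(Y has_vector_derivative frechet_derivative (X_H \<alpha> w) (at (\<Gamma> (\<theta> t))) (Y t)) (at t)"
        unfolding m Y_def[abs_def] using normal_solution[OF \<theta>, of ?z t, folded Z_def]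
        by (simp add: has_vector_derivative_phase has_real_derivative_iff_has_vector_derivative)
    qed
    moreover have "Y t - ((\<Psi> t *v v) $ 1 *\<^sub>R X1 \<alpha> w (\<Gamma> (\<theta> t)) + (\<Psi> t *v v) $ 2 *\<^sub>R X2 \<alpha> w (\<Gamma> (\<theta> t))) = 0" for t
    proof -
      have "Complex ((\<Psi> t *v v) $ 1) ((\<Psi> t *v v) $ 2) * frame (\<theta> t) = Z t"
        using lin[of t v] frame_nonzero[of "\<theta> t"] by (simp add: lin_def Z_def vec_complex_def)
      then show ?thesis unfolding frame_X1_X2 by (simp add: Y_def)
    qed
    ultimately show ?thesis by (intro exI[of _ Y]) (simp add: span_zero)
  qed
  moreover have "\<Psi> 0 = mat 1" by (simp add: \<Psi>_def N)
  ultimately show ?thesis unfolding transverse_flow_def by blast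
qed

text \<open>The argument of \<open>lin x z\<close> is the Hill angle plus \<open>x\<close> plus the
  principal arguments coming from \<open>f\<close> and \<open>g\<close>, which remain bounded
  because both avoid the negative axis. Dividing by \<open>x\<close> leaves \<open>rot + 1\<close>,
  and the mean speed of the anomaly converts this into a rate in time.\<close>

lemma transverse_rotation:
  assumes \<theta>: "anomaly \<theta>" and \<Psi>: "transverse_flow \<alpha> w (\<lambda>t. \<Gamma> (\<theta> t)) \<Psi>"
  shows "has_rotation_rate \<Psi> ((rot + 1) * (2 * pi / period))"
  unfolding has_rotation_rate_def
proof (intro allI impI)
  fix v :: "real ^ 2" assume v: "v \<noteq> 0"
  obtain z where z: "\<And>t. vec_complex (\<Psi> t *v v) = lin (\<theta> t) z" using transverse_flow_imp[OF \<theta> \<Psi>] by blast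
  have z0: "z \<noteq> 0"
  proof
    assume "z = 0"
    then have "vec_complex (\<Psi> 0 *v v) = 0" unfolding z by simp
    then show False using \<Psi> v by (simp add: transverse_flow_def)
  qed
  define f where "f x = unstretch x (flow z x) / flow z x" for x
  define g where "g x = frame x * cis x" for x
  have ne: "flow z x \<noteq> 0" for x by (rule flow_nonzero[OF z0])
  have fn: "f x \<notin> \<real>\<^sub>\<le>\<^sub>0" for x unfolding f_def by (rule unstretch_nonneg_real[OF ne])
  have gn: "g x \<notin> \<real>\<^sub>\<le>\<^sub>0" for x using frame_cis_pos[of x] by (auto simp: g_def complex_nonpos_Reals_iff)
  have f0: "f x \<noteq> 0" and g0: "g x \<noteq> 0" for x using fn[of x] gn[of x] by auto
  define h where "h x = Arg z + angle z x + Im (Ln (f x)) + x - Im (Ln (g x))" for x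
  have polar: "u = of_real (cmod u) * cis (Im (Ln u))" if "u \<noteq> 0" for u
  proof -
    have "u = exp (Ln u)" using that by simp
    also have "\<dots> = of_real (exp (Re (Ln u))) * cis (Im (Ln u))" by (rule exp_eq_polar)
    also have "exp (Re (Ln u)) = cmod u" using that by simp
    finally show ?thesis .
  qed
  have arg: "lin x z = of_real (cmod (lin x z)) * cis (h x)" for x
  proof -
    have lz: "lin x z = flow z x * f x * cis x / g x"
      using ne[of x] frame_nonzero[of x] by (simp add: lin_def f_def g_def)
    have "lin x z = (of_real (cmod (flow z x)) * cis (Arg z + angle z x)) * (of_real (cmod (f x)) * cis (Im (Ln (f x)))) * cis x /
        (of_real (cmod (g x)) * cis (Im (Ln (g x))))"
      unfolding lz by (simp only: flow_polar[OF z0, symmetric] polar[OF f0, symmetric] polar[OF g0, symmetric])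
    also have "\<dots> = of_real (cmod (flow z x) * cmod (f x) / cmod (g x)) * (cis (Arg z + angle z x) * cis (Im (Ln (f x))) * cis x / cis (Im (Ln (g x))))"
      by simp
    also have "cis (Arg z + angle z x) * cis (Im (Ln (f x))) * cis x / cis (Im (Ln (g x))) = cis (h x)"
      by (simp only: cis_mult cis_divide h_def)
    also have "cmod (flow z x) * cmod (f x) / cmod (g x) = cmod (lin x z)"
      unfolding lz by (simp add: norm_mult norm_divide)
    finally show ?thesis .
  qed
  have c\<theta>: "continuous_on A \<theta>" for A using anomalyD[OF \<theta>] by (rule DERIV_continuous_on)
  have cf: "continuous_on UNIV f" unfolding f_def[abs_def] unstretch_def Complex_eq
    by (intro continuous_on_divide continuous_on_add continuous_on_mult continuous_on_of_real continuous_on_const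
        continuous_on_Re continuous_on_Im continuous_on_R continuous_on_U continuous_on_flow ballI ne R(2))
  have cg: "continuous_on UNIV g" unfolding g_def[abs_def] frame_def Complex_eq
    by (intro continuous_on_divide continuous_on_add continuous_on_mult continuous_on_of_real continuous_on_const
        continuous_on_minus continuous_on_power continuous_on_cos continuous_on_cis continuous_on_id
        continuous_on_R continuous_on_U ballI) (use R \<beta> in simp)
  have ch: "continuous_on UNIV h" unfolding h_def[abs_def]
    by (intro continuous_on_add continuous_on_diff continuous_on_const continuous_on_id continuous_on_Im
        continuous_on_Ln' continuous_on_angle z0 cf cg fn gn)
  have "continuous_argument (\<lambda>t. vec_complex (\<Psi> t *v v)) (\<lambda>t. h (\<theta> t))"
    unfolding continuous_argument_def z
  proof (intro conjI allI impI)
    show "continuous_on {0..} (\<lambda>t. h (\<theta> t))" by (rule continuous_on_compose2[OF ch c\<theta>]) simp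
    fix t :: real
    show "lin (\<theta> t) z \<noteq> 0" using lin_inj[of "\<theta> t" z 0] z0 by auto
    show "lin (\<theta> t) z = of_real (cmod (lin (\<theta> t) z)) * cis (h (\<theta> t))" by (rule arg)
  qed
  moreover have "((\<lambda>t. h (\<theta> t) / t) \<longlongrightarrow> (rot + 1) * (2 * pi / period)) at_top"
  proof -
    have grow: "((\<lambda>t. \<theta> t / t) \<longlongrightarrow> 2 * pi / period) at_top" by (rule anomaly_growth[OF \<theta>])
    have top: "filterlim \<theta> at_top at_top"
    proof -
      have lim: "filterlim (\<lambda>t. \<theta> t / t * t) at_top at_top"
        by (rule filterlim_tendsto_pos_mult_at_top[OF grow _ filterlim_ident]) (use period_pos in simp)
      have ev: "\<forall>\<^sub>F t in at_top. \<theta> t / t * t = \<theta> t"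
        using eventually_gt_at_top[of 0] by eventually_elim simp
      show ?thesis by (rule filterlim_cong[OF refl refl ev, THEN iffD1, OF lim])
    qed
    have "((\<lambda>x. (h x - (angle z x + x)) / x) \<longlongrightarrow> 0) at_top"
    proof (rule Lim_null_comparison)
      show "\<forall>\<^sub>F x in at_top. norm ((h x - (angle z x + x)) / x) \<le> (3 * pi) / x"
        using eventually_gt_at_top[of 0]
      proof eventually_elim
        case (elim x)
        have "\<bar>Arg z\<bar> \<le> pi" using Arg_bounded[of z] by auto
        moreover have "\<bar>Im (Ln (f x))\<bar> \<le> pi" "\<bar>Im (Ln (g x))\<bar> \<le> pi"
          using mpi_less_Im_Ln[OF f0, of x] Im_Ln_le_pi[OF f0, of x] mpi_less_Im_Ln[OF g0, of x] Im_Ln_le_pi[OF g0, of x] by auto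
        ultimately have "\<bar>h x - (angle z x + x)\<bar> \<le> 3 * pi" unfolding h_def by linarith
        then show ?case using elim by (simp add: divide_right_mono)
      qed
      show "((\<lambda>x::real. (3 * pi) / x) \<longlongrightarrow> 0) at_top"
        by (rule tendsto_divide_0[OF tendsto_const filterlim_at_top_imp_at_infinity[OF filterlim_ident]])
    qed
    from tendsto_add[OF tendsto_add[OF this rot_tendsto[OF z0]] tendsto_const[of 1]]
    have "((\<lambda>x. (h x - (angle z x + x)) / x + angle z x / x + 1) \<longlongrightarrow> rot + 1) at_top" by simp
    moreover have "\<forall>\<^sub>F x in at_top. (h x - (angle z x + x)) / x + angle z x / x + 1 = h x / x"
      using eventually_gt_at_top[of 0] by eventually_elim (simp add: field_simps)
    ultimately have "((\<lambda>x. h x / x) \<longlongrightarrow> rot + 1) at_top" by (rule Lim_transform_eventually)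
    from tendsto_mult[OF filterlim_compose[OF this top] grow]
    have "((\<lambda>t. h (\<theta> t) / \<theta> t * (\<theta> t / t)) \<longlongrightarrow> (rot + 1) * (2 * pi / period)) at_top" .
    moreover have "\<forall>\<^sub>F t in at_top. h (\<theta> t) / \<theta> t * (\<theta> t / t) = h (\<theta> t) / t"
      using filterlim_at_top_dense[THEN iffD1, OF top, rule_format, of 0] by eventually_elim simp
    ultimately show ?thesis by (rule Lim_transform_eventually)
  qed
  ultimately show "\<exists>\<eta>. continuous_argument (\<lambda>t. vec_complex (\<Psi> t *v v)) \<eta> \<and> ((\<lambda>t. \<eta> t / t) \<longlongrightarrow> (rot + 1) * (2 * pi / period)) at_top"
    by blast
qed

text \<open>The return map is conjugate to the Hill monodromy by \<open>lin\<close> at the initial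
  anomaly, so trace and determinant agree.\<close>

lemma transverse_monodromy:
  assumes \<theta>: "anomaly \<theta>" and \<Psi>: "transverse_flow \<alpha> w (\<lambda>t. \<Gamma> (\<theta> t)) \<Psi>"
  shows "hyperbolic_matrix (\<Psi> period) \<longleftrightarrow> hyperbolic_matrix monodromy_matrix"
proof -
  let ?N = "cmat (lin (\<theta> 0))"
  have "\<Psi> period ** ?N = ?N ** monodromy_matrix"
  proof -
    have "vec_complex (\<Psi> period *v (?N *v u)) = vec_complex (?N *v (monodromy_matrix *v u))" for u
    proof -
      obtain z where z: "\<And>t. vec_complex (\<Psi> t *v (?N *v u)) = lin (\<theta> t) z" using transverse_flow_imp[OF \<theta> \<Psi>] by blast
      have "lin (\<theta> 0) (vec_complex u) = lin (\<theta> 0) z" using z[of 0] \<Psi> by (simp add: transverse_flow_def lin_matrix)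
      then have "vec_complex u = z" by (rule lin_inj)
      then show ?thesis using z[of period] anomaly_period[OF \<theta>, of 0] by (simp add: lin_matrix lin_shift monodromy_matrix)
    qed
    then show ?thesis by (simp add: vec_complex_inject matrix_eq matrix_vector_mul_assoc)
  qed
  then have s: "?N ** monodromy_matrix = \<Psi> period ** ?N" by simp
  have N: "det ?N \<noteq> 0" using lin_matrix(2) by (simp add: invertible_det_nz)
  have "det (\<Psi> period) = 1" using similar_matrices(2)[OF s N] det_monodromy by simp
  then show ?thesis
    using similar_matrices(1)[OF s N] by (simp add: hyperbolic_matrix_iff det_monodromy)
qed

lemma rotation_number: "orbit_rotation_number \<alpha> w = 1 + rot"
  unfolding orbit_rotation_number_def
proof (rule the_equality)
  obtain \<theta> where \<theta>: "anomaly \<theta>" using anomaly_exists by blast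
  obtain \<Psi> where \<Psi>: "transverse_flow \<alpha> w (\<lambda>t. \<Gamma> (\<theta> t)) \<Psi>" using transverse_flow_exists[OF \<theta>] by blast
  have "1 + rot = period * ((rot + 1) * (2 * pi / period) / (2 * pi))" using period_pos by simp
  then show "\<exists>\<gamma> T \<Psi> c. euler_solution \<alpha> w \<gamma> \<and> least_period \<gamma> T \<and> transverse_flow \<alpha> w \<gamma> \<Psi> \<and>
      has_rotation_rate \<Psi> c \<and> 1 + rot = T * (c / (2 * pi))"
    using euler_solution_anomaly[OF \<theta>] least_period_iff[OF \<theta>] \<Psi> transverse_rotation[OF \<theta> \<Psi>] by blast
next
  fix \<rho> assume "\<exists>\<gamma> T \<Psi> c. euler_solution \<alpha> w \<gamma> \<and> least_period \<gamma> T \<and> transverse_flow \<alpha> w \<gamma> \<Psi> \<and>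
      has_rotation_rate \<Psi> c \<and> \<rho> = T * (c / (2 * pi))"
  then obtain \<gamma> T \<Psi> c where h: "euler_solution \<alpha> w \<gamma>" "least_period \<gamma> T" "transverse_flow \<alpha> w \<gamma> \<Psi>" "has_rotation_rate \<Psi> c" "\<rho> = T * (c / (2 * pi))"
    by blast
  obtain \<theta> where \<theta>: "anomaly \<theta>" "\<gamma> = (\<lambda>t. \<Gamma> (\<theta> t))" using anomaly_of_euler_solution[OF h(1)] by blast
  have T: "T = period" using h(2) least_period_iff[OF \<theta>(1)] \<theta>(2) by simp
  have "c = (rot + 1) * (2 * pi / period)"
    using rotation_rate_unique[OF h(4) transverse_rotation[OF \<theta>(1)]] h(3) \<theta>(2) by simp
  then show "\<rho> = 1 + rot" using h(5) T period_pos by simp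
qed

lemma hyperbolic: "orbit_hyperbolic \<alpha> w \<longleftrightarrow> hyperbolic_matrix monodromy_matrix"
proof
  assume "orbit_hyperbolic \<alpha> w"
  then obtain \<gamma> T \<Psi> where h: "euler_solution \<alpha> w \<gamma>" "least_period \<gamma> T" "transverse_flow \<alpha> w \<gamma> \<Psi>" "hyperbolic_matrix (\<Psi> T)"
    unfolding orbit_hyperbolic_def by blast
  obtain \<theta> where \<theta>: "anomaly \<theta>" "\<gamma> = (\<lambda>t. \<Gamma> (\<theta> t))" using anomaly_of_euler_solution[OF h(1)] by blast
  have T: "T = period" using h(2) least_period_iff[OF \<theta>(1)] \<theta>(2) by simp
  show "hyperbolic_matrix monodromy_matrix" using transverse_monodromy[OF \<theta>(1)] h(3,4) \<theta>(2) T by simp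
next
  assume M: "hyperbolic_matrix monodromy_matrix"
  obtain \<theta> where \<theta>: "anomaly \<theta>" using anomaly_exists by blast
  obtain \<Psi> where \<Psi>: "transverse_flow \<alpha> w (\<lambda>t. \<Gamma> (\<theta> t)) \<Psi>" using transverse_flow_exists[OF \<theta>] by blast
  show "orbit_hyperbolic \<alpha> w"
    unfolding orbit_hyperbolic_def
    using euler_solution_anomaly[OF \<theta>] least_period_iff[OF \<theta>] \<Psi> transverse_monodromy[OF \<theta> \<Psi>] M by blast
qed

end

section \<open>Rotation number and hyperbolicity in the parameter domain\<close>

lemma euler_orbit_linear:
  assumes \<beta>: "0 < \<beta>" "\<beta> < 1" and e: "0 \<le> e" "e < 1"
  shows "rho_e \<beta> e = 1 + hill.rot (ecc_q (7 * \<beta>) e)"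
    and "euler_hyperbolic \<beta> e \<longleftrightarrow> y1pi (7 * \<beta>) e * v2pi (7 * \<beta>) e < 0"
proof -
  have h: "hyperbolic_matrix (hill.monodromy_matrix (ecc_q (7 * \<beta>) e)) \<longleftrightarrow> y1pi (7 * \<beta>) e * v2pi (7 * \<beta>) e < 0"
    by (rule hyperbolic_monodromy) (use \<beta> e in auto)
  have "rho_e \<beta> e = 1 + hill.rot (ecc_q (7 * \<beta>) e) \<and>
    (euler_hyperbolic \<beta> e \<longleftrightarrow> hyperbolic_matrix (hill.monodromy_matrix (ecc_q (7 * \<beta>) e)))"
  proof (cases "e = 0")
    case True
    then show ?thesis using lin_system[of e \<beta>] by (simp add: rho_e_def euler_hyperbolic_def)
  next
    case False
    interpret kepler \<beta> e by unfold_locales (use \<beta> e False in auto)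
    show ?thesis using rotation_number hyperbolic False
      by (simp add: rho_e_def euler_hyperbolic_def \<alpha>_def w_def)
  qed
  then show "rho_e \<beta> e = 1 + hill.rot (ecc_q (7 * \<beta>) e)"
    "euler_hyperbolic \<beta> e \<longleftrightarrow> y1pi (7 * \<beta>) e * v2pi (7 * \<beta>) e < 0"
    using h by simp_all
qed

text \<open>Encoded by conditions that are visibly open, with the angle window in place of a
  condition on the rotation number.\<close>

definition gap :: "nat \<Rightarrow> (real \<times> real) set" where
  "gap m = {(\<beta>, e). \<beta> \<in> {0<..<1} \<and> e \<in> {0<..<1} \<and> y1pi (7 * \<beta>) e * v2pi (7 * \<beta>) e < 0 \<and>
     hill_angle (ecc_q (7 * \<beta>) e) 1 (2 * pi) \<in> {2 * real m * pi<..<(2 * real m + 2) * pi}}"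

lemma open_gap: "open (gap m)"
proof -
  let ?S = "{0<..<1} \<times> {0<..<1} :: (real \<times> real) set"
  let ?f = "\<lambda>p. (y1pi (7 * fst p) (snd p) * v2pi (7 * fst p) (snd p), hill_angle (ecc_q (7 * fst p) (snd p)) 1 (2 * pi))"
  have e: "\<bar>snd p\<bar> < 1" if "p \<in> ?S" for p using that by auto
  have "continuous_on ?S (\<lambda>p. hill_angle (ecc_q (fst (7 * fst p, snd p)) (snd (7 * fst p, snd p))) 1 (2 * pi))"
    by (rule continuous_on_compose2[OF continuous_on_hill_angle_ecc[of 1 "2 * pi"], of ?S "\<lambda>p. (7 * fst p, snd p)"])
       (auto intro!: continuous_intros)
  then have "continuous_on ?S ?f"
    by (intro continuous_on_Pair continuous_on_mult continuous_on_pi continuous_on_fst continuous_on_snd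
        continuous_on_id continuous_on_const e) simp_all
  moreover have "open ?S" by (intro open_Times) auto
  moreover have "open ({..<0 :: real} \<times> {2 * real m * pi<..<(2 * real m + 2) * pi})" by (intro open_Times) auto
  ultimately have "open (?S \<inter> ?f -` ({..<0} \<times> {2 * real m * pi<..<(2 * real m + 2) * pi}))"
    by (rule continuous_open_preimage)
  also have "?S \<inter> ?f -` ({..<0} \<times> {2 * real m * pi<..<(2 * real m + 2) * pi}) = gap m"
    by (auto simp: gap_def)
  finally show ?thesis .
qed

lemma gap_subset: "gap m \<subseteq> hyperbolic_locus (real m + 3 / 2)"
proof
  fix x assume "x \<in> gap m"
  then obtain \<beta> e where x: "x = (\<beta>, e)" and b: "0 < \<beta>" "\<beta> < 1" "0 < e" "e < 1"
    and neg: "y1pi (7 * \<beta>) e * v2pi (7 * \<beta>) e < 0"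
    and a: "2 * real m * pi < hill_angle (ecc_q (7 * \<beta>) e) 1 (2 * pi)" "hill_angle (ecc_q (7 * \<beta>) e) 1 (2 * pi) < (2 * real m + 2) * pi"
    by (auto simp: gap_def)
  have e': "\<bar>e\<bar> < 1" using b by simp
  obtain j :: int where j: "hill.rot (ecc_q (7 * \<beta>) e) = of_int j + 1 / 2"
    "\<bar>hill_angle (ecc_q (7 * \<beta>) e) 1 (2 * pi) - pi * of_int (2 * j + 1)\<bar> < pi"
    using hill.rot_half_integer[OF hill_ecc_q[OF e'], of "7 * \<beta>"] neg by (auto simp: hill_pi_eq[OF e'])
  have "pi * (2 * real m) < pi * (2 * of_int j + 2)" "pi * (2 * of_int j) < pi * (2 * real m + 2)"
    using a j(2) by (simp_all add: abs_less_iff algebra_simps)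
  then have "2 * real m < 2 * of_int j + 2" "2 * of_int j < 2 * real m + 2"
    by (simp_all only: mult_less_cancel_left_pos pi_gt_zero)
  \<comment> \<open>The angle is within \<open>pi\<close> of \<open>(2 j + 1) pi\<close> and
    strictly between \<open>2 m pi\<close> and \<open>(2 m + 2) pi\<close>, which leaves only
    \<open>j = m\<close>; then \<open>1 + m + 1/2\<close> is \<open>m + 3/2\<close>.\<close>
  then have "j = int m" by linarith
  then show "x \<in> hyperbolic_locus (real m + 3 / 2)"
    using euler_orbit_linear[of \<beta> e] b neg j(1) by (simp add: x hyperbolic_locus_def)
qed

lemma gap_nonempty: "m \<ge> 1 \<Longrightarrow> gap m \<noteq> {}"
proof -
  assume "m \<ge> 1"
  from gap_exists_all[OF this] obtain k e where "0 < e" "e < 1" "0 < k" "k < 64 / 10" "y1pi k e * v2pi k e < 0"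
    "2 * real m * pi < hill_angle (ecc_q k e) 1 (2 * pi)" "hill_angle (ecc_q k e) 1 (2 * pi) < (2 * real m + 2) * pi" by blast
  then have "(k / 7, e) \<in> gap m" by (simp add: gap_def)
  then show ?thesis by blast
qed

lemma open_D_dom: "open D_dom"
proof -
  have "D_dom = {p. 0 < (fst p)\<^sup>2 + (snd p)\<^sup>2} \<inter> {p. (fst p)\<^sup>2 + (snd p)\<^sup>2 < 1} \<inter> {p. 0 < fst p} \<inter> {p. 0 < snd p}"
    by (auto simp: D_dom_def)
  also have "open \<dots>" by (intro open_Int open_Collect_less continuous_intros)
  finally show ?thesis .
qed

lemma D_domD:
  assumes "(\<beta>, e) \<in> D_dom" shows "0 < \<beta>" "\<beta> < 1" "0 < e" "e < 1"
proof -
  have h: "0 < \<beta>" "0 < e" "\<beta>\<^sup>2 + e\<^sup>2 < 1" using assms by (auto simp: D_dom_def)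
  then have "\<beta>\<^sup>2 < 1\<^sup>2" "e\<^sup>2 < 1\<^sup>2" using zero_le_power2[of \<beta>] zero_le_power2[of e] by (simp_all, linarith+)
  then show "0 < \<beta>" "\<beta> < 1" "0 < e" "e < 1" using h power_less_imp_less_base[of _ 2 1] by auto
qed

lemma gap_D_nonempty:
  assumes "m = 1 \<or> m = 2" shows "gap m \<inter> D_dom \<noteq> {}"
proof -
  from gap_exists_small[OF assms] obtain k where k: "0 < k" "k < 64 / 10" "y1pi k (1 / 10) * v2pi k (1 / 10) < 0"
    "2 * real m * pi < hill_angle (ecc_q k (1 / 10)) 1 (2 * pi)" "hill_angle (ecc_q k (1 / 10)) 1 (2 * pi) < (2 * real m + 2) * pi" by blast
  have "(k / 7)\<^sup>2 \<le> (64 / 70)\<^sup>2" using k by (intro power_mono) auto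
  then have "(k / 7)\<^sup>2 + (1 / 10)\<^sup>2 < 1" by (simp add: power2_eq_square)
  then have "(k / 7, 1 / 10) \<in> D_dom" using k by (simp add: D_dom_def add_pos_pos)
  moreover have "(k / 7, 1 / 10) \<in> gap m" using k by (simp add: gap_def)
  ultimately show ?thesis by blast
qed

text \<open>A nonnegative coefficient makes the angular velocity nonnegative. This secures a
  positive numerator for \<open>rho_e\<close>.\<close>

lemma rot_nonneg:
  assumes e: "0 \<le> e" "e < 1" and k: "k \<ge> 0"
  shows "hill.rot (ecc_q k e) \<ge> 0"
proof -
  have e': "\<bar>e\<bar> < 1" using e by simp
  interpret hill "ecc_q k e" "2 + \<bar>k\<bar> / (1 - \<bar>e\<bar>)" by (rule hill_ecc_q[OF e'])
  have q: "ecc_q k e t \<ge> 0" for t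
    using one_plus_ecc_cos_pos[OF e', of t] k by (simp add: ecc_q_def)
  have "angle 1 t \<ge> 0" if "t \<ge> 0" for t
  proof -
    have "angle 1 0 \<le> angle 1 t"
      by (rule DERIV_nonneg_imp_nondecreasing[OF that])
         (use angle_deriv[of 1] q in \<open>fastforce simp: logdiff_angle intro!: add_nonneg_nonneg mult_nonneg_nonneg\<close>)
    then show ?thesis by simp
  qed
  then have "\<forall>\<^sub>F t in at_top. 0 \<le> angle 1 t / t"
    by (intro eventually_mono[OF eventually_ge_at_top[of 0]]) simp
  with rot_tendsto[of 1] show ?thesis by (intro tendsto_lowerbound[of "\<lambda>t. angle 1 t / t"]) auto
qed

lemma D_odd_even_dense: "D_dom \<subseteq> closure D_odd_even"
proof
  fix x assume x: "x \<in> D_dom"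
  obtain \<beta> e where xe: "x = (\<beta>, e)" by (cases x)
  note b = D_domD[OF x[unfolded xe]]
  show "x \<in> closure D_odd_even"
    unfolding closure_approachable
  proof (intro allI impI)
    fix \<epsilon> :: real assume \<epsilon>: "\<epsilon> > 0"
    obtain r where r: "r > 0" "ball x r \<subseteq> D_dom" using open_D_dom x open_contains_ball by blast
    define \<delta> where "\<delta> = min r \<epsilon>"
    have \<delta>: "\<delta> > 0" using r \<epsilon> by (simp add: \<delta>_def)
    obtain k' and p n :: int where k': "7 * \<beta> < k'" "k' < 7 * \<beta> + 7 * \<delta>"
      and pn: "odd p" "n > 0" "hill.rot (ecc_q k' e) = of_int p / of_int (2 * n)"
      using odd_even_rotation_dense[of e "7 * \<beta>" "7 * \<delta>"] b \<delta> by auto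
    have d: "dist (k' / 7, e) x < \<delta>"
      using k' by (simp add: xe dist_Pair_Pair dist_real_def)
    then have D: "(k' / 7, e) \<in> D_dom" using r(2) by (auto simp: \<delta>_def dist_commute mem_ball)
    have "rho_e (k' / 7) e = 1 + of_int p / of_int (2 * n)"
      using euler_orbit_linear(1)[of "k' / 7" e] D_domD[OF D] pn(3) by simp
    \<comment> \<open>Adding 1 keeps the numerator odd over the same even denominator.\<close>
    also have "\<dots> = of_int (2 * n + p) / of_int (2 * n)" using pn(2) by (simp add: field_simps)
    finally have \<rho>: "rho_e (k' / 7) e = of_int (2 * n + p) / of_int (2 * n)" .
    have "0 \<le> of_int p / (of_int (2 * n) :: real)" using rot_nonneg[of e k'] b k' pn(3) by simp
    then have "p \<ge> 0" using pn(2) by (simp add: zero_le_divide_iff)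
    then have "2 * n + p > 0" "odd (2 * n + p)" "2 * n > 0" "even (2 * n)" using pn by auto
    then have "(k' / 7, e) \<in> D_odd_even" using D \<rho> unfolding D_odd_even_def by blast
    then show "\<exists>y\<in>D_odd_even. dist y x < \<epsilon>" using d by (intro bexI) (auto simp: \<delta>_def)
  qed
qed

lemma D_odd_even_subset: "D_odd_even \<subseteq> D_rational"
  by (auto simp: D_odd_even_def D_rational_def)

theorem theorem2p9:
  shows "(\<forall>k::int. k \<ge> 1 \<longrightarrow> hyperbolic_locus (of_int k) = {}) \<and>
   ((\<forall>k::int. k \<ge> 2 \<longrightarrow>
      (\<exists>U. openin (top_of_set ({0..1} \<times> {0..<1})) U \<and> U \<noteq> {} \<and>
           U \<subseteq> hyperbolic_locus (of_int k + 1 / 2))) \<and>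
    (\<exists>U. openin (top_of_set D_dom) U \<and> U \<noteq> {} \<and> U \<subseteq> hyperbolic_locus (5 / 2)) \<and>
    (\<exists>U. openin (top_of_set D_dom) U \<and> U \<noteq> {} \<and> U \<subseteq> hyperbolic_locus (7 / 2))) \<and>
   ((D_dom \<subseteq> closure D_rational \<and>
     (\<exists>U. open U \<and> U \<noteq> {} \<and> U \<subseteq> D_rational)) \<and>
    (D_dom \<subseteq> closure D_odd_even \<and>
     (\<exists>U. open U \<and> U \<noteq> {} \<and> U \<subseteq> D_odd_even)))"
proof (intro conjI allI impI)
  fix k :: int assume "k \<ge> 1"
  show "hyperbolic_locus (of_int k) = {}"
  proof (rule ccontr)
    assume "hyperbolic_locus (of_int k) \<noteq> {}"
    then obtain \<beta> e where b: "0 < \<beta>" "\<beta> < 1" "0 \<le> e" "e < 1" and r: "rho_e \<beta> e = of_int k" "euler_hyperbolic \<beta> e"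
      by (auto simp: hyperbolic_locus_def)
    have e': "\<bar>e\<bar> < 1" using b by simp
    have "y1pi (7 * \<beta>) e * v2pi (7 * \<beta>) e < 0" using r(2) euler_orbit_linear(2)[OF b] by simp
    then obtain j :: int where j: "hill.rot (ecc_q (7 * \<beta>) e) = of_int j + 1 / 2"
      using hill.rot_half_integer[OF hill_ecc_q[OF e'], of "7 * \<beta>"] by (auto simp: hill_pi_eq[OF e'])
    \<comment> \<open>Hyperbolicity makes \<open>rho_e\<close> a half-integer; doubling turns this
      into a parity contradiction.\<close>
    have "of_int (2 * k) = (of_int (2 * j + 3) :: real)"
      using r(1) euler_orbit_linear(1)[OF b] j by simp
    then have "2 * k = 2 * j + 3" by (simp only: of_int_eq_iff)
    then show False by presburger
  qed
next
  fix k :: int assume k: "k \<ge> 2"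
  \<comment> \<open>The offset 1 is the rotation of the frame: \<open>gap m\<close> has rotation
    number \<open>m + 3/2\<close>.\<close>
  define m where "m = nat (k - 1)"
  have m: "m \<ge> 1" "real m + 3 / 2 = of_int k + 1 / 2" using k by (simp_all add: m_def)
  have "gap m \<subseteq> {0..1} \<times> {0..<1}" by (auto simp: gap_def)
  then have "openin (top_of_set ({0..1} \<times> {0..<1})) (gap m)" using open_gap by (intro open_subset)
  then show "\<exists>U. openin (top_of_set ({0..1} \<times> {0..<1})) U \<and> U \<noteq> {} \<and> U \<subseteq> hyperbolic_locus (of_int k + 1 / 2)"
    using gap_nonempty[OF m(1)] gap_subset[of m] m(2) by auto
next
  have "openin (top_of_set D_dom) (gap m \<inter> D_dom)" for m
    by (intro open_subset open_Int open_gap open_D_dom) auto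
  then show "\<exists>U. openin (top_of_set D_dom) U \<and> U \<noteq> {} \<and> U \<subseteq> hyperbolic_locus (5 / 2)"
    "\<exists>U. openin (top_of_set D_dom) U \<and> U \<noteq> {} \<and> U \<subseteq> hyperbolic_locus (7 / 2)"
    using gap_D_nonempty[of 1] gap_D_nonempty[of 2] gap_subset[of 1] gap_subset[of 2]
    by (force intro!: exI[of _ "gap 1 \<inter> D_dom"], force intro!: exI[of _ "gap 2 \<inter> D_dom"])
next
  have "gap 1 \<inter> D_dom \<subseteq> D_odd_even"
  proof
    fix x assume x: "x \<in> gap 1 \<inter> D_dom"
    obtain \<beta> e where xe: "x = (\<beta>, e)" by (cases x)
    have "x \<in> hyperbolic_locus (5 / 2)" using gap_subset[of 1] x by auto
    then have "rho_e \<beta> e = of_int 5 / of_int 2" by (simp add: xe hyperbolic_locus_def)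
    moreover have "(5::int) > 0" "odd (5::int)" "(2::int) > 0" "even (2::int)" by auto
    ultimately show "x \<in> D_odd_even" using x unfolding D_odd_even_def xe by blast
  qed
  moreover have "open (gap 1 \<inter> D_dom)" by (intro open_Int open_gap open_D_dom)
  moreover have "gap 1 \<inter> D_dom \<noteq> {}" using gap_D_nonempty by blast
  ultimately show 1: "\<exists>U. open U \<and> U \<noteq> {} \<and> U \<subseteq> D_odd_even" by blast
  show "\<exists>U. open U \<and> U \<noteq> {} \<and> U \<subseteq> D_rational" using 1 D_odd_even_subset by blast
  show 2: "D_dom \<subseteq> closure D_odd_even" by (rule D_odd_even_dense)
  show "D_dom \<subseteq> closure D_rational" using 2 closure_mono[OF D_odd_even_subset] by blast
qed

end
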